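(* Let $n\in\mathbb{N}$, $n\ge 1$, $s\in(0,1)$, $\beta>0$ and let $\Omega\subset\mathbb{R}^n$ be an open set. Let $\Lambda\ge\lambda>0$, $M>0$, $\Gamma>0$ be constants and let $K:\mathbb{R}^n\times\mathbb{R}^n\to[0,+\infty]$ be a measurable function such that (i) $K(x,y)=K(y,x)$ for a.a. $x,y\in\mathbb{R}^n$; (ii) $\lambda\le|x-y|^{n+2s}K(x,y)\le\Lambda$ for a.a. $x,y\in\mathbb{R}^n$ with $|x-y|<1$, and $0\le|x-y|^{n+\beta}K(x,y)\le M$ for a.a. $x,y\in\mathbb{R}^n$ with $|x-y|\ge1$; (iii) $|x-y|^{n+2s}\,|K(x+z,y+z)-K(x,y)|\le\Gamma|z|^s$ for a.a. $x,y,z\in\mathbb{R}^n$ with $|x-y|<1$ and $|z|<1$. Let $f\in L^2(\Omega)$ and let $u\in X(\Omega)\cap L^1_\beta(\mathbb{R}^n)$ be a solution of $\mathcal{E}_K(u,\cdot)=f$ in $\Omega$. Then $u\in N^{2s,2}_{\mathrm{loc}}(\Omega)$ and, for any domain $\Omega'\subset\subset\Omega$, $$\|u\|_{N^{2s,2}(\Omega')}\le C\left(\|u\|_{L^2(\Omega)}+\|u\|_{L^1_\beta(\mathbb{R}^n)}+\|f\|_{L^2(\Omega)}\right),$$ for some constant $C>0$ depending only on $n,s,\beta,\lambda,\Lambda,M,\Gamma,\Omega$ and $\Omega'$.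
   Context: Function spaces attached to $K$. For an open set $U\subset\mathbb{R}^n$, let $\mathscr{C}_U:=(\mathbb{R}^n\times\mathbb{R}^n)\setminus\big((\mathbb{R}^n\setminus U)\times(\mathbb{R}^n\setminus U)\big)$. $X(U)$ is the space of measurable functions $u:\mathbb{R}^n\to\mathbb{R}$ such that $u|_U\in L^2(U)$ and the map $(x,y)\mapsto(u(x)-u(y))\sqrt{K(x,y)}$ belongs to $L^2(\mathscr{C}_U)$. $X_0(U)$ is the subspace of functions in $X(U)$ that vanish a.e. outside $U$. Bilinear form and solutions. For $u\in X(\Omega)$ and $\varphi\in X_0(\Omega)$, $$\mathcal{E}_K(u,\varphi):=\int_{\mathbb{R}^n}\int_{\mathbb{R}^n}(u(x)-u(y))(\varphi(x)-\varphi(y))K(x,y)\,dx\,dy.$$ Given $f\in L^2(\Omega)$, a function $u\in X(\Omega)$ is a solution of $\mathcal{E}_K(u,\cdot)=f$ in $\Omega$ if $\mathcal{E}_K(u,\varphi)=\langle f,\varphi\rangle_{L^2(\Omega)}$ for every $\varphi\in X_0(\Omega)$. Weighted space. $L^1_\beta(\mathbb{R}^n)$ is the space of measurable $u:\mathbb{R}^n\to\mathbb{R}$ with $\|u\|_{L^1_\beta(\mathbb{R}^n)}:=\int_{\mathbb{R}^n}\frac{|u(x)|}{1+|x|^{n+\beta}}\,dx<+\infty$. Nikol'skii spaces. For a domain $U\subset\mathbb{R}^n$ and $z\in\mathbb{R}^n$ let $U_{2z}:=\{x\in U:\ x+z\in U \text{ and } x+2z\in U\}$ and, for $x\in U_{2z}$,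 $\Delta_z^2u(x):=u(x+2z)-2u(x+z)+u(x)$. For $r\in(0,2)$ and $1\le p<+\infty$, $N^{r,p}(U)$ is the space of $u\in L^p(U)$ such that $$[u]_{N^{r,p}(U)}:=\sup_{z\in\mathbb{R}^n\setminus\{0\}}|z|^{-r}\|\Delta_z^2u\|_{L^p(U_{2z})}<+\infty,$$ with norm $\|u\|_{N^{r,p}(U)}:=\|u\|_{L^p(U)}+[u]_{N^{r,p}(U)}$. $u\in N^{r,p}_{\mathrm{loc}}(\Omega)$ means $u|_V\in N^{r,p}(V)$ for any domain $V\subset\subset\Omega$. $V\subset\subset\Omega$ means that the closure of $V$ is compact and contained in $\Omega$. *)

theory Defs
  imports "HOL-Analysis.Analysis"
begin

text \<open>
  "Measurable" and "almost all" refer to Lebesgue measure, also on products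
  (\<^term>\<open>lebesgue :: ((real^'n) \<times> (real^'n)) measure\<close>).  Functions on a set \<open>U\<close> are represented by
  total functions whose values outside \<open>U\<close> do not matter.
\<close>

definition Lp_space :: "real \<Rightarrow> (real^'n) set \<Rightarrow> (real^'n \<Rightarrow> real) set" where
  "Lp_space p U = {g. g \<in> borel_measurable (lebesgue_on U) \<and>
                      integrable (lebesgue_on U) (\<lambda>x. \<bar>g x\<bar> powr p)}"

definition Lp_norm :: "real \<Rightarrow> (real^'n) set \<Rightarrow> (real^'n \<Rightarrow> real) \<Rightarrow> real" where
  "Lp_norm p U g = (\<integral>x. \<bar>g x\<bar> powr p \<partial>lebesgue_on U) powr (1 / p)"

definition cross_set :: "(real^'n) set \<Rightarrow> ((real^'n) \<times> (real^'n)) set" where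
  "cross_set U = UNIV - (- U) \<times> (- U)"

text \<open>
  The last condition says that the square of \<open>(u x - u y) * sqrt (K (x, y))\<close> has finite integral
  over \<^term>\<open>cross_set U\<close>; it is kept in \<^typ>\<open>ennreal\<close> because \<open>K\<close> may take the value \<open>\<infinity>\<close>.
  The map itself is measurable whenever \<open>K\<close> and \<open>u\<close> are.
\<close>

definition X_space ::
    "((real^'n) \<times> (real^'n) \<Rightarrow> ennreal) \<Rightarrow> (real^'n) set \<Rightarrow> (real^'n \<Rightarrow> real) set" where
  "X_space K U = {u. u \<in> borel_measurable lebesgue \<and> u \<in> Lp_space 2 U \<and>
     (\<integral>\<^sup>+(x, y) \<in> cross_set U. ennreal ((u x - u y)\<^sup>2) * K (x, y) \<partial>lebesgue) < \<infinity>}"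

definition X0_space ::
    "((real^'n) \<times> (real^'n) \<Rightarrow> ennreal) \<Rightarrow> (real^'n) set \<Rightarrow> (real^'n \<Rightarrow> real) set" where
  "X0_space K U = {u \<in> X_space K U. AE x in lebesgue. x \<notin> U \<longrightarrow> u x = 0}"

text \<open>
  For \<open>u \<in> X_space K U\<close> and \<open>\<phi> \<in> X0_space K U\<close> the integrand is absolutely integrable, and it vanishes
  almost everywhere on \<open>{K = \<infinity>}\<close> (with \<open>0 \<cdot> \<infinity> = 0\<close>), so \<^const>\<open>enn2real\<close> loses nothing.
\<close>

definition energy_form ::
    "((real^'n) \<times> (real^'n) \<Rightarrow> ennreal) \<Rightarrow> (real^'n \<Rightarrow> real) \<Rightarrow> (real^'n \<Rightarrow> real) \<Rightarrow> real" where
  "energy_form K u \<phi> =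
     (\<integral>(x, y). (u x - u y) * (\<phi> x - \<phi> y) * enn2real (K (x, y)) \<partial>lebesgue)"

definition is_solution ::
    "((real^'n) \<times> (real^'n) \<Rightarrow> ennreal) \<Rightarrow> (real^'n) set \<Rightarrow> (real^'n \<Rightarrow> real) \<Rightarrow>
     (real^'n \<Rightarrow> real) \<Rightarrow> bool" where
  "is_solution K \<Omega> f u \<longleftrightarrow> u \<in> X_space K \<Omega> \<and>
     (\<forall>\<phi> \<in> X0_space K \<Omega>. energy_form K u \<phi> = (\<integral>x. f x * \<phi> x \<partial>lebesgue_on \<Omega>))"

definition weighted_L1_space :: "real \<Rightarrow> (real^'n \<Rightarrow> real) set" where
  "weighted_L1_space \<beta> = {u. u \<in> borel_measurable lebesgue \<and>
     integrable lebesgue (\<lambda>x. \<bar>u x\<bar> / (1 + norm x powr (real CARD('n) + \<beta>)))}"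

definition weighted_L1_norm :: "real \<Rightarrow> (real^'n \<Rightarrow> real) \<Rightarrow> real" where
  "weighted_L1_norm \<beta> u = (\<integral>x. \<bar>u x\<bar> / (1 + norm x powr (real CARD('n) + \<beta>)) \<partial>lebesgue)"

definition domain_set :: "(real^'n) set \<Rightarrow> bool" where
  "domain_set U \<longleftrightarrow> open U \<and> connected U \<and> U \<noteq> {}"

definition compactly_contained :: "(real^'n) set \<Rightarrow> (real^'n) set \<Rightarrow> bool" where
  "compactly_contained V U \<longleftrightarrow> compact (closure V) \<and> closure V \<subseteq> U"

definition shift_set :: "(real^'n) set \<Rightarrow> real^'n \<Rightarrow> (real^'n) set" where
  "shift_set U z = {x \<in> U. x + z \<in> U \<and> x + 2 *\<^sub>R z \<in> U}"

definition second_diff :: "real^'n \<Rightarrow> (real^'n \<Rightarrow> real) \<Rightarrow> real^'n \<Rightarrow> real" where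
  "second_diff z u x = u (x + 2 *\<^sub>R z) - 2 * u (x + z) + u x"

definition nikolskii_quotient ::
    "real \<Rightarrow> real \<Rightarrow> (real^'n) set \<Rightarrow> (real^'n \<Rightarrow> real) \<Rightarrow> real^'n \<Rightarrow> real" where
  "nikolskii_quotient r p U u z = norm z powr (- r) * Lp_norm p (shift_set U z) (second_diff z u)"

text \<open>
  For \<open>u \<in> Lp_space p U\<close> with \<open>U\<close> open and \<open>p \<ge> 1\<close> each second difference lies in \<open>L\<^sup>p\<close> of its shift set,
  so finiteness of the supremum is boundedness of the real-valued quotients.
\<close>

definition nikolskii_space :: "real \<Rightarrow> real \<Rightarrow> (real^'n) set \<Rightarrow> (real^'n \<Rightarrow> real) set" where
  "nikolskii_space r p U =
     {u \<in> Lp_space p U. bdd_above (nikolskii_quotient r p U u ` (UNIV - {0}))}"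

definition nikolskii_seminorm ::
    "real \<Rightarrow> real \<Rightarrow> (real^'n) set \<Rightarrow> (real^'n \<Rightarrow> real) \<Rightarrow> real" where
  "nikolskii_seminorm r p U u = (SUP z \<in> UNIV - {0}. nikolskii_quotient r p U u z)"

definition nikolskii_norm ::
    "real \<Rightarrow> real \<Rightarrow> (real^'n) set \<Rightarrow> (real^'n \<Rightarrow> real) \<Rightarrow> real" where
  "nikolskii_norm r p U u = Lp_norm p U u + nikolskii_seminorm r p U u"

definition nikolskii_loc_space :: "real \<Rightarrow> real \<Rightarrow> (real^'n) set \<Rightarrow> (real^'n \<Rightarrow> real) set" where
  "nikolskii_loc_space r p \<Omega> =
     {u. \<forall>V. domain_set V \<and> compactly_contained V \<Omega> \<longrightarrow> u \<in> nikolskii_space r p V}"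

end

theory Submission
  imports Defs
begin

text \<open>
  Cut the kernel at a small radius \<open>r\<close>. The part of the form with \<open>\<bar>x - y\<bar> \<ge> r\<close> is bounded by the data times
  the \<open>L\<^sup>2\<close> norm of the test function, so near \<open>\<Omega>'\<close> the solution satisfies
  \<open>\<bar>E (u, \<phi>)\<bar> \<le> N \<parallel>\<phi>\<parallel>\<close> for the short-range form \<open>E\<close>, which depends on \<open>u\<close> only near the support of \<open>\<phi>\<close>.
  Testing with \<open>\<eta>\<^sup>2 u\<close> gives a Caccioppoli bound for the Gagliardo seminorm of \<open>\<eta> u\<close>.
  For \<open>v = u (\<cdot> + z) - u\<close> and \<open>\<psi> = \<eta>\<^sup>2 v\<close>, a change of variables gives
  \<open>E (v, \<psi>) = E (u, \<psi> (\<cdot> - z) - \<psi>)\<close> plus an error which the regularity of the kernel bounds by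
  \<open>\<bar>z\<bar>\<^sup>s [u] [\<psi>]\<close>. Since an \<open>L\<^sup>2\<close> difference with step \<open>z\<close> costs \<open>\<bar>z\<bar>\<^sup>s\<close> times the seminorm,
  this yields \<open>[\<eta> v] \<le> C \<bar>z\<bar>\<^sup>s N\<close>, and differencing \<open>\<eta> v\<close> once more gives the second factor \<open>\<bar>z\<bar>\<^sup>s\<close>.
\<close>

section \<open>Lebesgue measure on products\<close>

text \<open>The solution is known as an L^2 function of finite energy inside \<Omega> and only as a
  weighted L^1 function outside, so its translates have no common Sobolev norm. The cut at
  \<open>r\<close> removes this obstacle: on tests supported well inside, the short-range form does
  not distinguish u from a cut-off multiple of u, and that multiple lies in a translation-invariant
  space on all of R^n, so no domain of definition has to follow the shifts. The gain in the
  difference step rests on the equation bounding the form by the L^2 norm of the test function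
  alone: differencing the test function then gains |z|^s, where boundedness of the form would gain
  nothing. The seminorm of \<psi> on the right is in turn controlled by that of \<eta> v and is
  absorbed by Young's inequality. Only steps shorter than \<open>r\<close> need this; for longer
  ones |z|^(-2s) is bounded. Two gaps separate the hypotheses from this argument: the data are
  Lebesgue measurable with an extended-valued kernel, and the kernel regularity holds for almost
  every z, whereas the Nikol'skii seminorm is a supremum over all z.\<close>

lemma lborel_distr_isometric_affine:
  fixes t :: "'a::euclidean_space" and c :: real
  assumes "\<bar>c\<bar> = 1"
  shows "distr lborel borel (\<lambda>x. t + c *\<^sub>R x) = lborel"
proof -
  have "c \<noteq> 0" using assms by auto
  from lborel_affine[OF this, of t] assms show ?thesis
    by (simp add: density_1)
qed

lemma nn_integral_lborel_affine1:
  fixes t :: "'a::euclidean_space" and c :: real and f :: "'a \<Rightarrow> ennreal"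
  assumes "\<bar>c\<bar> = 1" and [measurable]: "f \<in> borel_measurable borel"
  shows "(\<integral>\<^sup>+x. f (t + c *\<^sub>R x) \<partial>lborel) = (\<integral>\<^sup>+x. f x \<partial>lborel)"
  by (subst (2) lborel_distr_isometric_affine[OF assms(1), of t, symmetric])
     (simp add: nn_integral_distr)

lemma integrable_lborel_shift:
  fixes t :: "'a::euclidean_space" and f :: "'a \<Rightarrow> real"
  assumes "integrable lborel f"
  shows "integrable lborel (\<lambda>x. f (x + t))"
  using integrable_distr[of "(+) t" lborel borel f] assms
  by (simp add: lborel_distr_plus add.commute)

lemma integral_lborel_shift:
  fixes t :: "'a::euclidean_space" and f :: "'a \<Rightarrow> real"
  assumes "f \<in> borel_measurable borel"
  shows "(\<integral>x. f (x + t) \<partial>lborel) = (\<integral>x. f x \<partial>lborel)"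
  using integral_distr[of "(+) t" lborel borel f] assms
  by (simp add: lborel_distr_plus add.commute)

lemma AE_lborel_shift:
  fixes t :: "'a::euclidean_space"
  assumes "AE x in lborel. P x"
  shows "AE x in lborel. P (x + t)"
proof -
  have "AE x in distr lborel borel ((+) t). P x"
    using assms unfolding lborel_distr_plus .
  then have "AE x in lborel. P (t + x)"
    by (rule AE_distrD[rotated]) simp
  then show ?thesis by (simp add: add.commute)
qed

lemma AE_lborel_reflect:
  fixes t :: "'a::euclidean_space"
  assumes "AE x in lborel. P x"
  shows "AE x in lborel. P (t - x)"
proof -
  have "AE x in distr lborel borel (\<lambda>x. t + (-1) *\<^sub>R x). P x"
    using assms by (subst lborel_distr_isometric_affine) auto
  then have "AE x in lborel. P (t + (-1) *\<^sub>R x)"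
    by (rule AE_distrD[rotated]) simp
  then show ?thesis by simp
qed

lemma lborel_distr_swap:
  "distr lborel borel (\<lambda>p. (snd p, fst p)) = (lborel :: ('a::euclidean_space \<times> 'a) measure)"
proof -
  have "distr lborel borel (\<lambda>(x, y). (y, x)) = distr lborel (lborel :: ('a \<times> 'a) measure) (\<lambda>(x, y). (y, x))"
    by (rule distr_cong) auto
  also have "\<dots> = lborel"
    using lborel_pair.distr_pair_swap[where 'a='a and 'b='a] by (simp add: lborel_prod)
  finally show ?thesis by (simp add: case_prod_unfold)
qed

lemma measurable_swap_borel [measurable]:
  "(\<lambda>p. (snd p, fst p)) \<in> borel_measurable (borel :: ('a::euclidean_space \<times> 'a) measure)"
  by (simp add: borel_prod[symmetric])

lemma integral_lborel_swap:
  fixes f :: "'a::euclidean_space \<times> 'a \<Rightarrow> real"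
  assumes [measurable]: "f \<in> borel_measurable borel"
  shows "(\<integral>(x, y). f (y, x) \<partial>lborel) = (\<integral>p. f p \<partial>lborel)"
  by (subst (2) lborel_distr_swap[symmetric], subst integral_distr) (simp_all add: case_prod_unfold)

lemma integrable_lborel_swap:
  fixes f :: "'a::euclidean_space \<times> 'a \<Rightarrow> real"
  assumes "integrable lborel f"
  shows "integrable lborel (\<lambda>(x, y). f (y, x))"
proof -
  have "integrable (distr lborel borel (\<lambda>p. (snd p, fst p))) f"
    using assms unfolding lborel_distr_swap .
  then have "integrable lborel (\<lambda>p. f (snd p, fst p))"
    by (rule integrable_distr[rotated]) simp
  then show ?thesis by (simp add: case_prod_unfold)
qed

lemma AE_lborel_swap:
  assumes "AE (x, y) in (lborel :: ('a::euclidean_space \<times> 'a) measure). P x y"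
  shows "AE (x, y) in (lborel :: ('a \<times> 'a) measure). P y x"
proof -
  have "AE p in distr lborel borel (\<lambda>p. (snd p, fst p)). case p of (x, y) \<Rightarrow> P x (y::'a)"
    using assms unfolding lborel_distr_swap .
  then have "AE p in (lborel :: ('a \<times> 'a) measure). case (snd p, fst p) of (x, y) \<Rightarrow> P x y"
    by (rule AE_distrD[rotated]) simp
  then show ?thesis by (simp add: case_prod_unfold)
qed

section \<open>Tonelli, null sets and convolution-type integrals on products\<close>

lemma nn_integral_lborel_pair:
  fixes f :: "'a::euclidean_space \<times> 'b::euclidean_space \<Rightarrow> ennreal"
  assumes "f \<in> borel_measurable borel"
  shows "(\<integral>\<^sup>+p. f p \<partial>lborel) = (\<integral>\<^sup>+x. \<integral>\<^sup>+y. f (x, y) \<partial>lborel \<partial>lborel)"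
  using lborel.nn_integral_fst[of f lborel] assms by (simp add: lborel_prod)

lemma AE_lborel_pair_fst:
  assumes "AE x in (lborel :: 'a::euclidean_space measure). P x"
  shows "AE p in (lborel :: ('a \<times> 'b::euclidean_space) measure). P (fst p)"
proof -
  obtain N where N: "N \<in> null_sets lborel" "{x. \<not> P x} \<subseteq> N"
    using assms unfolding eventually_ae_filter by auto
  have [measurable]: "N \<in> sets borel" using N by auto
  have "AE x in lborel. x \<notin> N" using N(1) by (rule AE_not_in)
  then have "AE x in lborel. AE y in (lborel :: 'b measure). x \<notin> N"
    by eventually_elim simp
  then have "AE p in (lborel :: 'a measure) \<Otimes>\<^sub>M (lborel :: 'b measure). fst p \<notin> N"
  proof (rule lborel_pair.AE_pair_measure[rotated, of "\<lambda>p. fst p \<notin> N", unfolded fst_conv])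
    show "{p \<in> space ((lborel :: 'a measure) \<Otimes>\<^sub>M (lborel :: 'b measure)). fst p \<notin> N} \<in> sets (lborel \<Otimes>\<^sub>M lborel)"
      by measurable
  qed
  then show ?thesis unfolding lborel_prod by eventually_elim (use N in auto)
qed

lemma AE_lborel_pair_snd:
  assumes "AE x in (lborel :: 'a::euclidean_space measure). P x"
  shows "AE p in (lborel :: ('a \<times> 'a) measure). P (snd p)"
  using AE_lborel_swap[of "\<lambda>x y. P x"] AE_lborel_pair_fst[OF assms, where 'b='a]
  by (simp add: case_prod_unfold)

lemma AE_lborel_diagonal:
  "AE (x, y) in (lborel :: ('a::euclidean_space \<times> 'a) measure). x \<noteq> y"
proof -
  have "AE p in (lborel :: 'a measure) \<Otimes>\<^sub>M lborel. fst p \<noteq> snd p"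
  proof (rule lborel_pair.AE_pair_measure)
    have "{p \<in> space (borel \<Otimes>\<^sub>M borel). fst p - snd p \<noteq> (0::'a)} \<in> sets (borel \<Otimes>\<^sub>M borel)"
      by measurable
    then show "{p \<in> space ((lborel :: 'a measure) \<Otimes>\<^sub>M lborel). fst p \<noteq> snd p} \<in> sets ((lborel :: 'a measure) \<Otimes>\<^sub>M lborel)"
      by (simp add: space_pair_measure cong: sets_pair_measure_cong)
    show "AE x in lborel. AE y in lborel. fst (x, y) \<noteq> (snd (x, y) :: 'a)"
    proof (rule AE_I2)
      fix x :: 'a
      show "AE y in lborel. fst (x, y) \<noteq> snd (x, y)"
        using AE_lborel_singleton[of x] by eventually_elim auto
    qed
  qed
  then show ?thesis unfolding lborel_prod case_prod_unfold .
qed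

text \<open>For fixed x, invariance under the reflection y -> x - y removes x from the inner
  integral. Every kernel majorant below depends on x - y only and is integrated in this way.\<close>

lemma nn_integral_mult_diff:
  fixes f g :: "'a::euclidean_space \<Rightarrow> ennreal"
  assumes [measurable]: "f \<in> borel_measurable borel" "g \<in> borel_measurable borel"
  shows "(\<integral>\<^sup>+(x, y). f x * g (x - y) \<partial>lborel) = (\<integral>\<^sup>+x. f x \<partial>lborel) * (\<integral>\<^sup>+x. g x \<partial>lborel)"
proof -
  have "(\<lambda>(x, y). f x * g (x - y)) \<in> borel_measurable borel"
    by (simp add: borel_prod[symmetric])
  then have "(\<integral>\<^sup>+(x, y). f x * g (x - y) \<partial>lborel) = (\<integral>\<^sup>+x. \<integral>\<^sup>+y. f x * g (x - y) \<partial>lborel \<partial>lborel)"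
    by (subst nn_integral_lborel_pair) auto
  also have "\<dots> = (\<integral>\<^sup>+x. f x * (\<integral>\<^sup>+y. g y \<partial>lborel) \<partial>lborel)"
  proof (rule nn_integral_cong)
    fix x
    have "(\<integral>\<^sup>+y. f x * g (x - y) \<partial>lborel) = f x * (\<integral>\<^sup>+y. g (x - y) \<partial>lborel)"
      by (rule nn_integral_cmult) auto
    then show "(\<integral>\<^sup>+y. f x * g (x - y) \<partial>lborel) = f x * (\<integral>\<^sup>+y. g y \<partial>lborel)"
      using nn_integral_lborel_affine1[of "-1" g x] by simp
  qed
  also have "\<dots> = (\<integral>\<^sup>+x. f x \<partial>lborel) * (\<integral>\<^sup>+x. g x \<partial>lborel)"
    by (rule nn_integral_multc) auto
  finally show ?thesis .
qed

lemma has_bochner_integral_mult_diff: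
  fixes f g :: "'a::euclidean_space \<Rightarrow> real"
  assumes "integrable lborel f" "integrable lborel g" "\<And>x. 0 \<le> f x" "\<And>x. 0 \<le> g x"
  shows "has_bochner_integral lborel (\<lambda>(x, y). f x * g (x - y)) ((\<integral>x. f x \<partial>lborel) * (\<integral>x. g x \<partial>lborel))"
proof (rule has_bochner_integral_nn_integral)
  have [measurable]: "f \<in> borel_measurable borel" "g \<in> borel_measurable borel"
    using assms(1,2) by (auto dest: borel_measurable_integrable)
  show "(\<lambda>(x, y). f x * g (x - y)) \<in> borel_measurable lborel"
    by (simp add: lborel_prod[symmetric])
  have "(\<integral>\<^sup>+p. ennreal (case p of (x, y) \<Rightarrow> f x * g (x - y)) \<partial>lborel)
      = (\<integral>\<^sup>+(x, y). ennreal (f x) * ennreal (g (x - y)) \<partial>lborel)"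
    by (intro nn_integral_cong) (auto simp: ennreal_mult assms)
  also have "\<dots> = (\<integral>\<^sup>+x. f x \<partial>lborel) * (\<integral>\<^sup>+x. g x \<partial>lborel)"
    by (rule nn_integral_mult_diff) auto
  also have "\<dots> = ennreal ((\<integral>x. f x \<partial>lborel) * (\<integral>x. g x \<partial>lborel))"
    using assms by (simp add: nn_integral_eq_integral ennreal_mult)
  finally show "(\<integral>\<^sup>+p. ennreal (case p of (x, y) \<Rightarrow> f x * g (x - y)) \<partial>lborel)
      = ennreal ((\<integral>x. f x \<partial>lborel) * (\<integral>x. g x \<partial>lborel))" .
qed (use assms in auto)

text \<open>Exchanging the variables turns x - y into y - x, and evenness of \<open>g\<close>
  restores it.\<close>

lemma has_bochner_integral_mult_diff':
  fixes f g :: "'a::euclidean_space \<Rightarrow> real"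
  assumes "integrable lborel f" "integrable lborel g" "\<And>x. 0 \<le> f x" "\<And>x. 0 \<le> g x"
    and ev: "\<And>x. g (- x) = g x"
  shows "has_bochner_integral lborel (\<lambda>(x, y). f y * g (x - y)) ((\<integral>x. f x \<partial>lborel) * (\<integral>x. g x \<partial>lborel))"
proof -
  have h: "has_bochner_integral lborel (\<lambda>(x, y). f x * g (x - y)) ((\<integral>x. f x \<partial>lborel) * (\<integral>x. g x \<partial>lborel))"
    using has_bochner_integral_mult_diff[OF assms(1-4)] .
  have e: "(\<lambda>(x, y). f y * g (x - y)) = (\<lambda>(x, y). (\<lambda>(x, y). f x * g (x - y)) (y, x))"
    using ev by (auto simp: fun_eq_iff) (metis minus_diff_eq)
  show ?thesis
    unfolding e has_bochner_integral_iff
    using h integrable_lborel_swap[of "\<lambda>(x, y). f x * g (x - y)"]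
      integral_lborel_swap[of "\<lambda>(x, y). f x * g (x - y)"]
    by (auto simp: has_bochner_integral_iff dest: borel_measurable_integrable)
qed

lemma Cauchy_Schwarz_integral:
  fixes f g :: "'a \<Rightarrow> real"
  assumes f: "integrable M (\<lambda>x. (f x)\<^sup>2)" and g: "integrable M (\<lambda>x. (g x)\<^sup>2)"
    and [measurable]: "f \<in> borel_measurable M" "g \<in> borel_measurable M"
  shows "integrable M (\<lambda>x. f x * g x)"
    and "(\<integral>x. \<bar>f x * g x\<bar> \<partial>M) \<le> sqrt (\<integral>x. (f x)\<^sup>2 \<partial>M) * sqrt (\<integral>x. (g x)\<^sup>2 \<partial>M)"
proof -
  have ab: "\<bar>f x * g x\<bar> \<le> (f x)\<^sup>2 + (g x)\<^sup>2" for x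
  proof -
    have "0 \<le> (\<bar>f x\<bar> - \<bar>g x\<bar>)\<^sup>2" by simp
    then have "2 * (\<bar>f x\<bar> * \<bar>g x\<bar>) \<le> (f x)\<^sup>2 + (g x)\<^sup>2" by (simp add: power2_diff)
    moreover have "0 \<le> \<bar>f x\<bar> * \<bar>g x\<bar>" by simp
    ultimately show ?thesis unfolding abs_mult by linarith
  qed
  show i: "integrable M (\<lambda>x. f x * g x)"
    by (rule Bochner_Integration.integrable_bound[OF Bochner_Integration.integrable_add[OF f g]])
       (use ab in \<open>auto intro!: AE_I2\<close>)
  let ?I = "\<integral>x. \<bar>f x * g x\<bar> \<partial>M" and ?F = "\<integral>x. (f x)\<^sup>2 \<partial>M" and ?G = "\<integral>x. (g x)\<^sup>2 \<partial>M"
  have "(\<integral>\<^sup>+x. ennreal \<bar>f x\<bar> * ennreal \<bar>g x\<bar> \<partial>M)\<^sup>2 \<le> (\<integral>\<^sup>+x. (ennreal \<bar>f x\<bar>)\<^sup>2 \<partial>M) * (\<integral>\<^sup>+x. (ennreal \<bar>g x\<bar>)\<^sup>2 \<partial>M)"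
    by (rule Cauchy_Schwarz_nn_integral) auto
  also have "(\<lambda>x. ennreal \<bar>f x\<bar> * ennreal \<bar>g x\<bar>) = (\<lambda>x. ennreal \<bar>f x * g x\<bar>)"
    by (simp add: ennreal_mult[symmetric] abs_mult)
  also have "(\<integral>\<^sup>+x. ennreal \<bar>f x * g x\<bar> \<partial>M) = ennreal ?I"
    using i by (intro nn_integral_eq_integral) auto
  also have "(\<integral>\<^sup>+x. (ennreal \<bar>f x\<bar>)\<^sup>2 \<partial>M) = ennreal ?F"
    using f by (simp add: ennreal_power nn_integral_eq_integral)
  also have "(\<integral>\<^sup>+x. (ennreal \<bar>g x\<bar>)\<^sup>2 \<partial>M) = ennreal ?G"
    using g by (simp add: ennreal_power nn_integral_eq_integral)
  finally have "?I\<^sup>2 \<le> ?F * ?G"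
    by (simp add: ennreal_power ennreal_mult[symmetric])
  then have "?I \<le> sqrt (?F * ?G)" by (rule real_le_rsqrt)
  then show "?I \<le> sqrt ?F * sqrt ?G" by (simp add: real_sqrt_mult)
qed

section \<open>Integrability of powers of the norm\<close>

text \<open>Dyadic annuli: on the j-th one the power is comparable to its value at the outer radius
  \<open>R * q ^ j\<close>, and the volume of the enclosing ball makes the sum geometric with ratio
  \<open>q powr (e + DIM('a))\<close>. The choice q = 1/2 treats the origin, q = 2 treats
  infinity.\<close>

lemma integrable_radial_powr:
  fixes e q R :: real and A :: "'a::euclidean_space set"
  assumes q: "0 < q" "q powr (e + DIM('a)) < 1" and R: "0 < R" and A[measurable]: "A \<in> sets borel"
    and cov: "\<And>h. h \<in> A \<Longrightarrow> \<exists>j. R * q ^ j / 2 \<le> norm h \<and> norm h \<le> R * q ^ j"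
  shows "integrable lborel (\<lambda>h. indicator A h * norm h powr e)"
proof (rule integrableI_bounded)
  show "(\<lambda>h. indicator A h * norm h powr e) \<in> borel_measurable lborel" by measurable
  \<comment> \<open>Bounds t powr e for 1/2 \<le> t \<le> 1 whatever the sign of e.\<close>
  define c where "c = 2 powr \<bar>e\<bar>"
  define V where "V = unit_ball_vol (DIM('a))"
  define p where "p = e + DIM('a)"
  have V: "0 \<le> V" by (simp add: V_def)
  have c: "0 \<le> c" by (simp add: c_def)
  define r where "r j = R * q ^ j" for j :: nat
  have r: "0 < r j" for j using q R by (simp add: r_def)
  have pw: "norm h powr e \<le> c * r j powr e" if h: "r j / 2 \<le> norm h" "norm h \<le> r j" for h :: 'a and j
  proof -
    have "(norm h / r j) powr e \<le> c"
    proof (cases "e \<ge> 0")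
      case True
      then have "(norm h / r j) powr e \<le> 1 powr e" using h r[of j] by (intro powr_mono2) auto
      also have "\<dots> \<le> c" using True by (simp add: c_def ge_one_powr_ge_zero)
      finally show ?thesis .
    next
      case False
      then have "(norm h / r j) powr e \<le> (1/2) powr e"
        using h r[of j] by (intro powr_mono2') (auto simp: field_simps)
      also have "\<dots> = c" using False by (simp add: c_def powr_divide powr_minus_divide)
      finally show ?thesis .
    qed
    then have "(norm h / r j) powr e * r j powr e \<le> c * r j powr e"
      by (intro mult_right_mono) auto
    then show ?thesis using r[of j] by (simp add: powr_divide)
  qed
  define t where "t j = c * V * R powr p * (q powr p) ^ j" for j :: nat
  have t0: "0 \<le> t j" for j using c V by (simp add: t_def)
  have "(\<integral>\<^sup>+h. ennreal (norm (indicator A h * norm h powr e)) \<partial>lborel)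
     \<le> (\<integral>\<^sup>+h. (\<Sum>j. ennreal (c * r j powr e) * indicator (cball (0::'a) (r j)) h) \<partial>lborel)"
  proof (rule nn_integral_mono)
    fix h :: 'a
    show "ennreal (norm (indicator A h * norm h powr e)) \<le> (\<Sum>j. ennreal (c * r j powr e) * indicator (cball (0::'a) (r j)) h)"
    proof (cases "h \<in> A")
      case True
      then obtain j where j: "r j / 2 \<le> norm h" "norm h \<le> r j" using cov r_def by auto
      then have "ennreal (norm (indicator A h * norm h powr e)) \<le> ennreal (c * r j powr e) * indicator (cball (0::'a) (r j)) h"
        using True pw[OF j] by (auto intro!: ennreal_leI)
      also have "\<dots> \<le> (\<Sum>j. ennreal (c * r j powr e) * indicator (cball (0::'a) (r j)) h)"
        using sum_le_suminf[of "\<lambda>j. ennreal (c * r j powr e) * indicator (cball (0::'a) (r j)) h" "{j}"]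
        by (simp only: summableI finite.emptyI finite_insert zero_le simp_thms sum.insert sum.empty
            empty_iff not_False_eq_True add_0_right)
      finally show ?thesis .
    qed auto
  qed
  also have "\<dots> = (\<Sum>j. \<integral>\<^sup>+h. ennreal (c * r j powr e) * indicator (cball (0::'a) (r j)) h \<partial>lborel)"
  proof (rule nn_integral_suminf)
    show "(\<lambda>h. ennreal (c * r j powr e) * indicator (cball (0::'a) (r j)) h) \<in> borel_measurable lborel" for j
      by (intro borel_measurable_times_ennreal borel_measurable_const borel_measurable_indicator) simp
  qed
  also have "\<dots> = (\<Sum>j. ennreal (t j))"
  proof (rule suminf_cong)
    fix j
    have "(\<integral>\<^sup>+h. ennreal (c * r j powr e) * indicator (cball (0::'a) (r j)) h \<partial>lborel)
       = ennreal (c * r j powr e) * ennreal (V * r j ^ DIM('a))"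
      using r[of j] by (subst nn_integral_cmult_indicator) (auto simp: emeasure_cball V_def)
    also have "\<dots> = ennreal (c * V * (r j powr e * r j powr DIM('a)))"
      using c V r[of j] by (simp add: ennreal_mult[symmetric] powr_realpow ac_simps)
    also have "r j powr e * r j powr DIM('a) = r j powr p"
      by (simp add: p_def powr_add)
    also have "\<dots> = R powr p * (q powr p) ^ j"
    proof -
      have "(q ^ j) powr p = (q powr p) ^ j"
        using q by (induction j) (auto simp: powr_mult)
      then show ?thesis using R q by (simp add: r_def powr_mult)
    qed
    finally show "(\<integral>\<^sup>+h. ennreal (c * r j powr e) * indicator (cball (0::'a) (r j)) h \<partial>lborel) = ennreal (t j)"
      by (simp add: t_def ac_simps)
  qed
  also have "\<dots> = ennreal (\<Sum>j. t j)"
    using q t0 by (intro suminf_ennreal2) (auto simp: t_def p_def intro!: summable_mult summable_geometric)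
  also have "\<dots> < \<infinity>" by simp
  finally show "(\<integral>\<^sup>+h. ennreal (norm (indicator A h * norm h powr e)) \<partial>lborel) < \<infinity>" .
qed

lemma integrable_powr_near:
  fixes e r :: real
  assumes "- real DIM('a) < e" "0 < r"
  shows "integrable lborel (\<lambda>h::'a::euclidean_space. if norm h < r then norm h powr e else 0)"
proof -
  \<comment> \<open>The origin lies in no annulus; it can be left out because
    \<open>0 powr e = 0\<close>.\<close>
  let ?A = "{h::'a. 0 < norm h \<and> norm h < r}"
  have "integrable lborel (\<lambda>h. indicator ?A h * norm h powr e)"
  proof (rule integrable_radial_powr[of "1/2" _ r])
    have "(1/2::real) powr (e + real DIM('a)) < (1/2) powr 0"
      using assms by (intro powr_less_mono') auto
    then show "(1/2::real) powr (e + real DIM('a)) < 1" by simp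
    show "?A \<in> sets borel" by measurable
    fix h assume h: "h \<in> ?A"
    obtain j where "(1/2::real) ^ j < norm h / r"
      using real_arch_pow_inv[of "norm h / r" "1/2"] h assms by auto
    then have ex: "\<exists>j. r * (1/2) ^ j / 2 \<le> norm h"
      using assms h by (intro exI[of _ j]) (auto simp: field_simps)
    \<comment> \<open>The first annulus whose inner radius is below \<open>norm h\<close>; failure
      of the inequality at the preceding index is exactly the outer bound.\<close>
    define j where "j = (LEAST j. r * (1/2) ^ j / 2 \<le> norm h)"
    have 1: "r * (1/2) ^ j / 2 \<le> norm h" unfolding j_def by (rule LeastI_ex[OF ex])
    have "norm h \<le> r * (1/2) ^ j"
    proof (cases j)
      case 0 then show ?thesis using h by auto
    next
      case (Suc i)
      then have "\<not> r * (1/2) ^ i / 2 \<le> norm h"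
        using not_less_Least[of i "\<lambda>j. r * (1/2) ^ j / 2 \<le> norm h"] by (simp add: j_def)
      then show ?thesis using Suc by simp
    qed
    with 1 show "\<exists>j. r * (1/2) ^ j / 2 \<le> norm h \<and> norm h \<le> r * (1/2) ^ j" by blast
  qed (use assms in auto)
  then show ?thesis
    by (rule Bochner_Integration.integrable_cong[THEN iffD1, rotated 2]) (auto simp: indicator_def)
qed

lemma integrable_powr_far:
  fixes e r :: real
  assumes "e < - real DIM('a)" "0 < r"
  shows "integrable lborel (\<lambda>h::'a::euclidean_space. if norm h < r then 0 else norm h powr e)"
proof -
  let ?A = "{h::'a. r \<le> norm h}"
  have "integrable lborel (\<lambda>h. indicator ?A h * norm h powr e)"
  proof (rule integrable_radial_powr[of 2 _ r])
    have "(2::real) powr (e + real DIM('a)) < 2 powr 0"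
      using assms by (intro powr_less_mono) auto
    then show "(2::real) powr (e + real DIM('a)) < 1" by simp
    show "?A \<in> sets borel" by measurable
    fix h assume h: "h \<in> ?A"
    obtain j where "norm h / r < (2::real) ^ j"
      using real_arch_pow[of 2 "norm h / r"] by auto
    then have ex: "\<exists>j. norm h \<le> r * 2 ^ j"
      using assms h by (intro exI[of _ j]) (auto simp: field_simps)
    define j where "j = (LEAST j. norm h \<le> r * 2 ^ j)"
    have 1: "norm h \<le> r * 2 ^ j" unfolding j_def by (rule LeastI_ex[OF ex])
    have "r * 2 ^ j / 2 \<le> norm h"
    proof (cases j)
      case 0 then show ?thesis using h assms by auto
    next
      case (Suc i)
      then have "\<not> norm h \<le> r * 2 ^ i"
        using not_less_Least[of i "\<lambda>j. norm h \<le> r * 2 ^ j"] by (simp add: j_def)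
      then show ?thesis using Suc by simp
    qed
    with 1 show "\<exists>j. r * 2 ^ j / 2 \<le> norm h \<and> norm h \<le> r * 2 ^ j" by blast
  qed (use assms in auto)
  then show ?thesis
    by (rule Bochner_Integration.integrable_cong[THEN iffD1, rotated 2]) (auto simp: indicator_def)
qed

section \<open>The truncated Gagliardo seminorm\<close>

lemma borel_measurable_fst_borel [measurable]:
  "fst \<in> borel_measurable (borel :: ('a::euclidean_space \<times> 'b::euclidean_space) measure)"
  by (intro borel_measurable_continuous_onI continuous_intros)

lemma borel_measurable_snd_borel [measurable]:
  "snd \<in> borel_measurable (borel :: ('a::euclidean_space \<times> 'b::euclidean_space) measure)"
  by (intro borel_measurable_continuous_onI continuous_intros)

lemma power2_sum_le: "(a + b)\<^sup>2 \<le> 2 * a\<^sup>2 + 2 * (b::real)\<^sup>2"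
  using sum_squares_bound[of a b] by (simp add: power2_sum)

text \<open>The fractional kernel cut at distance \<open>r\<close>. On the diagonal its value is 0
  by the convention for \<open>powr\<close>, so lower bounds by this kernel hold there for free,
  while upper bounds have to exclude the diagonal as a null set.\<close>

definition short_kern :: "real \<Rightarrow> real \<Rightarrow> 'a::euclidean_space \<Rightarrow> real" where
  "short_kern s r h = (if norm h < r then norm h powr (- (real DIM('a) + 2 * s)) else 0)"

definition gagliardo :: "real \<Rightarrow> real \<Rightarrow> ('a::euclidean_space \<Rightarrow> real) \<Rightarrow> real" where
  "gagliardo s r w = (\<integral>(x, y). (w x - w y)\<^sup>2 * short_kern s r (x - y) \<partial>lborel)"

definition l2sq :: "('a::euclidean_space \<Rightarrow> real) \<Rightarrow> real" where
  "l2sq w = (\<integral>x. (w x)\<^sup>2 \<partial>lborel)"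

text \<open>The space H^s of the whole space, which is invariant under translations. Its members are
  Borel functions rather than classes, so that compositions with shifts and exchanges of variables
  stay measurable without completion.\<close>

definition frac_sobolev :: "real \<Rightarrow> real \<Rightarrow> ('a::euclidean_space \<Rightarrow> real) set" where
  "frac_sobolev s r = {w. w \<in> borel_measurable borel \<and> integrable lborel (\<lambda>x. (w x)\<^sup>2) \<and>
     integrable lborel (\<lambda>(x, y). (w x - w y)\<^sup>2 * short_kern s r (x - y))}"

text \<open>The price of a Lipschitz cut-off: the squared increment of the cut-off is at most a
  multiple of |x - y|^2, and this is integrated against the kernel.\<close>

definition kern_moment :: "'a::euclidean_space itself \<Rightarrow> real \<Rightarrow> real \<Rightarrow> real" where
  "kern_moment _ s r = (\<integral>h. (norm h)\<^sup>2 * short_kern s r (h::'a) \<partial>lborel)"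

definition bform :: "('a::euclidean_space \<times> 'a \<Rightarrow> real) \<Rightarrow> ('a \<Rightarrow> real) \<Rightarrow> ('a \<Rightarrow> real) \<Rightarrow> real" where
  "bform \<kappa> a b = (\<integral>(x, y). (a x - a y) * (b x - b y) * \<kappa> (x, y) \<partial>lborel)"

definition cutoff :: "real \<Rightarrow> ('a::euclidean_space \<Rightarrow> real) \<Rightarrow> bool" where
  "cutoff L \<eta> \<longleftrightarrow> (\<forall>x. 0 \<le> \<eta> x \<and> \<eta> x \<le> 1) \<and> (\<forall>x y. \<bar>\<eta> x - \<eta> y\<bar> \<le> L * norm (x - y))"

lemma short_kern_nonneg [simp]: "0 \<le> short_kern s r h"
  by (simp add: short_kern_def)

lemma short_kern_minus [simp]: "short_kern s r (- h) = short_kern s r h"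
  by (simp add: short_kern_def)

lemma short_kern_measurable [measurable]: "short_kern s r \<in> borel_measurable borel"
  unfolding short_kern_def by measurable

lemma gagliardo_nonneg [simp]: "0 \<le> gagliardo s r w"
  unfolding gagliardo_def by (rule integral_nonneg_AE) auto

lemma l2sq_nonneg [simp]: "0 \<le> l2sq w"
  unfolding l2sq_def by simp

lemma kern_moment_nonneg [simp]: "0 \<le> kern_moment T s r"
  unfolding kern_moment_def by simp

text \<open>The total exponent is 2 - n - 2s, which exceeds -n since s < 1.\<close>

lemma integrable_kern_moment:
  assumes "s < 1" "0 < r"
  shows "integrable lborel (\<lambda>h::'a::euclidean_space. (norm h)\<^sup>2 * short_kern s r h)"
proof -
  have "integrable lborel (\<lambda>h::'a. if norm h < r then norm h powr (2 - (real DIM('a) + 2 * s)) else 0)"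
    using assms by (intro integrable_powr_near) auto
  moreover have "(norm h)\<^sup>2 * short_kern s r h = (if norm h < r then norm h powr (2 - (real DIM('a) + 2 * s)) else 0)" for h :: 'a
  proof (cases "h = 0")
    case False
    then have "norm h powr (2 - (real DIM('a) + 2 * s)) = norm h powr 2 * norm h powr (- (real DIM('a) + 2 * s))"
      by (simp only: powr_add[symmetric] diff_conv_add_uminus)
    then show ?thesis using False by (simp add: short_kern_def)
  qed (simp add: short_kern_def)
  ultimately show ?thesis by simp
qed

lemma integrable_sq_kern_moment:
  fixes w :: "'a::euclidean_space \<Rightarrow> real"
  assumes "s < 1" "0 < r" and w: "integrable lborel (\<lambda>x. (w x)\<^sup>2)"
  shows "has_bochner_integral lborel (\<lambda>(x, y). (w x)\<^sup>2 * ((norm (x - y))\<^sup>2 * short_kern s r (x - y))) (l2sq w * kern_moment TYPE('a) s r)"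
    and "has_bochner_integral lborel (\<lambda>(x, y). (w y)\<^sup>2 * ((norm (x - y))\<^sup>2 * short_kern s r (x - y))) (l2sq w * kern_moment TYPE('a) s r)"
  using has_bochner_integral_mult_diff[OF w integrable_kern_moment[OF assms(1,2)]]
    has_bochner_integral_mult_diff'[OF w integrable_kern_moment[OF assms(1,2)]]
  by (simp_all add: l2sq_def kern_moment_def)

text \<open>The weight \<open>k\<close> lets one statement serve both the L^2 part, with weight 1,
  and the seminorm, with the kernel as weight.\<close>

lemma integrable_sq_add:
  fixes f g :: "'a \<Rightarrow> real"
  assumes "integrable M (\<lambda>x. (f x)\<^sup>2 * k x)" "integrable M (\<lambda>x. (g x)\<^sup>2 * k x)"
    "f \<in> borel_measurable M" "g \<in> borel_measurable M" "k \<in> borel_measurable M" "\<And>x. 0 \<le> k x"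
  shows "integrable M (\<lambda>x. (f x + c * g x)\<^sup>2 * k x)"
proof (rule Bochner_Integration.integrable_bound)
  show "integrable M (\<lambda>x. 2 * ((f x)\<^sup>2 * k x) + 2 * c\<^sup>2 * ((g x)\<^sup>2 * k x))"
    using assms by auto
  show "(\<lambda>x. (f x + c * g x)\<^sup>2 * k x) \<in> borel_measurable M" using assms by measurable
  show "AE x in M. norm ((f x + c * g x)\<^sup>2 * k x) \<le> norm (2 * ((f x)\<^sup>2 * k x) + 2 * c\<^sup>2 * ((g x)\<^sup>2 * k x))"
  proof (rule AE_I2)
    fix x
    have "(f x + c * g x)\<^sup>2 \<le> 2 * (f x)\<^sup>2 + 2 * (c * g x)\<^sup>2"
      by (rule power2_sum_le)
    then have "(f x + c * g x)\<^sup>2 * k x \<le> (2 * (f x)\<^sup>2 + 2 * (c * g x)\<^sup>2) * k x"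
      by (rule mult_right_mono) (use assms in auto)
    then show "norm ((f x + c * g x)\<^sup>2 * k x) \<le> norm (2 * ((f x)\<^sup>2 * k x) + 2 * c\<^sup>2 * ((g x)\<^sup>2 * k x))"
      using assms(6)[of x] by (simp add: power_mult_distrib algebra_simps)
  qed
qed

lemma frac_sobolev_add_scaled:
  assumes u: "u \<in> frac_sobolev s r" and v: "v \<in> frac_sobolev s r"
  shows "(\<lambda>x. u x + c * v x) \<in> frac_sobolev s r"
proof -
  have [measurable]: "u \<in> borel_measurable borel" "v \<in> borel_measurable borel"
    using u v by (auto simp: frac_sobolev_def)
  have "integrable lborel (\<lambda>x. (u x + c * v x)\<^sup>2 * 1)"
    using u v by (intro integrable_sq_add) (auto simp: frac_sobolev_def)
  moreover have "integrable lborel (\<lambda>p. ((u (fst p) - u (snd p)) + c * (v (fst p) - v (snd p)))\<^sup>2 * short_kern s r (fst p - snd p))"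
    using u v by (intro integrable_sq_add) (auto simp: frac_sobolev_def case_prod_unfold)
  ultimately show ?thesis
    by (simp add: frac_sobolev_def case_prod_unfold algebra_simps)
qed

lemma frac_sobolev_diff:
  assumes "u \<in> frac_sobolev s r" "v \<in> frac_sobolev s r"
  shows "(\<lambda>x. u x - v x) \<in> frac_sobolev s r"
  using frac_sobolev_add_scaled[OF assms, of "-1"] by simp

lemma frac_sobolev_shift:
  fixes w :: "'a::euclidean_space \<Rightarrow> real"
  assumes w: "w \<in> frac_sobolev s r"
  shows "(\<lambda>x. w (x + z)) \<in> frac_sobolev s r" and "gagliardo s r (\<lambda>x. w (x + z)) = gagliardo s r w"
    and "l2sq (\<lambda>x. w (x + z)) = l2sq w"
proof -
  have [measurable]: "w \<in> borel_measurable borel" using w by (auto simp: frac_sobolev_def)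
  let ?f = "\<lambda>p. (w (fst p) - w (snd p))\<^sup>2 * short_kern s r (fst p - snd p)"
  have "?f (p + (z, z)) = (w (fst p + z) - w (snd p + z))\<^sup>2 * short_kern s r (fst p - snd p)" for p
    by simp
  moreover have "integrable lborel ?f" using w by (simp add: frac_sobolev_def case_prod_unfold)
  ultimately show "(\<lambda>x. w (x + z)) \<in> frac_sobolev s r" "gagliardo s r (\<lambda>x. w (x + z)) = gagliardo s r w"
    using integrable_lborel_shift[of ?f "(z, z)"] integral_lborel_shift[of ?f "(z, z)"]
      integrable_lborel_shift[of "\<lambda>x. (w x)\<^sup>2" z] w
    by (simp_all add: frac_sobolev_def gagliardo_def case_prod_unfold)
  show "l2sq (\<lambda>x. w (x + z)) = l2sq w"
    unfolding l2sq_def using integral_lborel_shift[of "\<lambda>x. (w x)\<^sup>2" z] by simp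
qed

section \<open>Multiplication by Lipschitz cut-offs\<close>

lemma cutoff_measurable [measurable_dest]:
  assumes "cutoff L \<eta>"
  shows "\<eta> \<in> borel_measurable borel"
proof -
  have "L' -lipschitz_on UNIV \<eta>" if "L' = max 0 L" for L'
  proof (rule lipschitz_onI)
    fix x y
    have "\<bar>\<eta> x - \<eta> y\<bar> \<le> L * norm (x - y)" using assms by (simp add: cutoff_def)
    also have "\<dots> \<le> L' * norm (x - y)" using that by (intro mult_right_mono) auto
    finally show "dist (\<eta> x) (\<eta> y) \<le> L' * dist x y" by (simp add: dist_norm)
  qed (use that in auto)
  then have "continuous_on UNIV \<eta>" using lipschitz_on_continuous_on by blast
  then show ?thesis by (rule borel_measurable_continuous_onI)
qed

text \<open>A discrete product rule whose whole error falls on \<open>b\<close>, the value at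
  \<open>y\<close>. By exchanging the two points the error can therefore be placed where the
  function is known to be square integrable.\<close>

lemma cutoff_mult_sq_le:
  assumes "cutoff L \<eta>"
  shows "(\<eta> x * a - \<eta> y * b)\<^sup>2 \<le> 2 * (a - b)\<^sup>2 + 2 * L\<^sup>2 * (b\<^sup>2 * (norm (x - y))\<^sup>2)"
proof -
  have "(\<eta> x * a - \<eta> y * b)\<^sup>2 = (\<eta> x * (a - b) + b * (\<eta> x - \<eta> y))\<^sup>2" by (simp add: algebra_simps)
  also have "\<dots> \<le> 2 * (\<eta> x * (a - b))\<^sup>2 + 2 * (b * (\<eta> x - \<eta> y))\<^sup>2"
    by (rule power2_sum_le)
  also have "(\<eta> x * (a - b))\<^sup>2 \<le> (a - b)\<^sup>2"
    using assms by (auto simp: cutoff_def power_mult_distrib abs_square_le_1 intro!: mult_left_le_one_le)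
  also have "(\<eta> x - \<eta> y)\<^sup>2 \<le> (L * norm (x - y))\<^sup>2"
    using assms by (intro power2_le_iff_abs_le[THEN iffD2]) (auto simp: cutoff_def intro: order_trans[OF abs_ge_zero])
  then have "(b * (\<eta> x - \<eta> y))\<^sup>2 \<le> L\<^sup>2 * (b\<^sup>2 * (norm (x - y))\<^sup>2)"
    using mult_left_mono[of "(\<eta> x - \<eta> y)\<^sup>2" "(L * norm (x - y))\<^sup>2" "b\<^sup>2"]
    by (simp only: power_mult_distrib mult_ac zero_le_power2)
  finally show ?thesis by simp
qed

lemma l2sq_cutoff_mult:
  assumes "cutoff L \<eta>" "w \<in> borel_measurable borel" "integrable lborel (\<lambda>x. (w x)\<^sup>2)"
  shows "integrable lborel (\<lambda>x. (\<eta> x * w x)\<^sup>2)" "l2sq (\<lambda>x. \<eta> x * w x) \<le> l2sq w"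
proof -
  have [measurable]: "\<eta> \<in> borel_measurable borel" "w \<in> borel_measurable borel"
    using assms cutoff_measurable by auto
  have le: "(\<eta> x * w x)\<^sup>2 \<le> (w x)\<^sup>2" for x
    using assms(1) by (auto simp: cutoff_def power_mult_distrib abs_square_le_1 intro!: mult_left_le_one_le)
  show i: "integrable lborel (\<lambda>x. (\<eta> x * w x)\<^sup>2)"
    by (rule Bochner_Integration.integrable_bound[OF assms(3)]) (use le in auto)
  show "l2sq (\<lambda>x. \<eta> x * w x) \<le> l2sq w"
    unfolding l2sq_def by (rule integral_mono[OF i assms(3) le])
qed

lemma frac_sobolev_cutoff_mult:
  fixes w :: "'a::euclidean_space \<Rightarrow> real"
  assumes sr: "s < 1" "0 < r" and c: "cutoff L \<eta>" and w: "w \<in> frac_sobolev s r"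
  shows "(\<lambda>x. \<eta> x * w x) \<in> frac_sobolev s r"
    and "gagliardo s r (\<lambda>x. \<eta> x * w x) \<le> 2 * gagliardo s r w + 2 * L\<^sup>2 * kern_moment TYPE('a) s r * l2sq w"
proof -
  have [measurable]: "\<eta> \<in> borel_measurable borel" "w \<in> borel_measurable borel"
    using c w cutoff_measurable by (auto simp: frac_sobolev_def)
  let ?g = "\<lambda>p. 2 * ((w (fst p) - w (snd p))\<^sup>2 * short_kern s r (fst p - snd p))
     + 2 * L\<^sup>2 * ((w (snd p))\<^sup>2 * ((norm (fst p - snd p))\<^sup>2 * short_kern s r (fst p - snd p)))"
  let ?f = "\<lambda>p. (\<eta> (fst p) * w (fst p) - \<eta> (snd p) * w (snd p))\<^sup>2 * short_kern s r (fst p - snd p)"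
  have h: "has_bochner_integral lborel ?g (2 * gagliardo s r w + 2 * L\<^sup>2 * (l2sq w * kern_moment TYPE('a) s r))"
    using w integrable_sq_kern_moment(2)[OF sr, of w]
    by (intro has_bochner_integral_add has_bochner_integral_mult_right)
       (auto simp: frac_sobolev_def gagliardo_def case_prod_unfold has_bochner_integral_iff)
  have le: "?f p \<le> ?g p" for p
  proof -
    have "?f p \<le> (2 * (w (fst p) - w (snd p))\<^sup>2 + 2 * L\<^sup>2 * ((w (snd p))\<^sup>2 * (norm (fst p - snd p))\<^sup>2)) * short_kern s r (fst p - snd p)"
      by (rule mult_right_mono[OF cutoff_mult_sq_le[OF c]]) simp
    then show ?thesis by (simp add: algebra_simps)
  qed
  have ig: "integrable lborel ?g" using h by (simp add: has_bochner_integral_iff)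
  have i: "integrable lborel ?f"
    by (rule Bochner_Integration.integrable_bound[OF ig]) (use le in \<open>auto intro!: AE_I2 order_trans[OF _ abs_ge_self]\<close>)
  then show "(\<lambda>x. \<eta> x * w x) \<in> frac_sobolev s r"
    using l2sq_cutoff_mult[OF c] w by (simp add: frac_sobolev_def case_prod_unfold)
  have "integral\<^sup>L lborel ?f \<le> integral\<^sup>L lborel ?g" by (rule integral_mono[OF i ig le])
  then show "gagliardo s r (\<lambda>x. \<eta> x * w x) \<le> 2 * gagliardo s r w + 2 * L\<^sup>2 * kern_moment TYPE('a) s r * l2sq w"
    using h by (simp add: gagliardo_def case_prod_unfold has_bochner_integral_iff algebra_simps)
qed

text \<open>Compare \<open>w (x + z)\<close> and \<open>w x\<close> with the values \<open>w y\<close> on the ball with diameter \<open>[x, x + z]\<close>.\<close>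

lemma frac_sobolev_translation_estimate:
  fixes w :: "'a::euclidean_space \<Rightarrow> real"
  assumes s: "0 < s" and z: "z \<noteq> 0" "norm z < r" and w: "w \<in> frac_sobolev s r"
  shows "l2sq (\<lambda>x. w (x + z) - w x) \<le> (4 * 2 ^ DIM('a) / unit_ball_vol DIM('a)) * norm z powr (2 * s) * gagliardo s r w"
proof -
  have [measurable]: "w \<in> borel_measurable borel" using w by (auto simp: frac_sobolev_def)
  \<comment> \<open>x - y lies in \<open>B\<close> iff y lies in the ball of radius |z|/2 about the
    midpoint x + z/2; such y are within |z| of both x and x + z.\<close>
  define B where "B = cball (- z /\<^sub>R 2) (norm z / 2)"
  define V where "V = unit_ball_vol DIM('a)"
  have V: "0 < V" by (simp add: V_def)
  \<comment> \<open>The kernel at distance |z|, hence its lower bound at all smaller positive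
    distances; |z| < r keeps it from being cut.\<close>
  define d where "d = norm z powr (- (real DIM('a) + 2 * s))"
  have d: "0 < d" using z by (simp add: d_def)
  define W where "W = (\<lambda>x. w (x + z) - w x)"
  have W: "W \<in> frac_sobolev s r" unfolding W_def by (intro frac_sobolev_diff frac_sobolev_shift w)
  have B: "integrable lborel (indicator B :: 'a \<Rightarrow> real)" "integral\<^sup>L lborel (indicator B :: 'a \<Rightarrow> real) = V * (norm z / 2) ^ DIM('a)"
    by (simp_all add: B_def V_def emeasure_cball content_cball)
  have hl: "has_bochner_integral lborel (\<lambda>(x, y). d * ((W x)\<^sup>2 * indicator B (x - y))) (d * (l2sq W * (V * (norm z / 2) ^ DIM('a))))"
    using has_bochner_integral_mult_diff[OF _ B(1), of "\<lambda>x. (W x)\<^sup>2"] W B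
    by (auto simp: case_prod_unfold l2sq_def frac_sobolev_def intro!: has_bochner_integral_mult_right)
  let ?f = "\<lambda>p. (w (fst p) - w (snd p))\<^sup>2 * short_kern s r (fst p - snd p)"
  have f: "integrable lborel ?f" "integral\<^sup>L lborel ?f = gagliardo s r w" using w by (auto simp: frac_sobolev_def gagliardo_def case_prod_unfold)
  \<comment> \<open>Shifting the first variable alone turns the seminorm integrand into the
    comparison of w (x + z) with w y, with the kernel at x + z - y, and keeps the integral.\<close>
  have "integrable lborel (\<lambda>p. ?f (p + (z, 0)))" "(\<integral>p. ?f (p + (z, 0)) \<partial>lborel) = gagliardo s r w"
    using integrable_lborel_shift[OF f(1), of "(z, 0)"] integral_lborel_shift[of ?f "(z, 0)"] f(2)
    by auto
  then have hr: "has_bochner_integral lborel (\<lambda>p. 2 * ?f (p + (z, 0)) + 2 * ?f p) (2 * gagliardo s r w + 2 * gagliardo s r w)"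
    using f by (intro has_bochner_integral_add has_bochner_integral_mult_right) (auto simp: has_bochner_integral_iff)
  have kd: "e\<^sup>2 * d \<le> e\<^sup>2 * short_kern s r h" if "norm h \<le> norm z" "h = 0 \<Longrightarrow> e = 0" for h :: 'a and e :: real
  proof (cases "h = 0")
    case False
    then have "d \<le> norm h powr (- (real DIM('a) + 2 * s))"
      unfolding d_def using that s by (intro powr_mono2') auto
    then show ?thesis using that z by (auto simp: short_kern_def intro!: mult_left_mono)
  qed (use that in auto)
  have le: "(case p of (x, y) \<Rightarrow> d * ((W x)\<^sup>2 * indicator B (x - y))) \<le> 2 * ?f (p + (z, 0)) + 2 * ?f p" for p
  proof -
    obtain x y where p: "p = (x, y)" by (cases p)
    show ?thesis
    proof (cases "x - y \<in> B")
      case True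
      then have b: "norm (x - y + z /\<^sub>R 2) \<le> norm z / 2"
        by (simp add: B_def dist_norm norm_minus_commute algebra_simps)
      have n1: "norm (x - y) \<le> norm z"
        using b norm_triangle_ineq4[of "x - y + z /\<^sub>R 2" "z /\<^sub>R 2"] by simp
      have "z /\<^sub>R 2 + z /\<^sub>R 2 = z" by (simp flip: scaleR_add_left)
      then have e: "x - y + z /\<^sub>R 2 + z /\<^sub>R 2 = x + z - y" by (simp add: add.assoc)
      have n2: "norm (x + z - y) \<le> norm z"
        using b norm_triangle_ineq[of "x - y + z /\<^sub>R 2" "z /\<^sub>R 2"] unfolding e by simp
      have "(W x)\<^sup>2 \<le> 2 * (w (x + z) - w y)\<^sup>2 + 2 * (w x - w y)\<^sup>2"
        using power2_sum_le[of "w (x + z) - w y" "w y - w x"]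
        by (simp add: W_def power2_commute[of "w x"])
      then have "(W x)\<^sup>2 * d \<le> (2 * (w (x + z) - w y)\<^sup>2 + 2 * (w x - w y)\<^sup>2) * d"
        by (rule mult_right_mono) (use d in auto)
      also have "\<dots> \<le> 2 * ((w (x + z) - w y)\<^sup>2 * short_kern s r (x + z - y)) + 2 * ((w x - w y)\<^sup>2 * short_kern s r (x - y))"
        using kd[OF n1, of "w x - w y"] kd[OF n2, of "w (x + z) - w y"] by (simp add: algebra_simps)
      finally show ?thesis using True by (simp add: p mult.commute)
    qed (simp add: p)
  qed
  have "d * (l2sq W * (V * (norm z / 2) ^ DIM('a))) \<le> 2 * gagliardo s r w + 2 * gagliardo s r w"
    using integral_mono[OF integrable.intros[OF hl] integrable.intros[OF hr] le]
    unfolding has_bochner_integral_integral_eq[OF hl] has_bochner_integral_integral_eq[OF hr] .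
  also have "d * (l2sq W * (V * (norm z / 2) ^ DIM('a))) = l2sq W * V / 2 ^ DIM('a) / norm z powr (2 * s)"
  proof -
    have "d * norm z ^ DIM('a) = norm z powr (- (2 * s))"
      using z by (simp add: d_def powr_realpow[symmetric] powr_add[symmetric])
    then have "d * norm z ^ DIM('a) = 1 / norm z powr (2 * s)" by (simp add: powr_minus_divide)
    moreover have "d * (l2sq W * (V * (norm z / 2) ^ DIM('a))) = d * norm z ^ DIM('a) * (l2sq W * V / 2 ^ DIM('a))"
      by (simp add: power_divide)
    ultimately show ?thesis by simp
  qed
  \<comment> \<open>Two seminorms, each with factor 2, give the 4 of the constant; 2^n / V comes
    from the volume of the ball of radius |z|/2.\<close>
  finally have "l2sq W \<le> 2 ^ DIM('a) / V * norm z powr (2 * s) * (2 * gagliardo s r w + 2 * gagliardo s r w)"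
    using V z by (simp add: field_simps)
  then show ?thesis unfolding W_def V_def by (simp add: algebra_simps)
qed

section \<open>Bilinear forms with short-range kernels\<close>

text \<open>The bound is on the absolute value, so it also covers the difference of a kernel and its
  translate, which has no sign.\<close>

definition kbound :: "real \<Rightarrow> real \<Rightarrow> real \<Rightarrow> ('a::euclidean_space \<times> 'a \<Rightarrow> real) \<Rightarrow> bool" where
  "kbound s r L \<kappa> \<longleftrightarrow> \<kappa> \<in> borel_measurable borel \<and> 0 \<le> L \<and>
     (AE (x, y) in lborel. \<bar>\<kappa> (x, y)\<bar> \<le> L * short_kern s r (x - y))"

lemma bform_bound:
  fixes a b :: "'a::euclidean_space \<Rightarrow> real"
  assumes k: "kbound s r L \<kappa>" and a: "a \<in> frac_sobolev s r" and b: "b \<in> frac_sobolev s r"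
  shows "integrable lborel (\<lambda>(x, y). (a x - a y) * (b x - b y) * \<kappa> (x, y))"
    and "\<bar>bform \<kappa> a b\<bar> \<le> L * (sqrt (gagliardo s r a) * sqrt (gagliardo s r b))"
proof -
  have [measurable]: "a \<in> borel_measurable borel" "b \<in> borel_measurable borel" "\<kappa> \<in> borel_measurable borel"
    using assms by (auto simp: frac_sobolev_def kbound_def)
  let ?k = "\<lambda>p. short_kern s r (fst p - snd p)"
  \<comment> \<open>The majorant of the kernel is shared equally between the two factors before
    applying Cauchy-Schwarz.\<close>
  let ?f = "\<lambda>p. (a (fst p) - a (snd p)) * sqrt (?k p)"
  let ?g = "\<lambda>p. (b (fst p) - b (snd p)) * sqrt (?k p)"
  let ?h = "\<lambda>p. (a (fst p) - a (snd p)) * (b (fst p) - b (snd p)) * \<kappa> p"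
  have f2: "(\<lambda>p. (?f p)\<^sup>2) = (\<lambda>p. (a (fst p) - a (snd p))\<^sup>2 * ?k p)"
    and g2: "(\<lambda>p. (?g p)\<^sup>2) = (\<lambda>p. (b (fst p) - b (snd p))\<^sup>2 * ?k p)"
    by (simp_all add: power_mult_distrib)
  have if2: "integrable lborel (\<lambda>p. (?f p)\<^sup>2)" and ig2: "integrable lborel (\<lambda>p. (?g p)\<^sup>2)"
    using a b unfolding f2 g2 by (simp_all add: frac_sobolev_def case_prod_unfold)
  note cs = Cauchy_Schwarz_integral[OF if2 ig2]
  have i: "integrable lborel (\<lambda>p. \<bar>?f p * ?g p\<bar>)"
    by (rule integrable_abs, rule cs) measurable
  have "AE p in lborel. \<bar>\<kappa> p\<bar> \<le> L * ?k p"
    using k by (simp add: kbound_def case_prod_unfold)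
  then have le: "AE p in lborel. \<bar>?h p\<bar> \<le> L * \<bar>?f p * ?g p\<bar>"
  proof eventually_elim
    fix p assume "\<bar>\<kappa> p\<bar> \<le> L * ?k p"
    then have "\<bar>(a (fst p) - a (snd p)) * (b (fst p) - b (snd p))\<bar> * \<bar>\<kappa> p\<bar>
      \<le> \<bar>(a (fst p) - a (snd p)) * (b (fst p) - b (snd p))\<bar> * (L * ?k p)"
      by (rule mult_left_mono) simp
    moreover have "?f p * ?g p = (a (fst p) - a (snd p)) * (b (fst p) - b (snd p)) * (sqrt (?k p))\<^sup>2"
      by (simp only: power2_eq_square mult_ac)
    ultimately show "\<bar>?h p\<bar> \<le> L * \<bar>?f p * ?g p\<bar>"
      by (simp add: abs_mult mult_ac)
  qed
  have ih: "integrable lborel ?h"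
  proof (rule Bochner_Integration.integrable_bound)
    show "integrable lborel (\<lambda>p. L * \<bar>?f p * ?g p\<bar>)" by (rule integrable_mult_right[OF i])
    show "AE p in lborel. norm (?h p) \<le> norm (L * \<bar>?f p * ?g p\<bar>)"
      using le by (eventually_elim, unfold real_norm_def) (erule order_trans[OF _ abs_ge_self])
  qed measurable
  then show "integrable lborel (\<lambda>(x, y). (a x - a y) * (b x - b y) * \<kappa> (x, y))"
    by (simp add: case_prod_unfold)
  have "\<bar>bform \<kappa> a b\<bar> \<le> (\<integral>p. \<bar>?h p\<bar> \<partial>lborel)"
    unfolding bform_def case_prod_unfold prod.collapse by (rule integral_abs_bound)
  also have "\<dots> \<le> (\<integral>p. L * \<bar>?f p * ?g p\<bar> \<partial>lborel)"
    by (rule integral_mono_AE[OF integrable_abs[OF ih] integrable_mult_right[OF i] le])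
  also have "\<dots> = L * (\<integral>p. \<bar>?f p * ?g p\<bar> \<partial>lborel)" by simp
  also have "\<dots> \<le> L * (sqrt (\<integral>p. (?f p)\<^sup>2 \<partial>lborel) * sqrt (\<integral>p. (?g p)\<^sup>2 \<partial>lborel))"
    by (rule mult_left_mono, rule cs) (use k in \<open>auto simp: kbound_def\<close>)
  finally show "\<bar>bform \<kappa> a b\<bar> \<le> L * (sqrt (gagliardo s r a) * sqrt (gagliardo s r b))"
    unfolding f2 g2 by (simp add: gagliardo_def case_prod_unfold)
qed

lemma bform_diff_left:
  assumes "kbound s r L \<kappa>" "a \<in> frac_sobolev s r" "a' \<in> frac_sobolev s r" "b \<in> frac_sobolev s r"
  shows "bform \<kappa> (\<lambda>x. a x - a' x) b = bform \<kappa> a b - bform \<kappa> a' b"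
  using Bochner_Integration.integral_diff[OF bform_bound(1)[OF assms(1,2,4)] bform_bound(1)[OF assms(1,3,4)]]
  by (simp add: bform_def case_prod_unfold algebra_simps)

lemma bform_diff_right:
  assumes "kbound s r L \<kappa>" "a \<in> frac_sobolev s r" "b \<in> frac_sobolev s r" "b' \<in> frac_sobolev s r"
  shows "bform \<kappa> a (\<lambda>x. b x - b' x) = bform \<kappa> a b - bform \<kappa> a b'"
  using Bochner_Integration.integral_diff[OF bform_bound(1)[OF assms(1,2,3)] bform_bound(1)[OF assms(1,2,4)]]
  by (simp add: bform_def case_prod_unfold algebra_simps)

lemma bform_diff_kernel:
  assumes "kbound s r L \<kappa>" "kbound s r L' \<kappa>'" "a \<in> frac_sobolev s r" "b \<in> frac_sobolev s r"
  shows "bform (\<lambda>p. \<kappa> p - \<kappa>' p) a b = bform \<kappa> a b - bform \<kappa>' a b"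
  using Bochner_Integration.integral_diff[OF bform_bound(1)[OF assms(1,3,4)] bform_bound(1)[OF assms(2,3,4)]]
  by (simp add: bform_def case_prod_unfold algebra_simps)

text \<open>Discrete integration by parts: the diagonal change of variables takes the shift off
  \<open>a\<close> and puts it on the kernel and on \<open>b\<close>.\<close>

lemma bform_shift:
  fixes a b :: "'a::euclidean_space \<Rightarrow> real"
  assumes [measurable]: "a \<in> borel_measurable borel" "b \<in> borel_measurable borel" "\<kappa> \<in> borel_measurable borel"
  shows "bform \<kappa> (\<lambda>x. a (x + z)) b = bform (\<lambda>p. \<kappa> (p - (z, z))) a (\<lambda>x. b (x - z))"
proof -
  let ?f = "\<lambda>p. (a (fst p) - a (snd p)) * (b (fst p - z) - b (snd p - z)) * \<kappa> (p - (z, z))"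
  have "(\<integral>p. ?f (p + (z, z)) \<partial>lborel) = (\<integral>p. ?f p \<partial>lborel)"
    by (rule integral_lborel_shift) measurable
  then show ?thesis by (simp add: bform_def case_prod_unfold minus_prod_def)
qed

lemma kbound_shift:
  fixes \<kappa> :: "'a::euclidean_space \<times> 'a \<Rightarrow> real"
  assumes k: "kbound s r L \<kappa>"
  shows "kbound s r L (\<lambda>p. \<kappa> (p - (z, z)))"
proof -
  have [measurable]: "\<kappa> \<in> borel_measurable borel" using k by (simp add: kbound_def)
  have "AE p in lborel. \<bar>\<kappa> p\<bar> \<le> L * short_kern s r (fst p - snd p)"
    using k by (simp add: kbound_def case_prod_unfold)
  from AE_lborel_shift[OF this, of "- (z, z)"]
  have "AE p in lborel. \<bar>\<kappa> (p - (z, z))\<bar> \<le> L * short_kern s r (fst p - snd p)"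
    by eventually_elim (simp add: minus_prod_def plus_prod_def)
  then show ?thesis using k by (simp add: kbound_def case_prod_unfold minus_prod_def)
qed

text \<open>The identity \<open>(a - b) (p\<^sup>2 a - q\<^sup>2 b) = (p a - q b)\<^sup>2 - a b (p - q)\<^sup>2\<close> leaves an error
  term without differences of \<open>w\<close>.\<close>

lemma caccioppoli:
  fixes w :: "'a::euclidean_space \<Rightarrow> real"
  assumes sr: "s < 1" "0 < r" and c: "cutoff L \<eta>" and w: "w \<in> frac_sobolev s r"
    and k: "kbound s r Lam \<kappa>" and lam: "AE (x, y) in lborel. lam * short_kern s r (x - y) \<le> \<kappa> (x, y)" "0 \<le> lam"
  shows "lam * gagliardo s r (\<lambda>x. \<eta> x * w x) \<le> bform \<kappa> w (\<lambda>x. \<eta> x * (\<eta> x * w x)) + Lam * L\<^sup>2 * kern_moment TYPE('a) s r * l2sq w"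
proof -
  let ?k = "\<lambda>p. short_kern s r (fst p - snd p)"
  let ?N = "\<lambda>p. (norm (fst p - snd p))\<^sup>2 * short_kern s r (fst p - snd p)"
  let ?f = "\<lambda>p. (\<eta> (fst p) * w (fst p) - \<eta> (snd p) * w (snd p))\<^sup>2 * ?k p"
  let ?b = "\<lambda>p. (w (fst p) - w (snd p)) * (\<eta> (fst p) * (\<eta> (fst p) * w (fst p)) - \<eta> (snd p) * (\<eta> (snd p) * w (snd p))) * \<kappa> p"
  let ?e = "\<lambda>p. (Lam * L\<^sup>2 / 2) * ((w (fst p))\<^sup>2 * ?N p + (w (snd p))\<^sup>2 * ?N p)"
  note H = frac_sobolev_cutoff_mult(1)[OF sr c]
  have f: "has_bochner_integral lborel ?f (gagliardo s r (\<lambda>x. \<eta> x * w x))"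
    using H[OF w] by (simp add: gagliardo_def frac_sobolev_def case_prod_unfold has_bochner_integral_iff)
  have b: "has_bochner_integral lborel ?b (bform \<kappa> w (\<lambda>x. \<eta> x * (\<eta> x * w x)))"
    using bform_bound(1)[OF k w H[OF H[OF w]]]
    by (simp add: bform_def case_prod_unfold has_bochner_integral_iff)
  have e: "has_bochner_integral lborel ?e ((Lam * L\<^sup>2 / 2) * (l2sq w * kern_moment TYPE('a) s r + l2sq w * kern_moment TYPE('a) s r))"
    using integrable_sq_kern_moment[OF sr, of w] w
    by (intro has_bochner_integral_mult_right has_bochner_integral_add) (auto simp: frac_sobolev_def case_prod_unfold)
  have "AE p in lborel. \<bar>\<kappa> p\<bar> \<le> Lam * ?k p" "AE p in lborel. lam * ?k p \<le> \<kappa> p"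
    using k lam by (simp_all add: kbound_def case_prod_unfold)
  then have le: "AE p in lborel. lam * ?f p \<le> ?b p + ?e p"
  proof eventually_elim
    case (elim p)
    obtain x y where p: "p = (x, y)" by (cases p)
    have k0: "0 \<le> \<kappa> p" using elim(2) lam(2) by (smt (verit) short_kern_nonneg mult_nonneg_nonneg)
    have "lam * ?f p = (\<eta> x * w x - \<eta> y * w y)\<^sup>2 * (lam * ?k p)" by (simp add: p)
    also have "\<dots> \<le> (\<eta> x * w x - \<eta> y * w y)\<^sup>2 * \<kappa> p"
      using elim(2) by (intro mult_left_mono) auto
    also have "\<dots> = ?b p + w x * w y * ((\<eta> x - \<eta> y)\<^sup>2 * \<kappa> p)"
      by (simp add: p power2_eq_square algebra_simps)
    \<comment> \<open>The product is split into squares at single points, so that each term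
      integrates to the L^2 norm times the second moment of the kernel.\<close>
    also have "w x * w y * ((\<eta> x - \<eta> y)\<^sup>2 * \<kappa> p) \<le> ((w x)\<^sup>2 + (w y)\<^sup>2) / 2 * ((\<eta> x - \<eta> y)\<^sup>2 * \<kappa> p)"
      using k0 sum_squares_bound[of "w x" "w y"] by (intro mult_right_mono) auto
    also have "\<dots> \<le> ((w x)\<^sup>2 + (w y)\<^sup>2) / 2 * ((L * norm (x - y))\<^sup>2 * (Lam * ?k p))"
    proof (intro mult_left_mono mult_mono)
      show "(\<eta> x - \<eta> y)\<^sup>2 \<le> (L * norm (x - y))\<^sup>2"
        using c by (intro power2_le_iff_abs_le[THEN iffD2]) (auto simp: cutoff_def intro: order_trans[OF abs_ge_zero])
    qed (use elim(1) k0 in auto)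
    also have "\<dots> = ?e p" by (simp add: p power_mult_distrib algebra_simps add_divide_distrib)
    finally show ?case by simp
  qed
  have "lam * gagliardo s r (\<lambda>x. \<eta> x * w x) = (\<integral>p. lam * ?f p \<partial>lborel)"
    using f by (simp add: has_bochner_integral_iff)
  also have "\<dots> \<le> (\<integral>p. ?b p + ?e p \<partial>lborel)"
    by (rule integral_mono_AE) (use f b e le in \<open>auto simp: has_bochner_integral_iff\<close>)
  also have "\<dots> = bform \<kappa> w (\<lambda>x. \<eta> x * (\<eta> x * w x)) + (Lam * L\<^sup>2 / 2) * (l2sq w * kern_moment TYPE('a) s r + l2sq w * kern_moment TYPE('a) s r)"
    by (rule has_bochner_integral_integral_eq[OF has_bochner_integral_add[OF b e]])
  finally show ?thesis by (simp add: algebra_simps)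
qed

text \<open>The method of difference quotients for a nonlocal form. Assumption \<open>kz\<close> and
  the L^2 bound \<open>N\<close>, which is combined with the translation estimate for \<psi>, each
  supply one factor |z|^s. The constants enter as equations so that named constants can be
  substituted afterwards.\<close>

lemma difference_estimate:
  fixes U :: "'a::euclidean_space \<Rightarrow> real"
  assumes s: "0 < s" "s < 1" and r: "0 < r" and c: "cutoff L \<eta>" and U: "U \<in> frac_sobolev s r"
    and k: "kbound s r Lam \<kappa>" and lam: "AE (x, y) in lborel. lam * short_kern s r (x - y) \<le> \<kappa> (x, y)" "0 < lam"
    and z: "z \<noteq> 0" "norm z < r" and G: "0 \<le> G"
    and kz: "AE (x, y) in lborel. \<bar>\<kappa> (x - z, y - z) - \<kappa> (x, y)\<bar> \<le> G * norm z powr s * short_kern s r (x - y)"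
    and \<psi>: "\<psi> = (\<lambda>x. \<eta> x * (\<eta> x * (U (x + z) - U x)))"
    and N: "\<bar>bform \<kappa> U (\<lambda>x. \<psi> (x - z) - \<psi> x)\<bar> \<le> N * sqrt (l2sq (\<lambda>x. \<psi> (x - z) - \<psi> x))" "0 \<le> N"
    and cc: "c0 = 4 * 2 ^ DIM('a) / unit_ball_vol DIM('a)" and m: "m = kern_moment TYPE('a) s r"
    and C: "C = L\<^sup>2 * m * c0 + 4 * G\<^sup>2 / lam\<^sup>2 + 2 * Lam * L\<^sup>2 * m * c0 / lam + 4 * c0 / lam\<^sup>2"
  shows "gagliardo s r (\<lambda>x. \<eta> x * (U (x + z) - U x)) \<le> C * norm z powr (2 * s) * (N\<^sup>2 + gagliardo s r U)"
proof -
  define \<zeta> where "\<zeta> = norm z powr s"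
  have \<zeta>2: "\<zeta>\<^sup>2 = norm z powr (2 * s)"
    using z by (simp add: \<zeta>_def powr_power)
  have \<zeta>: "0 \<le> \<zeta>" by (simp add: \<zeta>_def)
  define v where "v = (\<lambda>x. U (x + z) - U x)"
  define w where "w = (\<lambda>x. \<eta> x * v x)"
  have \<psi>': "\<psi> = (\<lambda>x. \<eta> x * w x)" by (simp add: \<psi> w_def v_def)
  have c0: "0 \<le> c0" by (simp add: cc)
  have m0: "0 \<le> m" by (simp add: m)
  have Lam: "0 \<le> Lam" using k by (simp add: kbound_def)
  have vH: "v \<in> frac_sobolev s r" unfolding v_def by (intro frac_sobolev_diff frac_sobolev_shift U)
  have wH: "w \<in> frac_sobolev s r" unfolding w_def by (rule frac_sobolev_cutoff_mult(1)[OF s(2) r c vH])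
  have \<psi>H: "\<psi> \<in> frac_sobolev s r" unfolding \<psi>' by (rule frac_sobolev_cutoff_mult(1)[OF s(2) r c wH])
  have \<psi>zH: "(\<lambda>x. \<psi> (x - z)) \<in> frac_sobolev s r" "gagliardo s r (\<lambda>x. \<psi> (x - z)) = gagliardo s r \<psi>"
    using frac_sobolev_shift(1,2)[OF \<psi>H, of "- z"] by simp_all
  have UzH: "(\<lambda>x. U (x + z)) \<in> frac_sobolev s r" by (intro frac_sobolev_shift U)
  define X where "X = gagliardo s r w"
  define P where "P = gagliardo s r \<psi>"
  define g where "g = gagliardo s r U"
  define V where "V = l2sq v"
  have g0: "0 \<le> g" and P0: "0 \<le> P" and X0: "0 \<le> X" by (simp_all add: g_def P_def X_def)
  have V: "V \<le> c0 * \<zeta>\<^sup>2 * g"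
    using frac_sobolev_translation_estimate[OF s(1) z U] by (simp add: V_def v_def g_def \<zeta>2 cc)
  have "P \<le> 2 * X + 2 * L\<^sup>2 * m * l2sq w"
    using frac_sobolev_cutoff_mult(2)[OF s(2) r c wH] by (simp add: P_def \<psi>' X_def m)
  also have "l2sq w \<le> V"
    unfolding w_def V_def by (rule l2sq_cutoff_mult(2)[OF c]) (use vH in \<open>auto simp: frac_sobolev_def\<close>)
  \<comment> \<open>\<psi> is one cut-off away from \<open>w\<close>, so its seminorm costs
    \<open>X\<close> up to the L^2 quantity \<open>V\<close>, which is already of order
    |z|^(2s).\<close>
  finally have P: "P \<le> 2 * X + 2 * L\<^sup>2 * m * V" using m0 by (simp add: mult_left_mono)
  have A: "lam * X \<le> bform \<kappa> v \<psi> + Lam * L\<^sup>2 * m * V"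
    using caccioppoli[OF s(2) r c vH k lam(1)] lam(2) by (simp add: X_def w_def \<psi>' V_def m)
  have "l2sq (\<lambda>x. \<psi> (x + (- z)) - \<psi> x) \<le> c0 * norm (- z) powr (2 * s) * gagliardo s r \<psi>"
    unfolding cc by (rule frac_sobolev_translation_estimate[OF s(1) _ _ \<psi>H]) (use z in auto)
  then have D: "l2sq (\<lambda>x. \<psi> (x - z) - \<psi> x) \<le> c0 * \<zeta>\<^sup>2 * P" by (simp add: \<zeta>2 P_def)
  have kD: "kbound s r (G * \<zeta>) (\<lambda>p. \<kappa> (p - (z, z)) - \<kappa> p)"
    using kz k \<zeta> G by (auto simp: kbound_def \<zeta>_def case_prod_unfold minus_prod_def)
  \<comment> \<open>After the shift has moved to the kernel and the test function, subtracting and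
    adding the unshifted kernel separates the kernel error from a term in which only the test
    function is differenced.\<close>
  have "bform \<kappa> v \<psi> = bform \<kappa> (\<lambda>x. U (x + z)) \<psi> - bform \<kappa> U \<psi>"
    unfolding v_def by (rule bform_diff_left[OF k UzH U \<psi>H])
  also have "bform \<kappa> (\<lambda>x. U (x + z)) \<psi> = bform (\<lambda>p. \<kappa> (p - (z, z))) U (\<lambda>x. \<psi> (x - z))"
    by (rule bform_shift) (use U \<psi>H k in \<open>auto simp: frac_sobolev_def kbound_def\<close>)
  also have "\<dots> = bform (\<lambda>p. \<kappa> (p - (z, z)) - \<kappa> p) U (\<lambda>x. \<psi> (x - z)) + bform \<kappa> U (\<lambda>x. \<psi> (x - z))"
    using bform_diff_kernel[OF kbound_shift[OF k] k U \<psi>zH(1), of z] by simp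
  finally have "bform \<kappa> v \<psi> = bform (\<lambda>p. \<kappa> (p - (z, z)) - \<kappa> p) U (\<lambda>x. \<psi> (x - z)) + bform \<kappa> U (\<lambda>x. \<psi> (x - z) - \<psi> x)"
    using bform_diff_right[OF k U \<psi>zH(1) \<psi>H] by simp
  also have "\<dots> \<le> G * \<zeta> * (sqrt g * sqrt P) + N * sqrt (c0 * \<zeta>\<^sup>2 * P)"
  proof (rule add_mono)
    show "bform (\<lambda>p. \<kappa> (p - (z, z)) - \<kappa> p) U (\<lambda>x. \<psi> (x - z)) \<le> G * \<zeta> * (sqrt g * sqrt P)"
      using bform_bound(2)[OF kD U \<psi>zH(1)] \<psi>zH(2) by (simp add: g_def P_def)
    show "bform \<kappa> U (\<lambda>x. \<psi> (x - z) - \<psi> x) \<le> N * sqrt (c0 * \<zeta>\<^sup>2 * P)"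
      using N mult_left_mono[OF real_sqrt_le_mono[OF D] N(2)] by linarith
  qed
  also have "\<dots> = \<zeta> * sqrt P * (G * sqrt g + N * sqrt c0)"
    using \<zeta> by (simp add: real_sqrt_mult algebra_simps)
  \<comment> \<open>Young's inequality. The weight lam / 4 is chosen because \<open>P\<close>
    contains \<open>2 * X\<close>: what returns is lam / 2 times \<open>X\<close>, half of the
    left-hand side of \<open>A\<close>.\<close>
  also have "\<dots> \<le> lam / 4 * P + \<zeta>\<^sup>2 / lam * (G * sqrt g + N * sqrt c0)\<^sup>2"
  proof -
    let ?a = "sqrt lam / 2 * sqrt P" and ?b = "\<zeta> / sqrt lam * (G * sqrt g + N * sqrt c0)"
    have "2 * ?a * ?b \<le> ?a\<^sup>2 + ?b\<^sup>2" by (rule sum_squares_bound)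
    moreover have "2 * ?a * ?b = \<zeta> * sqrt P * (G * sqrt g + N * sqrt c0)"
      using lam(2) by (simp add: field_simps)
    moreover have "?a\<^sup>2 = lam / 4 * P" "?b\<^sup>2 = \<zeta>\<^sup>2 / lam * (G * sqrt g + N * sqrt c0)\<^sup>2"
      using lam(2) P0 by (simp_all add: power_mult_distrib power_divide)
    ultimately show ?thesis by simp
  qed
  also have "(G * sqrt g + N * sqrt c0)\<^sup>2 \<le> 2 * (G\<^sup>2 * g + N\<^sup>2 * c0)"
  proof -
    have "(G * sqrt g + N * sqrt c0)\<^sup>2 \<le> 2 * (G * sqrt g)\<^sup>2 + 2 * (N * sqrt c0)\<^sup>2"
      by (rule power2_sum_le)
    then show ?thesis using g0 c0 by (simp add: power_mult_distrib)
  qed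
  then have "\<zeta>\<^sup>2 / lam * (G * sqrt g + N * sqrt c0)\<^sup>2 \<le> \<zeta>\<^sup>2 / lam * (2 * (G\<^sup>2 * g + N\<^sup>2 * c0))"
    by (rule mult_left_mono) (use lam in auto)
  also have "lam / 4 * P \<le> lam / 4 * (2 * X + 2 * L\<^sup>2 * m * V)"
    by (rule mult_left_mono[OF P]) (use lam in auto)
  finally have B: "bform \<kappa> v \<psi> \<le> lam / 4 * (2 * X + 2 * L\<^sup>2 * m * V) + \<zeta>\<^sup>2 / lam * (2 * (G\<^sup>2 * g + N\<^sup>2 * c0))"
    by simp
  define T where "T = \<zeta>\<^sup>2 / lam * (2 * (G\<^sup>2 * g + N\<^sup>2 * c0))"
  \<comment> \<open>The term lam / 2 times \<open>X\<close> is absorbed here, which produces the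
    factor 2.\<close>
  have "lam * X \<le> 2 * ((lam / 2 * L\<^sup>2 * m + Lam * L\<^sup>2 * m) * V + T)"
    using A B[folded T_def] by (simp add: algebra_simps)
  also have "(lam / 2 * L\<^sup>2 * m + Lam * L\<^sup>2 * m) * V \<le> (lam / 2 * L\<^sup>2 * m + Lam * L\<^sup>2 * m) * (c0 * \<zeta>\<^sup>2 * g)"
    by (rule mult_left_mono[OF V]) (use lam Lam m0 in auto)
  finally have "X \<le> 2 * ((lam / 2 * L\<^sup>2 * m + Lam * L\<^sup>2 * m) * (c0 * \<zeta>\<^sup>2 * g) + T) / lam"
    using lam by (simp add: field_simps)
  also have "\<dots> = \<zeta>\<^sup>2 * ((L\<^sup>2 * m * c0 + 4 * G\<^sup>2 / lam\<^sup>2 + 2 * Lam * L\<^sup>2 * m * c0 / lam) * g + 4 * c0 / lam\<^sup>2 * N\<^sup>2)"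
    using lam unfolding T_def by (simp add: field_simps power2_eq_square)
  \<comment> \<open>\<open>C\<close> is the sum of all coefficients, so it dominates both the one of
    \<open>g\<close> and the one of \<open>N\<close> squared.\<close>
  also have "\<dots> \<le> \<zeta>\<^sup>2 * (C * g + C * N\<^sup>2)"
  proof -
    have "0 \<le> L\<^sup>2 * m * c0" "0 \<le> 4 * G\<^sup>2 / lam\<^sup>2" "0 \<le> 2 * Lam * L\<^sup>2 * m * c0 / lam" "0 \<le> 4 * c0 / lam\<^sup>2"
      using Lam lam m0 c0 by simp_all
    then have "L\<^sup>2 * m * c0 + 4 * G\<^sup>2 / lam\<^sup>2 + 2 * Lam * L\<^sup>2 * m * c0 / lam \<le> C" "4 * c0 / lam\<^sup>2 \<le> C"
      unfolding C by linarith+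
    then show ?thesis
      using g0 by (intro mult_left_mono add_mono mult_right_mono) auto
  qed
  finally show ?thesis by (simp add: X_def w_def v_def g_def \<zeta>2 algebra_simps)
qed

section \<open>Solutions with Borel measurable data\<close>

lemma has_bochner_integral_mult_prod:
  fixes f g :: "'a::euclidean_space \<Rightarrow> real"
  assumes "integrable lborel f" "integrable lborel g" "\<And>x. 0 \<le> f x" "\<And>x. 0 \<le> g x"
  shows "has_bochner_integral lborel (\<lambda>(x, y). f x * g y) ((\<integral>x. f x \<partial>lborel) * (\<integral>x. g x \<partial>lborel))"
proof (rule has_bochner_integral_nn_integral)
  have [measurable]: "f \<in> borel_measurable borel" "g \<in> borel_measurable borel"
    using assms(1,2) by (auto dest: borel_measurable_integrable)
  show "(\<lambda>(x, y). f x * g y) \<in> borel_measurable lborel"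
    unfolding case_prod_unfold by measurable
  have "(\<integral>\<^sup>+p. ennreal (case p of (x, y) \<Rightarrow> f x * g y) \<partial>lborel)
      = (\<integral>\<^sup>+x. \<integral>\<^sup>+y. ennreal (f x) * ennreal (g y) \<partial>lborel \<partial>lborel)"
    by (subst nn_integral_lborel_pair) (auto simp: ennreal_mult assms case_prod_unfold)
  also have "\<dots> = (\<integral>\<^sup>+x. f x \<partial>lborel) * (\<integral>\<^sup>+x. g x \<partial>lborel)"
    by (simp add: nn_integral_cmult nn_integral_multc)
  also have "\<dots> = ennreal ((\<integral>x. f x \<partial>lborel) * (\<integral>x. g x \<partial>lborel))"
    using assms by (simp add: nn_integral_eq_integral ennreal_mult)
  finally show "(\<integral>\<^sup>+p. ennreal (case p of (x, y) \<Rightarrow> f x * g y) \<partial>lborel)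
      = ennreal ((\<integral>x. f x \<partial>lborel) * (\<integral>x. g x \<partial>lborel))" .
qed (use assms in auto)

section \<open>The kernel at large distances, and cut-offs\<close>

lemma powr_mult_powr_minus: "0 < t \<Longrightarrow> t powr p * t powr (- p) = (1::real)"
  by (simp add: powr_minus)

text \<open>Majorant for the kernel beyond distance \<open>r\<close>. The decay with exponent
  \<beta> is assumed from distance 1 on; between \<open>r\<close> and 1 the kernel is bounded, which
  only changes the constant.\<close>

definition far_kern :: "real \<Rightarrow> real \<Rightarrow> 'a::euclidean_space \<Rightarrow> real" where
  "far_kern \<beta> r h = (if norm h < r then 0 else norm h powr (- (real DIM('a) + \<beta>)))"

lemma far_kern_nonneg [simp]: "0 \<le> far_kern \<beta> r h"
  by (simp add: far_kern_def)

lemma far_kern_minus [simp]: "far_kern \<beta> r (- h) = far_kern \<beta> r h"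
  by (simp add: far_kern_def)

lemma integrable_far_kern:
  assumes "0 < \<beta>" "0 < r"
  shows "integrable lborel (far_kern \<beta> r :: 'a::euclidean_space \<Rightarrow> real)"
  unfolding far_kern_def by (rule integrable_powr_far) (use assms in auto)

text \<open>With t = |x - y| \<ge> r and |x| \<le> R one has |y| \<le> R + t \<le> (R / r + 1) t.
  Hence the far kernel seen from a bounded set is dominated by the weight of the L^1 norm, which is
  all that is known of the solution at infinity.\<close>

lemma far_kern_weight:
  fixes x y :: "'a::euclidean_space"
  assumes "0 < \<beta>" "0 < r" "norm x \<le> R"
  shows "far_kern \<beta> r (x - y) * (1 + norm y powr (real DIM('a) + \<beta>))
    \<le> (1 / r) powr (real DIM('a) + \<beta>) + (R / r + 1) powr (real DIM('a) + \<beta>)"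
proof (cases "norm (x - y) < r")
  case False
  define p where "p = real DIM('a) + \<beta>"
  define t where "t = norm (x - y)"
  have p: "0 < p" using assms by (simp add: p_def add_nonneg_pos)
  have t: "r \<le> t" "0 < t" using False assms by (auto simp: t_def)
  have R: "0 \<le> R" using assms(3) norm_ge_zero order_trans by blast
  have y: "norm y \<le> (R / r + 1) * t"
  proof -
    have "norm y \<le> norm x + t" unfolding t_def by (metis norm_minus_commute norm_triangle_sub)
    also have "\<dots> \<le> R / r * t + t"
      using assms t R mult_left_mono[of r t "R / r"] by simp
    finally show ?thesis by (simp add: algebra_simps)
  qed
  have "t powr (- p) * norm y powr p \<le> t powr (- p) * ((R / r + 1) * t) powr p"
    using y p by (intro mult_left_mono powr_mono2) auto
  also have "\<dots> = t powr p * t powr (- p) * (R / r + 1) powr p"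
    by (subst powr_mult) (use t R assms in auto)
  also have "\<dots> = (R / r + 1) powr p"
    using powr_mult_powr_minus[OF t(2), of p] by simp
  finally have 1: "t powr (- p) * norm y powr p \<le> (R / r + 1) powr p" .
  have "t powr (- p) \<le> r powr (- p)" using t assms p by (intro powr_mono2') auto
  also have "\<dots> = (1 / r) powr p" using assms by (simp add: powr_divide powr_minus_divide)
  finally have 2: "t powr (- p) \<le> (1 / r) powr p" .
  show ?thesis using 1 2 False
    by (simp add: far_kern_def p_def[symmetric] t_def[symmetric] distrib_left)
qed (simp add: far_kern_def)

text \<open>Piecewise linear in the distance to \<open>A\<close>: it is 1 up to distance
  \<open>j * r\<close> and falls to 0 at \<open>(j + 1) * r\<close>, hence has slope 1 / r for every
  \<open>j\<close>.\<close>

definition bump :: "'a::euclidean_space set \<Rightarrow> real \<Rightarrow> real \<Rightarrow> 'a \<Rightarrow> real" where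
  "bump A r j x = max 0 (min 1 (j + 1 - infdist x A / r))"

lemma bump_cutoff:
  assumes "0 < r"
  shows "cutoff (1 / r) (bump A r j)"
  unfolding cutoff_def
proof (intro conjI allI)
  fix x y :: 'a
  have "\<bar>bump A r j x - bump A r j y\<bar> \<le> \<bar>infdist x A / r - infdist y A / r\<bar>"
    by (auto simp: bump_def max_def min_def)
  also have "\<dots> = \<bar>infdist x A - infdist y A\<bar> / r" using assms by (simp add: diff_divide_distrib[symmetric])
  also have "\<dots> \<le> 1 / r * norm (x - y)"
    using infdist_triangle_abs[of x A y] assms by (simp add: dist_norm divide_right_mono)
  finally show "\<bar>bump A r j x - bump A r j y\<bar> \<le> 1 / r * norm (x - y)" .
qed (auto simp: bump_def)

lemma bump_eq_1: "0 < r \<Longrightarrow> infdist x A \<le> j * r \<Longrightarrow> bump A r j x = 1"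
  by (simp add: bump_def field_simps)

lemma bump_eq_0: "0 < r \<Longrightarrow> (j + 1) * r \<le> infdist x A \<Longrightarrow> bump A r j x = 0"
  by (simp add: bump_def field_simps)

lemma infdist_shift: "infdist x A \<le> infdist y A + norm (x - y)"
  using infdist_triangle[of x A y] by (simp add: dist_norm)

text \<open>The number \<open>nf\<close> is the \<open>L\<^sup>2\<close> norm of the right-hand side, and the margin \<open>7 * r\<close> leaves
  room for the nested cut-offs \<open>bump A r j\<close> with \<open>j = 0, 3, 5\<close> and for steps of length less than \<open>r\<close>.\<close>

locale nonlocal_solution =
  fixes s \<beta> lam Lam M \<Gamma> r R nf :: real and \<Omega> A :: "'a::euclidean_space set"
    and \<kappa> :: "'a \<times> 'a \<Rightarrow> real" and u :: "'a \<Rightarrow> real"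
  assumes s: "0 < s" "s < 1" and \<beta>: "0 < \<beta>" and lam: "0 < lam" "lam \<le> Lam" and M: "0 < M"
    and \<Gamma>: "0 \<le> \<Gamma>" and r: "0 < r" "r \<le> 1"
    and \<Omega>: "\<Omega> \<in> sets borel" and A: "A \<noteq> {}"
    and nbhd: "\<And>x. infdist x A \<le> 7 * r \<Longrightarrow> x \<in> \<Omega>" "\<And>x. infdist x A \<le> 7 * r \<Longrightarrow> norm x \<le> R"
    and \<kappa>_measurable [measurable]: "\<kappa> \<in> borel_measurable borel" and \<kappa>_nonneg: "\<And>p. 0 \<le> \<kappa> p"
    and \<kappa>_near: "AE (x, y) in lborel. norm (x - y) < 1 \<longrightarrow>
       lam \<le> norm (x - y) powr (real DIM('a) + 2 * s) * \<kappa> (x, y) \<and>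
       norm (x - y) powr (real DIM('a) + 2 * s) * \<kappa> (x, y) \<le> Lam"
    and \<kappa>_far: "AE (x, y) in lborel. norm (x - y) \<ge> 1 \<longrightarrow>
       norm (x - y) powr (real DIM('a) + \<beta>) * \<kappa> (x, y) \<le> M"
    and \<kappa>_translation: "\<And>z. z \<noteq> 0 \<Longrightarrow> norm z < 1 \<Longrightarrow> AE (x, y) in lborel. norm (x - y) < 1 \<longrightarrow>
       norm (x - y) powr (real DIM('a) + 2 * s) * \<bar>\<kappa> (x + z, y + z) - \<kappa> (x, y)\<bar> \<le> \<Gamma> * norm z powr s"
    and u_measurable [measurable]: "u \<in> borel_measurable borel"
    and u_L2: "integrable lborel (\<lambda>x. (indicator \<Omega> x * u x)\<^sup>2)"
    and u_weighted: "integrable lborel (\<lambda>x. \<bar>u x\<bar> / (1 + norm x powr (real DIM('a) + \<beta>)))"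
    and u_energy: "integrable lborel (\<lambda>(x, y). indicator (- ((- \<Omega>) \<times> (- \<Omega>))) (x, y) * ((u x - u y)\<^sup>2 * \<kappa> (x, y)))"
    and nf: "0 \<le> nf"
    and solution: "\<And>\<phi>. \<phi> \<in> frac_sobolev s r \<Longrightarrow> (\<And>x. x \<notin> \<Omega> \<Longrightarrow> \<phi> x = 0) \<Longrightarrow>
       integrable lborel (\<lambda>(x, y). (\<phi> x - \<phi> y)\<^sup>2 * \<kappa> (x, y)) \<Longrightarrow> \<bar>bform \<kappa> u \<phi>\<bar> \<le> nf * sqrt (l2sq \<phi>)"
begin

lemmas [measurable] = \<Omega>

section \<open>Splitting the kernel at distance \<open>r\<close>\<close>

definition short :: "'a \<times> 'a \<Rightarrow> real" where
  "short p = (if norm (fst p - snd p) < r then \<kappa> p else 0)"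

text \<open>\<open>M\<close> serves distances at least 1. The other entry bounds the kernel at
  distances between \<open>r\<close> and 1, where \<open>far_kern\<close> is at least 1.\<close>

definition tail_bd :: real where
  "tail_bd = max M (Lam * (1 / r) powr (real DIM('a) + 2 * s))"

definition n1 :: real where "n1 = (\<integral>x. \<bar>u x\<bar> / (1 + norm x powr (real DIM('a) + \<beta>)) \<partial>lborel)"

text \<open>A squared norm, in contrast to \<open>n1\<close>; this is why \<open>sqrt n2\<close>
  occurs in the bounds.\<close>

definition n2 :: real where "n2 = l2sq (\<lambda>x. indicator \<Omega> x * u x)"

abbreviation E :: "real \<Rightarrow> 'a \<Rightarrow> real" where "E \<equiv> bump A r"

lemma n1_nonneg: "0 \<le> n1" unfolding n1_def by (rule integral_nonneg_AE) auto

lemma n2_nonneg: "0 \<le> n2" unfolding n2_def by simp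

lemma Lam_pos: "0 < Lam" using lam by simp

lemma tail_bd_nonneg: "0 \<le> tail_bd" using M by (simp add: tail_bd_def max_def)

lemma short_measurable [measurable]: "short \<in> borel_measurable borel"
  unfolding short_def by measurable

lemma AE_off_diagonal: "AE p in (lborel :: ('a \<times> 'a) measure). fst p \<noteq> snd p"
  using AE_lborel_diagonal by (simp add: case_prod_unfold)

lemma short_kern_eq:
  assumes "h \<noteq> 0" "norm h < r"
  shows "norm h powr (real DIM('a) + 2 * s) * short_kern s r (h::'a) = 1"
  unfolding short_kern_def using assms powr_mult_powr_minus[of "norm h" "real DIM('a) + 2 * s"] by simp

lemma kappa_short:
  "AE p in lborel. lam * short_kern s r (fst p - snd p) \<le> short p \<and> short p \<le> Lam * short_kern s r (fst p - snd p)"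
  using \<kappa>_near AE_off_diagonal
proof eventually_elim
  case (elim p)
  show ?case
  proof (cases "norm (fst p - snd p) < r")
    case True
    define t where "t = norm (fst p - snd p) powr (real DIM('a) + 2 * s)"
    have t: "0 < t" "t * short_kern s r (fst p - snd p) = 1"
      using elim(2) True short_kern_eq[of "fst p - snd p"] by (auto simp: t_def)
    then have k: "short_kern s r (fst p - snd p) = 1 / t" by (simp add: field_simps)
    have "lam \<le> t * \<kappa> p \<and> t * \<kappa> p \<le> Lam"
      using elim(1) True r(2) by (simp add: case_prod_unfold t_def)
    then show ?thesis using t True by (simp add: short_def k field_simps)
  qed (simp add: short_kern_def short_def)
qed

lemma kbound_short: "kbound s r Lam short"
proof -
  have "AE p in lborel. \<bar>short p\<bar> \<le> Lam * short_kern s r (fst p - snd p)"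
    using kappa_short by eventually_elim (auto simp: short_def \<kappa>_nonneg)
  then show ?thesis using Lam_pos by (simp add: kbound_def case_prod_unfold)
qed

lemma short_lower: "AE (x, y) in lborel. lam * short_kern s r (x - y) \<le> short (x, y)"
  using kappa_short by (auto simp: case_prod_unfold elim!: eventually_mono)

text \<open>A diagonal shift preserves |x - y|, so the sharp cut at distance \<open>r\<close>
  happens at the same pairs for the kernel and its translate and causes no error.\<close>

lemma short_translation:
  assumes "z \<noteq> 0" "norm z < 1"
  shows "AE (x, y) in lborel. \<bar>short (x - z, y - z) - short (x, y)\<bar> \<le> \<Gamma> * norm z powr s * short_kern s r (x - y)"
proof -
  have "AE p in lborel. norm (fst p - snd p) < 1 \<longrightarrow>
       norm (fst p - snd p) powr (real DIM('a) + 2 * s) * \<bar>\<kappa> (fst p + (- z), snd p + (- z)) - \<kappa> p\<bar> \<le> \<Gamma> * norm (- z) powr s"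
    using \<kappa>_translation[of "- z"] assms by (simp add: case_prod_unfold)
  then have "AE p in lborel. \<bar>short (fst p - z, snd p - z) - short p\<bar> \<le> \<Gamma> * norm z powr s * short_kern s r (fst p - snd p)"
    using AE_off_diagonal
  proof eventually_elim
    case (elim p)
    show ?case
    proof (cases "norm (fst p - snd p) < r")
      case True
      define t where "t = norm (fst p - snd p) powr (real DIM('a) + 2 * s)"
      have t: "0 < t" "t * short_kern s r (fst p - snd p) = 1"
        using elim(2) True short_kern_eq[of "fst p - snd p"] by (auto simp: t_def)
      then have k: "short_kern s r (fst p - snd p) = 1 / t" by (simp add: field_simps)
      have "t * \<bar>\<kappa> (fst p - z, snd p - z) - \<kappa> p\<bar> \<le> \<Gamma> * norm z powr s"
        using elim(1) True r(2) by (simp add: t_def)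
      then show ?thesis using t True by (simp add: short_def k field_simps)
    qed (simp add: short_kern_def short_def)
  qed
  then show ?thesis by (simp add: case_prod_unfold)
qed

lemma kappa_tail:
  "AE p in lborel. \<kappa> p - short p \<le> tail_bd * far_kern \<beta> r (fst p - snd p)"
  using \<kappa>_near \<kappa>_far
proof eventually_elim
  case (elim p)
  define d where "d = norm (fst p - snd p)"
  show ?case
  proof (cases "d < r")
    case False
    then have d: "0 < d" "r \<le> d" using r by auto
    have "\<kappa> p \<le> tail_bd * d powr (- (real DIM('a) + \<beta>))"
    proof (cases "d < 1")
      case True
      have "d powr (real DIM('a) + 2 * s) * \<kappa> p \<le> Lam"
        using elim(1) True by (simp add: case_prod_unfold d_def)
      then have "\<kappa> p \<le> Lam * (1 / d) powr (real DIM('a) + 2 * s)"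
        using d by (simp add: powr_divide field_simps)
      also have "\<dots> \<le> Lam * (1 / r) powr (real DIM('a) + 2 * s)"
        using d r s Lam_pos by (intro mult_left_mono powr_mono2) (auto simp: field_simps)
      also have "\<dots> \<le> tail_bd" by (simp add: tail_bd_def)
      also have "\<dots> \<le> tail_bd * d powr (- (real DIM('a) + \<beta>))"
      proof -
        have "1 powr (- (real DIM('a) + \<beta>)) \<le> d powr (- (real DIM('a) + \<beta>))"
          using d True \<beta> by (intro powr_mono2') auto
        then show ?thesis using tail_bd_nonneg by (simp add: mult_left_le[of] mult_le_cancel_left1)
      qed
      finally show ?thesis .
    next
      case far: False
      then have "d powr (real DIM('a) + \<beta>) * \<kappa> p \<le> M"
        using elim(2) by (simp add: case_prod_unfold d_def)
      also have "M \<le> tail_bd" by (simp add: tail_bd_def)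
      finally have "d powr (- (real DIM('a) + \<beta>)) * (d powr (real DIM('a) + \<beta>) * \<kappa> p) \<le> d powr (- (real DIM('a) + \<beta>)) * tail_bd"
        by (rule mult_left_mono) simp
      moreover have "d powr (- (real DIM('a) + \<beta>)) * (d powr (real DIM('a) + \<beta>) * \<kappa> p) = d powr (real DIM('a) + \<beta>) * d powr (- (real DIM('a) + \<beta>)) * \<kappa> p"
        by (simp only: mult_ac)
      ultimately show ?thesis by (simp only: powr_mult_powr_minus[OF d(1)] mult_1 mult.commute)
    qed
    then show ?thesis using False by (simp add: far_kern_def short_def d_def)
  qed (simp add: far_kern_def short_def d_def)
qed

lemma short_le: "0 \<le> \<kappa> p - short p" "0 \<le> short p"
  using \<kappa>_nonneg by (auto simp: short_def)

section \<open>Cutting off the solution and its test functions\<close>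

lemma bump_support: "E j x \<noteq> 0 \<Longrightarrow> infdist x A < (j + 1) * r"
  using bump_eq_0[OF r(1), of j x A] by force

lemma cutoff_E: "cutoff (1 / r) (E j)"
  by (rule bump_cutoff[OF r(1)])

lemma E_measurable [measurable]: "E j \<in> borel_measurable borel"
  by (rule cutoff_measurable[OF cutoff_E])

lemma E_indicator:
  assumes "j \<le> 6"
  shows "E j x * u x = E j x * (indicator \<Omega> x * u x)"
proof (cases "E j x = 0")
  case False
  from bump_support[OF this] have "infdist x A < (j + 1) * r" .
  also have "\<dots> \<le> 7 * r" using assms r by simp
  finally show ?thesis using nbhd(1)[of x] by simp
qed simp

lemma l2_cut:
  assumes "j \<le> 6"
  shows "integrable lborel (\<lambda>x. (E j x * u x)\<^sup>2)" "l2sq (\<lambda>x. E j x * u x) \<le> n2"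
  unfolding E_indicator[OF assms] n2_def by (rule l2sq_cutoff_mult[OF cutoff_E]; use u_L2 in simp)+

text \<open>The energy of \<open>u\<close> is controlled only for pairs with a point in \<Omega>;
  for all other pairs the cut-off vanishes at both points. The bound \<open>j \<le> 6\<close> keeps
  the support within distance \<open>7 * r\<close> of \<open>A\<close>.\<close>

lemma cut_frac_sobolev:
  assumes j: "j \<le> 6"
  shows "(\<lambda>x. E j x * u x) \<in> frac_sobolev s r"
proof -
  let ?v = "\<lambda>x. indicator \<Omega> x * u x"
  let ?N = "\<lambda>p. (norm (fst p - snd p))\<^sup>2 * short_kern s r (fst p - snd p)"
  let ?e = "\<lambda>p. indicator (- ((- \<Omega>) \<times> (- \<Omega>))) p * ((u (fst p) - u (snd p))\<^sup>2 * \<kappa> p)"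
  let ?g = "\<lambda>p. 2 / lam * ?e p + 2 * (1 / r)\<^sup>2 * ((?v (fst p))\<^sup>2 * ?N p + (?v (snd p))\<^sup>2 * ?N p)"
  let ?f = "\<lambda>p. (E j (fst p) * u (fst p) - E j (snd p) * u (snd p))\<^sup>2 * short_kern s r (fst p - snd p)"
  have ig: "integrable lborel ?g"
    using integrable_sq_kern_moment[OF s(2) r(1) u_L2] u_energy
    by (intro Bochner_Integration.integrable_add integrable_mult_right) (auto simp: case_prod_unfold has_bochner_integral_iff)
  have le: "AE p in lborel. ?f p \<le> ?g p"
    using kappa_short
  proof eventually_elim
    case (elim p)
    obtain x y where p: "p = (x, y)" by (cases p)
    have Ez: "E j w = 0" if "w \<notin> \<Omega>" for w
    proof (rule ccontr)
      assume "E j w \<noteq> 0"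
      from bump_support[OF this] have "infdist w A < (j + 1) * r" .
      also have "\<dots> \<le> 7 * r" using j r by simp
      finally show False using nbhd(1)[of w] that by simp
    qed
    have k: "short_kern s r (x - y) \<le> 1 / lam * \<kappa> p"
    proof -
      have "lam * short_kern s r (x - y) \<le> \<kappa> p" using elim short_le(1)[of p] by (simp add: p)
      then show ?thesis using lam by (simp add: field_simps)
    qed
    have e: "(u x - u y)\<^sup>2 * short_kern s r (x - y) \<le> 1 / lam * ?e p" if "x \<in> \<Omega> \<or> y \<in> \<Omega>"
    proof -
      have "(u x - u y)\<^sup>2 * short_kern s r (x - y) \<le> (u x - u y)\<^sup>2 * (1 / lam * \<kappa> p)"
        by (rule mult_left_mono[OF k]) simp
      then show ?thesis using that by (auto simp: p)
    qed
    have e0: "0 \<le> ?e p" using \<kappa>_nonneg by simp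
    \<comment> \<open>The case decides which point carries the Lipschitz error of the cut-off: it
      must lie in \<Omega>, where \<open>u\<close> is square integrable.\<close>
    consider "y \<in> \<Omega>" | "x \<in> \<Omega>" | "x \<notin> \<Omega>" "y \<notin> \<Omega>" by blast
    then show ?case
    proof cases
      case 1
      have "?f p \<le> (2 * (u x - u y)\<^sup>2 + 2 * (1 / r)\<^sup>2 * ((u y)\<^sup>2 * (norm (x - y))\<^sup>2)) * short_kern s r (x - y)"
        unfolding p fst_conv snd_conv by (rule mult_right_mono[OF cutoff_mult_sq_le[OF cutoff_E]]) simp
      also have "\<dots> = 2 * ((u x - u y)\<^sup>2 * short_kern s r (x - y)) + 2 * (1 / r)\<^sup>2 * ((?v y)\<^sup>2 * ?N p)"
        using 1 by (simp add: p algebra_simps)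
      also have "\<dots> \<le> 2 * (1 / lam * ?e p) + 2 * (1 / r)\<^sup>2 * ((?v x)\<^sup>2 * ?N p + (?v y)\<^sup>2 * ?N p)"
        using 1 by (intro add_mono mult_left_mono e) auto
      finally show ?thesis by (simp add: p)
    next
      case 2
      have "?f p = (E j y * u y - E j x * u x)\<^sup>2 * short_kern s r (x - y)"
        by (simp add: p power2_commute)
      also have "\<dots> \<le> (2 * (u y - u x)\<^sup>2 + 2 * (1 / r)\<^sup>2 * ((u x)\<^sup>2 * (norm (y - x))\<^sup>2)) * short_kern s r (x - y)"
        by (rule mult_right_mono[OF cutoff_mult_sq_le[OF cutoff_E]]) simp
      also have "\<dots> = 2 * ((u x - u y)\<^sup>2 * short_kern s r (x - y)) + 2 * (1 / r)\<^sup>2 * ((?v x)\<^sup>2 * ?N p)"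
        using 2 by (simp add: p power2_commute[of "u y"] norm_minus_commute[of y] algebra_simps)
      also have "\<dots> \<le> 2 * (1 / lam * ?e p) + 2 * (1 / r)\<^sup>2 * ((?v x)\<^sup>2 * ?N p + (?v y)\<^sup>2 * ?N p)"
        using 2 by (intro add_mono mult_left_mono e) auto
      finally show ?thesis by (simp add: p)
    next
      case 3
      then show ?thesis using e0 lam by (simp add: p Ez)
    qed
  qed
  have "integrable lborel ?f"
    by (rule Bochner_Integration.integrable_bound[OF ig])
      (measurable, use le in \<open>auto elim!: eventually_mono intro: order_trans[OF _ abs_ge_self]\<close>)
  then show ?thesis using l2_cut(1)[OF j] by (simp add: frac_sobolev_def case_prod_unfold)
qed

text \<open>Within distance \<open>r\<close> the energy is dominated by the Gagliardo seminorm,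
  beyond it by the L^2 norm, since the far kernel is integrable.\<close>

lemma test_admissible:
  assumes \<phi>: "\<phi> \<in> frac_sobolev s r"
  shows "integrable lborel (\<lambda>(x, y). (\<phi> x - \<phi> y)\<^sup>2 * \<kappa> (x, y))"
proof -
  have [measurable]: "\<phi> \<in> borel_measurable borel" using \<phi> by (simp add: frac_sobolev_def)
  have i2: "integrable lborel (\<lambda>x. (\<phi> x)\<^sup>2)" using \<phi> by (simp add: frac_sobolev_def)
  note F = integrable_far_kern[OF \<beta> r(1), where 'a='a]
  let ?g = "\<lambda>p. Lam * ((\<phi> (fst p) - \<phi> (snd p))\<^sup>2 * short_kern s r (fst p - snd p)) +
     (2 * tail_bd) * ((\<phi> (fst p))\<^sup>2 * far_kern \<beta> r (fst p - snd p) + (\<phi> (snd p))\<^sup>2 * far_kern \<beta> r (fst p - snd p))"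
  have ig: "integrable lborel ?g"
    using has_bochner_integral_mult_diff[OF i2 F] has_bochner_integral_mult_diff'[OF i2 F] \<phi>
    by (intro Bochner_Integration.integrable_add integrable_mult_right) (auto simp: case_prod_unfold has_bochner_integral_iff frac_sobolev_def)
  have le: "AE p in lborel. (\<phi> (fst p) - \<phi> (snd p))\<^sup>2 * \<kappa> p \<le> ?g p"
    using kappa_short kappa_tail
  proof eventually_elim
    case (elim p)
    have "(\<phi> (fst p) - \<phi> (snd p))\<^sup>2 * \<kappa> p = (\<phi> (fst p) - \<phi> (snd p))\<^sup>2 * short p + (\<phi> (fst p) - \<phi> (snd p))\<^sup>2 * (\<kappa> p - short p)"
      by (simp add: algebra_simps)
    also have "\<dots> \<le> (\<phi> (fst p) - \<phi> (snd p))\<^sup>2 * (Lam * short_kern s r (fst p - snd p)) +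
       (2 * (\<phi> (fst p))\<^sup>2 + 2 * (\<phi> (snd p))\<^sup>2) * (tail_bd * far_kern \<beta> r (fst p - snd p))"
      using elim short_le power2_sum_le[of "\<phi> (fst p)" "- \<phi> (snd p)"]
      by (intro add_mono mult_mono) auto
    finally show ?case by (simp add: algebra_simps)
  qed
  have "integrable lborel (\<lambda>p. (\<phi> (fst p) - \<phi> (snd p))\<^sup>2 * \<kappa> p)"
    by (rule Bochner_Integration.integrable_bound[OF ig])
      (measurable, use le \<kappa>_nonneg in \<open>auto elim!: eventually_mono intro: order_trans[OF _ abs_ge_self]\<close>)
  then show ?thesis by (simp add: case_prod_unfold)
qed

text \<open>The short kernel couples points at distance less than \<open>r\<close>. If \<phi> is
  nonzero at one of them, both are within \<open>(i + 1) * r\<close> of \<open>A\<close>, where the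
  cut-off equals 1; hence the requirement \<open>i + 1 \<le> j\<close>.\<close>

lemma localize:
  assumes \<phi>: "\<And>x. i * r < infdist x A \<Longrightarrow> \<phi> x = 0" and ij: "i + 1 \<le> j"
  shows "(E j x * u x - E j y * u y) * (\<phi> x - \<phi> y) * short (x, y) = (u x - u y) * (\<phi> x - \<phi> y) * short (x, y)"
proof (cases "norm (x - y) < r \<and> (\<phi> x \<noteq> 0 \<or> \<phi> y \<noteq> 0)")
  case True
  then have "infdist x A \<le> i * r \<or> infdist y A \<le> i * r"
    using \<phi>[of x] \<phi>[of y] by (metis not_less)
  then have "infdist x A \<le> (i + 1) * r" "infdist y A \<le> (i + 1) * r"
    using True infdist_shift[of x A y] infdist_shift[of y A x]
    by (auto simp: norm_minus_commute[of y] algebra_simps)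
  moreover have "(i + 1) * r \<le> j * r" using ij r by simp
  ultimately have "E j x = 1" "E j y = 1" by (auto intro!: bump_eq_1 r)
  then show ?thesis by simp
qed (auto simp: short_def)

section \<open>The long-range part of the form\<close>

definition tail_mass :: real where
  "tail_mass = (\<integral>h. far_kern \<beta> r (h::'a) \<partial>lborel)"

definition weight_const :: real where
  "weight_const = (1 / r) powr (real DIM('a) + \<beta>) + (R / r + 1) powr (real DIM('a) + \<beta>)"

definition ball_vol :: real where
  "ball_vol = measure lborel (cball (0::'a) R)"

lemma R_nonneg: "0 \<le> R"
proof -
  obtain a where "a \<in> A" using A by auto
  then have "norm a \<le> R" using nbhd(2)[of a] r by simp
  then show ?thesis using norm_ge_zero order_trans by blast
qed

lemma tail_mass_nonneg: "0 \<le> tail_mass" by (simp add: tail_mass_def)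

lemma weight_const_nonneg: "0 \<le> weight_const" by (simp add: weight_const_def)

text \<open>The product of differences has four terms. The two with u and \<phi> at the same point
  are paired in L^2(\<Omega>) and contribute the mass of the far kernel. In the mixed ones u may sit
  anywhere, so the weighted L^1 norm is used, against the L^1 norm of \<phi>.\<close>

lemma tail_estimate:
  assumes \<phi>: "\<phi> \<in> frac_sobolev s r" and supp: "\<And>x. 7 * r < infdist x A \<Longrightarrow> \<phi> x = 0"
  shows "integrable lborel (\<lambda>p. (u (fst p) - u (snd p)) * (\<phi> (fst p) - \<phi> (snd p)) * (\<kappa> p - short p))"
    and "\<bar>\<integral>p. (u (fst p) - u (snd p)) * (\<phi> (fst p) - \<phi> (snd p)) * (\<kappa> p - short p) \<partial>lborel\<bar>
      \<le> 2 * tail_bd * (tail_mass * sqrt n2 + weight_const * sqrt ball_vol * n1) * sqrt (l2sq \<phi>)"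
proof -
  have [measurable]: "\<phi> \<in> borel_measurable borel" using \<phi> by (simp add: frac_sobolev_def)
  have i2: "integrable lborel (\<lambda>x. (\<phi> x)\<^sup>2)" using \<phi> by (simp add: frac_sobolev_def)
  note F = integrable_far_kern[OF \<beta> r(1), where 'a='a]
  have \<phi>0: "infdist x A \<le> 7 * r" if "\<phi> x \<noteq> 0" for x using supp[of x] that by force
  let ?F = "\<lambda>p. far_kern \<beta> r (fst p - snd p)"
  define f where "f = (\<lambda>x. \<bar>\<phi> x * (indicator \<Omega> x * u x)\<bar>)"
  have f_eq: "f x = \<bar>\<phi> x\<bar> * \<bar>u x\<bar>" for x
    using \<phi>0[of x] nbhd(1)[of x] by (cases "\<phi> x = 0") (auto simp: f_def abs_mult)
  have f: "integrable lborel f" "integral\<^sup>L lborel f \<le> sqrt (l2sq \<phi>) * sqrt n2"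
    using Cauchy_Schwarz_integral[OF i2 u_L2] by (simp_all add: f_def l2sq_def n2_def)
  \<comment> \<open>The indicator changes nothing on the support of \<phi>; it is the second factor
    by which Cauchy-Schwarz passes from the L^1 to the L^2 norm.\<close>
  define g where "g = (\<lambda>x. \<bar>\<phi> x * indicator (cball 0 R) x\<bar>)"
  have g_eq: "g x = \<bar>\<phi> x\<bar>" for x
    using \<phi>0[of x] nbhd(2)[of x] by (cases "\<phi> x = 0") (auto simp: g_def)
  have ib: "integrable lborel (\<lambda>x. (indicator (cball (0::'a) R) x :: real)\<^sup>2)"
    "(\<integral>x. (indicator (cball (0::'a) R) x :: real)\<^sup>2 \<partial>lborel) = ball_vol"
  proof -
    have "(\<lambda>x. (indicator (cball (0::'a) R) x :: real)\<^sup>2) = indicator (cball 0 R)"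
      by (auto simp: indicator_def)
    then show "integrable lborel (\<lambda>x. (indicator (cball (0::'a) R) x :: real)\<^sup>2)"
      "(\<integral>x. (indicator (cball (0::'a) R) x :: real)\<^sup>2 \<partial>lborel) = ball_vol"
      using emeasure_cball[OF R_nonneg, of "0::'a"] by (simp_all add: ball_vol_def)
  qed
  have [measurable]: "(indicator (cball (0::'a) R) :: 'a \<Rightarrow> real) \<in> borel_measurable borel"
    by (rule borel_measurable_indicator) simp
  have g: "integrable lborel g" "integral\<^sup>L lborel g \<le> sqrt (l2sq \<phi>) * sqrt ball_vol"
    using Cauchy_Schwarz_integral[OF i2 ib(1)] unfolding ib(2) by (simp_all add: g_def l2sq_def)
  define h where "h = (\<lambda>x. \<bar>u x\<bar> / (1 + norm x powr (real DIM('a) + \<beta>)))"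
  have h: "integrable lborel h" "integral\<^sup>L lborel h = n1" using u_weighted by (simp_all add: h_def n1_def)
  have pos: "0 \<le> f x" "0 \<le> g x" "0 \<le> h x" for x by (auto simp: f_def g_def h_def)
  let ?B = "\<lambda>p. tail_bd * (f (fst p) * ?F p + f (snd p) * ?F p
     + weight_const * (g (fst p) * h (snd p)) + weight_const * (h (fst p) * g (snd p)))"
  have B: "has_bochner_integral lborel ?B (tail_bd * (integral\<^sup>L lborel f * tail_mass + integral\<^sup>L lborel f * tail_mass
     + weight_const * (integral\<^sup>L lborel g * n1) + weight_const * (n1 * integral\<^sup>L lborel g)))"
    using has_bochner_integral_mult_diff[OF f(1) F] has_bochner_integral_mult_diff'[OF f(1) F]
      has_bochner_integral_mult_prod[OF g(1) h(1)] has_bochner_integral_mult_prod[OF h(1) g(1)] pos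
    by (intro has_bochner_integral_mult_right has_bochner_integral_add)
       (auto simp: case_prod_unfold h(2) tail_mass_def)
  let ?T = "\<lambda>p. (u (fst p) - u (snd p)) * (\<phi> (fst p) - \<phi> (snd p)) * (\<kappa> p - short p)"
  have wt: "\<bar>\<phi> x\<bar> * \<bar>u y\<bar> * far_kern \<beta> r (x - y) \<le> weight_const * (g x * h y)" for x y
  proof (cases "\<phi> x = 0")
    case False
    have "far_kern \<beta> r (x - y) * (1 + norm y powr (real DIM('a) + \<beta>)) \<le> weight_const"
      unfolding weight_const_def by (rule far_kern_weight[OF \<beta> r(1) nbhd(2)[OF \<phi>0[OF False]]])
    moreover have "0 < 1 + norm y powr (real DIM('a) + \<beta>)" by (simp add: add_pos_nonneg)
    ultimately have "far_kern \<beta> r (x - y) \<le> weight_const / (1 + norm y powr (real DIM('a) + \<beta>))"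
      by (simp add: pos_le_divide_eq)
    then have "\<bar>\<phi> x\<bar> * \<bar>u y\<bar> * far_kern \<beta> r (x - y) \<le> \<bar>\<phi> x\<bar> * \<bar>u y\<bar> * (weight_const / (1 + norm y powr (real DIM('a) + \<beta>)))"
      by (rule mult_left_mono) simp
    then show ?thesis by (simp add: g_eq h_def mult_ac)
  qed (simp add: g_eq)
  have le: "AE p in lborel. \<bar>?T p\<bar> \<le> ?B p"
    using kappa_tail
  proof eventually_elim
    case (elim p)
    obtain x y where p: "p = (x, y)" by (cases p)
    have "\<bar>?T p\<bar> = \<bar>u x - u y\<bar> * \<bar>\<phi> x - \<phi> y\<bar> * (\<kappa> p - short p)"
      using short_le(1)[of p] by (simp add: p abs_mult)
    also have "\<dots> \<le> (\<bar>u x\<bar> + \<bar>u y\<bar>) * (\<bar>\<phi> x\<bar> + \<bar>\<phi> y\<bar>) * (tail_bd * ?F p)"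
      using elim short_le(1)[of p] by (intro mult_mono) auto
    also have "\<dots> = tail_bd * (f x * ?F p + f y * ?F p + \<bar>\<phi> x\<bar> * \<bar>u y\<bar> * ?F p + \<bar>\<phi> y\<bar> * \<bar>u x\<bar> * ?F p)"
      by (simp add: f_eq algebra_simps)
    also have "\<dots> \<le> tail_bd * (f x * ?F p + f y * ?F p + weight_const * (g x * h y) + weight_const * (g y * h x))"
      using wt[of x y] wt[of y x] far_kern_minus[of \<beta> r "x - y"]
      by (intro mult_left_mono[OF _ tail_bd_nonneg] add_mono) (auto simp: p)
    finally show ?case by (simp add: p mult.commute[of "g y"])
  qed
  have iB: "integrable lborel ?B" using B by (simp add: has_bochner_integral_iff)
  show i: "integrable lborel ?T"
    by (rule Bochner_Integration.integrable_bound[OF iB])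
      (measurable, use le in \<open>auto elim!: eventually_mono intro: order_trans[OF _ abs_ge_self]\<close>)
  have "\<bar>integral\<^sup>L lborel ?T\<bar> \<le> (\<integral>p. \<bar>?T p\<bar> \<partial>lborel)" by (rule integral_abs_bound)
  also have "\<dots> \<le> integral\<^sup>L lborel ?B" by (rule integral_mono_AE[OF integrable_abs[OF i] iB le])
  also have "\<dots> = 2 * tail_bd * (tail_mass * integral\<^sup>L lborel f + weight_const * n1 * integral\<^sup>L lborel g)"
    using has_bochner_integral_integral_eq[OF B] by (simp add: algebra_simps)
  also have "\<dots> \<le> 2 * tail_bd * (tail_mass * (sqrt (l2sq \<phi>) * sqrt n2) + weight_const * n1 * (sqrt (l2sq \<phi>) * sqrt ball_vol))"
    using tail_bd_nonneg tail_mass_nonneg weight_const_nonneg n1_nonneg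
    by (intro mult_left_mono add_mono f g) auto
  finally show "\<bar>integral\<^sup>L lborel ?T\<bar> \<le> 2 * tail_bd * (tail_mass * sqrt n2 + weight_const * sqrt ball_vol * n1) * sqrt (l2sq \<phi>)"
    by (simp add: algebra_simps)
qed

definition weak_const :: real where
  "weak_const = 1 + 2 * tail_bd * (tail_mass + weight_const * sqrt ball_vol)"

definition data :: real where "data = nf + sqrt n2 + n1"

lemma data_nonneg: "0 \<le> data" using nf n1_nonneg n2_nonneg by (simp add: data_def)

lemma weak_const_nonneg: "0 \<le> weak_const"
  using tail_bd_nonneg tail_mass_nonneg weight_const_nonneg by (simp add: weak_const_def ball_vol_def)

text \<open>The tail is moved to the right-hand side of the equation, and in the short-range form
  \<open>u\<close> is replaced by its cut-off. The 1 in \<open>weak_const\<close> accounts for the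
  right-hand side \<open>nf\<close>.\<close>

lemma weak_estimate:
  assumes \<phi>: "\<phi> \<in> frac_sobolev s r" and supp: "\<And>x. i * r < infdist x A \<Longrightarrow> \<phi> x = 0"
    and ij: "i + 1 \<le> j" "j \<le> 6"
  shows "\<bar>bform short (\<lambda>x. E j x * u x) \<phi>\<bar> \<le> weak_const * data * sqrt (l2sq \<phi>)"
proof -
  have ir: "i * r \<le> 7 * r" using ij r by simp
  have supp': "\<phi> x = 0" if "7 * r < infdist x A" for x using supp[of x] that ir by linarith
  have \<phi>\<Omega>: "\<phi> x = 0" if "x \<notin> \<Omega>" for x using supp'[of x] nbhd(1)[of x] that by force
  let ?S = "\<lambda>p. (u (fst p) - u (snd p)) * (\<phi> (fst p) - \<phi> (snd p)) * short p"
  let ?T = "\<lambda>p. (u (fst p) - u (snd p)) * (\<phi> (fst p) - \<phi> (snd p)) * (\<kappa> p - short p)"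
  have loc: "(E j (fst p) * u (fst p) - E j (snd p) * u (snd p)) * (\<phi> (fst p) - \<phi> (snd p)) * short p
      = (u (fst p) - u (snd p)) * (\<phi> (fst p) - \<phi> (snd p)) * short p" for p
    using localize[of i \<phi> j, OF supp ij(1), where x="fst p" and y="snd p"] by simp
  have S: "integrable lborel ?S" "integral\<^sup>L lborel ?S = bform short (\<lambda>x. E j x * u x) \<phi>"
    using bform_bound(1)[OF kbound_short cut_frac_sobolev[OF ij(2)] \<phi>]
    by (simp_all add: bform_def case_prod_unfold loc)
  note T = tail_estimate[OF \<phi> supp']
  have "bform \<kappa> u \<phi> = (\<integral>p. ?S p + ?T p \<partial>lborel)"
    unfolding bform_def by (rule Bochner_Integration.integral_cong) (auto simp: algebra_simps)
  also have "\<dots> = bform short (\<lambda>x. E j x * u x) \<phi> + integral\<^sup>L lborel ?T"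
    using S T(1) by simp
  finally have "\<bar>bform short (\<lambda>x. E j x * u x) \<phi>\<bar> \<le> \<bar>bform \<kappa> u \<phi>\<bar> + \<bar>integral\<^sup>L lborel ?T\<bar>" by linarith
  also have "\<dots> \<le> nf * sqrt (l2sq \<phi>) + 2 * tail_bd * (tail_mass * sqrt n2 + weight_const * sqrt ball_vol * n1) * sqrt (l2sq \<phi>)"
    by (intro add_mono solution[OF \<phi> \<phi>\<Omega> test_admissible[OF \<phi>]] T(2))
  also have "\<dots> = (nf + 2 * tail_bd * (tail_mass * sqrt n2 + weight_const * sqrt ball_vol * n1)) * sqrt (l2sq \<phi>)"
    by (simp add: algebra_simps)
  also have "\<dots> \<le> weak_const * data * sqrt (l2sq \<phi>)"
  proof (rule mult_right_mono)
    define a where "a = weight_const * sqrt ball_vol"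
    have a: "0 \<le> a" using weight_const_nonneg by (simp add: a_def ball_vol_def)
    have "tail_mass * sqrt n2 + a * n1 \<le> (tail_mass + a) * data"
    proof -
      have "(tail_mass + a) * data = tail_mass * sqrt n2 + a * n1 + (tail_mass * (nf + n1) + a * (nf + sqrt n2))"
        by (simp add: data_def algebra_simps)
      moreover have "0 \<le> tail_mass * (nf + n1) + a * (nf + sqrt n2)"
        using a tail_mass_nonneg nf n1_nonneg n2_nonneg by simp
      ultimately show ?thesis by linarith
    qed
    then have "2 * tail_bd * (tail_mass * sqrt n2 + a * n1) \<le> 2 * tail_bd * ((tail_mass + a) * data)"
      using tail_bd_nonneg by (intro mult_left_mono) auto
    moreover have "nf \<le> data" using n1_nonneg n2_nonneg by (simp add: data_def)
    ultimately show "nf + 2 * tail_bd * (tail_mass * sqrt n2 + weight_const * sqrt ball_vol * n1) \<le> weak_const * data"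
      unfolding weak_const_def a_def[symmetric] by (simp add: algebra_simps)
  qed simp
  finally show ?thesis .
qed

section \<open>Energy bound and second differences\<close>

definition energy_const :: real where
  "energy_const = (weak_const + Lam * (1 / r)\<^sup>2 * kern_moment TYPE('a) s r) / lam"

text \<open>Caccioppoli with cut-off \<open>E 3\<close>, applied to \<open>E 5 * u\<close> because
  \<open>u\<close> itself need not lie in the Sobolev space. The test function lives within distance
  \<open>4 * r\<close>, so the weak estimate applies with i = 4 and j = 5.\<close>

lemma energy_estimate: "gagliardo s r (\<lambda>x. E 3 x * u x) \<le> energy_const * data\<^sup>2"
proof -
  have U2: "(\<lambda>x. E 5 x * u x) \<in> frac_sobolev s r" by (rule cut_frac_sobolev) simp
  \<comment> \<open>\<open>E 3\<close> is supported within distance \<open>4 * r\<close>, where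
    \<open>E 5\<close> is already 1.\<close>
  have eq: "E 3 x * (E 5 x * u x) = E 3 x * u x" for x
  proof (cases "E 3 x = 0")
    case False
    from bump_support[OF this] show ?thesis using bump_eq_1[OF r(1), of x A 5] r by simp
  qed simp
  note H = frac_sobolev_cutoff_mult(1)[OF s(2) r(1) cutoff_E]
  let ?\<phi> = "\<lambda>x. E 3 x * (E 3 x * (E 5 x * u x))"
  have \<phi>: "?\<phi> \<in> frac_sobolev s r" by (intro H U2)
  have n: "l2sq (\<lambda>x. E 5 x * u x) \<le> n2" by (rule l2_cut) simp
  have "l2sq ?\<phi> \<le> l2sq (\<lambda>x. E 3 x * (E 5 x * u x))"
    by (rule l2sq_cutoff_mult(2)[OF cutoff_E]) (use H[OF U2, of 3] in \<open>auto simp: frac_sobolev_def\<close>)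
  also have "\<dots> \<le> l2sq (\<lambda>x. E 5 x * u x)"
    by (rule l2sq_cutoff_mult(2)[OF cutoff_E]) (use U2 in \<open>auto simp: frac_sobolev_def\<close>)
  also have "\<dots> \<le> n2" by (rule n)
  finally have n\<phi>: "l2sq ?\<phi> \<le> n2" .
  have d: "sqrt n2 \<le> data" using nf n1_nonneg by (simp add: data_def)
  have d2: "n2 \<le> data\<^sup>2" using power_mono[OF d, of 2] n2_nonneg by simp
  have supp: "?\<phi> x = 0" if "4 * r < infdist x A" for x
    using bump_eq_0[OF r(1), of 3 x A] that by simp
  have "bform short (\<lambda>x. E 5 x * u x) ?\<phi> \<le> \<bar>bform short (\<lambda>x. E 5 x * u x) ?\<phi>\<bar>" by simp
  also have "\<dots> \<le> weak_const * data * sqrt (l2sq ?\<phi>)"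
    by (rule weak_estimate[OF \<phi> supp]) auto
  also have "\<dots> \<le> weak_const * data * data"
    using order_trans[OF real_sqrt_le_mono[OF n\<phi>] d] weak_const_nonneg data_nonneg by (intro mult_left_mono) auto
  finally have b: "bform short (\<lambda>x. E 5 x * u x) ?\<phi> \<le> weak_const * data\<^sup>2" by (simp add: power2_eq_square)
  have "lam * gagliardo s r (\<lambda>x. E 3 x * u x) \<le> bform short (\<lambda>x. E 5 x * u x) ?\<phi> + Lam * (1 / r)\<^sup>2 * kern_moment TYPE('a) s r * l2sq (\<lambda>x. E 5 x * u x)"
    using caccioppoli[OF s(2) r(1) cutoff_E U2 kbound_short short_lower, of 3] lam(1) by (simp add: eq)
  also have "\<dots> \<le> weak_const * data\<^sup>2 + Lam * (1 / r)\<^sup>2 * kern_moment TYPE('a) s r * data\<^sup>2"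
    using b order_trans[OF n d2] Lam_pos by (intro add_mono mult_left_mono) auto
  finally show ?thesis
    using lam(1) by (simp add: energy_const_def field_simps)
qed

definition c0 :: real where "c0 = 4 * 2 ^ DIM('a) / unit_ball_vol DIM('a)"

definition diff_const :: real where
  "diff_const = (1 / r)\<^sup>2 * kern_moment TYPE('a) s r * c0 + 4 * \<Gamma>\<^sup>2 / lam\<^sup>2
     + 2 * Lam * (1 / r)\<^sup>2 * kern_moment TYPE('a) s r * c0 / lam + 4 * c0 / lam\<^sup>2"

text \<open>The square root of three factors: the second translation estimate, the difference
  estimate, and the squared bounds for the weak form and the energy in units of
  \<open>data\<close>.\<close>

definition reg_const :: real where
  "reg_const = sqrt (c0 * diff_const * (weak_const\<^sup>2 + energy_const))"

text \<open>The witness is the difference of the cut-off first difference. On \<open>A\<close> all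
  cut-offs are 1, so there it is the second difference of \<open>u\<close>, yet it is defined and
  square integrable on the whole space. The difference estimate and the translation estimate each
  contribute |z|^(2s) to the squared norm.\<close>

lemma second_difference_estimate:
  assumes z: "z \<noteq> 0" "norm z < r"
  obtains W where "integrable lborel (\<lambda>x. (W x)\<^sup>2)" "W \<in> borel_measurable borel"
    "sqrt (l2sq W) \<le> reg_const * norm z powr (2 * s) * data"
    "\<And>x. x \<in> A \<Longrightarrow> x + z \<in> A \<Longrightarrow> x + 2 *\<^sub>R z \<in> A \<Longrightarrow> W x = u (x + 2 *\<^sub>R z) - 2 * u (x + z) + u x"
proof -
  define U where "U = (\<lambda>x. E 3 x * u x)"
  have U: "U \<in> frac_sobolev s r" unfolding U_def by (rule cut_frac_sobolev) simp
  define \<psi> where "\<psi> = (\<lambda>x. E 0 x * (E 0 x * (U (x + z) - U x)))"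
  define w where "w = (\<lambda>x. E 0 x * (U (x + z) - U x))"
  note H = frac_sobolev_cutoff_mult(1)[OF s(2) r(1) cutoff_E]
  have w: "w \<in> frac_sobolev s r" unfolding w_def by (intro H frac_sobolev_diff frac_sobolev_shift U)
  have \<psi>: "\<psi> \<in> frac_sobolev s r" unfolding \<psi>_def by (intro H frac_sobolev_diff frac_sobolev_shift U)
  have \<psi>z: "(\<lambda>x. \<psi> (x - z) - \<psi> x) \<in> frac_sobolev s r"
    using frac_sobolev_diff[OF frac_sobolev_shift(1)[OF \<psi>, of "- z"] \<psi>] by simp
  have \<psi>0: "\<psi> x = 0" if "r \<le> infdist x A" for x
    using bump_eq_0[OF r(1), of 0 x A] that by (simp add: \<psi>_def)
  \<comment> \<open>\<psi> lives within distance \<open>r\<close>, and the step enlarges this to at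
    most \<open>2 * r\<close>; with i = 2 this is what calls for the cut-off \<open>E 3\<close> in
    \<open>U\<close>.\<close>
  have supp: "\<psi> (x - z) - \<psi> x = 0" if "2 * r < infdist x A" for x
    using \<psi>0[of x] \<psi>0[of "x - z"] that infdist_shift[of x A "x - z"] z r by simp
  have "\<bar>bform short U (\<lambda>x. \<psi> (x - z) - \<psi> x)\<bar> \<le> weak_const * data * sqrt (l2sq (\<lambda>x. \<psi> (x - z) - \<psi> x))"
    unfolding U_def by (rule weak_estimate[OF \<psi>z supp]) auto
  note D = difference_estimate[OF s r(1) cutoff_E U kbound_short short_lower lam(1) z \<Gamma> short_translation \<psi>_def this _ c0_def refl diff_const_def]
  have "gagliardo s r w \<le> diff_const * norm z powr (2 * s) * ((weak_const * data)\<^sup>2 + gagliardo s r U)"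
    unfolding w_def by (rule D) (use z r weak_const_nonneg data_nonneg in auto)
  also have "\<dots> \<le> diff_const * norm z powr (2 * s) * ((weak_const * data)\<^sup>2 + energy_const * data\<^sup>2)"
    using energy_estimate Lam_pos lam
    by (intro mult_left_mono add_mono) (auto simp: U_def diff_const_def c0_def)
  finally have gw: "gagliardo s r w \<le> diff_const * norm z powr (2 * s) * ((weak_const\<^sup>2 + energy_const) * data\<^sup>2)"
    by (simp add: power_mult_distrib algebra_simps)
  define W where "W = (\<lambda>x. w (x + z) - w x)"
  have WH: "W \<in> frac_sobolev s r" unfolding W_def by (intro frac_sobolev_diff frac_sobolev_shift w)
  have "l2sq W \<le> c0 * norm z powr (2 * s) * gagliardo s r w"
    using frac_sobolev_translation_estimate[OF s(1) z w] by (simp add: W_def c0_def)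
  also have "\<dots> \<le> c0 * norm z powr (2 * s) * (diff_const * norm z powr (2 * s) * ((weak_const\<^sup>2 + energy_const) * data\<^sup>2))"
    by (intro mult_left_mono gw) (simp add: c0_def)
  also have "\<dots> = (c0 * diff_const * (weak_const\<^sup>2 + energy_const)) * (norm z powr (2 * s) * data)\<^sup>2"
    by (simp add: power2_eq_square)
  finally have "sqrt (l2sq W) \<le> sqrt ((c0 * diff_const * (weak_const\<^sup>2 + energy_const)) * (norm z powr (2 * s) * data)\<^sup>2)"
    by (rule real_sqrt_le_mono)
  also have "\<dots> = reg_const * norm z powr (2 * s) * data"
    using data_nonneg by (simp add: reg_const_def real_sqrt_mult)
  finally have 1: "sqrt (l2sq W) \<le> reg_const * norm z powr (2 * s) * data" .
  have one: "E 0 x = 1" "E 3 x = 1" if "x \<in> A" for x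
    using that bump_eq_1[OF r(1), of x A] r by auto
  have "W x = u (x + 2 *\<^sub>R z) - 2 * u (x + z) + u x" if "x \<in> A" "x + z \<in> A" "x + 2 *\<^sub>R z \<in> A" for x
    using that one[of x] one[of "x + z"] one[of "x + 2 *\<^sub>R z"]
    by (simp add: W_def w_def U_def add.assoc scaleR_2)
  then show ?thesis using that[of W] WH 1 by (auto simp: frac_sobolev_def)
qed

end

section \<open>Borel versions of Lebesgue measurable data\<close>

text \<open>Lebesgue measure on a product is the completion of \<open>lborel\<close>. All analysis
  is done with Borel functions, where the product structure is available, and transferred by almost
  everywhere equality.\<close>

lemma
  fixes f g :: "'a::euclidean_space \<Rightarrow> real"
  assumes ae: "AE x in lborel. f x = g x" and [measurable]: "g \<in> borel_measurable borel"
  shows borel_measurable_lebesgue_AE: "f \<in> borel_measurable lebesgue"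
    and integrable_lebesgue_AE: "integrable lebesgue f \<longleftrightarrow> integrable lborel g"
    and integral_lebesgue_AE: "integral\<^sup>L lebesgue f = integral\<^sup>L lborel g"
proof -
  have ae': "AE x in lebesgue. g x = f x" using AE_completion[OF ae] by eventually_elim simp
  have g: "g \<in> borel_measurable lebesgue" by (rule measurable_completion) simp
  show f: "f \<in> borel_measurable lebesgue" by (rule borel_measurable_AE[OF g ae'])
  have "integrable lebesgue f \<longleftrightarrow> integrable lebesgue g"
    using ae' by (intro integrable_cong_AE f g) (auto simp: eq_commute)
  then show "integrable lebesgue f \<longleftrightarrow> integrable lborel g" by (simp add: integrable_completion)
  have "integral\<^sup>L lebesgue f = integral\<^sup>L lebesgue g"
    using ae' by (intro integral_cong_AE f g) (auto simp: eq_commute)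
  then show "integral\<^sup>L lebesgue f = integral\<^sup>L lborel g" by (simp add: integral_completion)
qed

section \<open>L^2 norms on subsets and extended-valued kernels\<close>

lemma abs_powr_two: "\<bar>x\<bar> powr 2 = (x::real)\<^sup>2"
  by (cases "x = 0") (auto simp: powr_numeral)

lemma Lp_norm_2: "Lp_norm 2 U g = sqrt (\<integral>x. (g x)\<^sup>2 \<partial>lebesgue_on U)"
  unfolding Lp_norm_def abs_powr_two by (simp add: powr_half_sqrt)

lemma Lp_space_2: "g \<in> Lp_space 2 U \<longleftrightarrow> g \<in> borel_measurable (lebesgue_on U) \<and> integrable (lebesgue_on U) (\<lambda>x. (g x)\<^sup>2)"
  unfolding Lp_space_def abs_powr_two by simp

lemma
  fixes g h :: "real^'n \<Rightarrow> real"
  assumes U: "U \<in> sets borel" and h: "h \<in> borel_measurable borel"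
    and ae: "AE x in lborel. x \<in> U \<longrightarrow> g x = h x"
  shows integrable_lebesgue_on_sq: "integrable (lebesgue_on U) (\<lambda>x. (g x)\<^sup>2) \<longleftrightarrow> integrable lborel (\<lambda>x. (indicator U x * h x)\<^sup>2)"
    and Lp_norm_2_borel: "Lp_norm 2 U g = sqrt (l2sq (\<lambda>x. indicator U x * h x))"
proof -
  note [measurable] = U h
  have ae': "AE x in lborel. indicator U x *\<^sub>R (g x)\<^sup>2 = (indicator U x * h x)\<^sup>2"
    using ae by eventually_elim (auto simp: indicator_def)
  have U': "U \<inter> space lebesgue \<in> sets lebesgue" using U by auto
  show "integrable (lebesgue_on U) (\<lambda>x. (g x)\<^sup>2) \<longleftrightarrow> integrable lborel (\<lambda>x. (indicator U x * h x)\<^sup>2)"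
    unfolding integrable_restrict_space[OF U'] by (rule integrable_lebesgue_AE[OF ae']) measurable
  show "Lp_norm 2 U g = sqrt (l2sq (\<lambda>x. indicator U x * h x))"
    unfolding Lp_norm_2 integral_restrict_space[OF U'] l2sq_def
    by (subst integral_lebesgue_AE[OF ae']) auto
qed

text \<open>A finite upper bound with t > 0 excludes k = \<infinity>, where \<open>enn2real\<close>
  would return the meaningless value 0.\<close>

lemma ennreal_mult_le_enn2real:
  assumes "0 < t" "0 \<le> L" "ennreal t * k \<le> ennreal L"
  shows "k < \<infinity>" "t * enn2real k \<le> L"
proof -
  show k: "k < \<infinity>"
    using assms by (cases k) (auto simp: ennreal_mult_top top_unique infinity_ennreal_def)
  then obtain q where q: "k = ennreal q" "0 \<le> q" by (cases k) auto
  show "t * enn2real k \<le> L"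
    using assms by (simp add: q ennreal_mult[symmetric])
qed

lemma le_ennreal_mult_enn2real:
  assumes "0 < t" "ennreal l \<le> ennreal t * k" "k < \<infinity>"
  shows "l \<le> t * enn2real k"
proof -
  obtain q where q: "k = ennreal q" "0 \<le> q" using assms(3) by (cases k) auto
  show ?thesis using assms by (simp add: q ennreal_mult[symmetric])
qed

text \<open>The kernel hypotheses of the theorem in their literal form, so that unfolding this
  definition matches them.\<close>

definition kernel_conditions ::
    "real \<Rightarrow> real \<Rightarrow> real \<Rightarrow> real \<Rightarrow> real \<Rightarrow> real \<Rightarrow> ((real^'n) \<times> (real^'n) \<Rightarrow> ennreal) \<Rightarrow> bool" where
  "kernel_conditions s \<beta> lam Lam M \<Gamma> K \<longleftrightarrow>
      K \<in> borel_measurable lebesgue \<and>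
      (AE (x, y) in lebesgue. K (x, y) = K (y, x)) \<and>
      (AE (x, y) in lebesgue. norm (x - y) < 1 \<longrightarrow>
         ennreal lam \<le> ennreal (norm (x - y) powr (real CARD('n) + 2 * s)) * K (x, y) \<and>
         ennreal (norm (x - y) powr (real CARD('n) + 2 * s)) * K (x, y) \<le> ennreal Lam) \<and>
      (AE (x, y) in lebesgue. norm (x - y) \<ge> 1 \<longrightarrow>
         0 \<le> ennreal (norm (x - y) powr (real CARD('n) + \<beta>)) * K (x, y) \<and>
         ennreal (norm (x - y) powr (real CARD('n) + \<beta>)) * K (x, y) \<le> ennreal M) \<and>
      (AE (x, y, z) in lebesgue. norm (x - y) < 1 \<and> norm z < 1 \<longrightarrow>
         norm (x - y) powr (real CARD('n) + 2 * s) *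
           \<bar>enn2real (K (x + z, y + z)) - enn2real (K (x, y))\<bar> \<le> \<Gamma> * norm z powr s)"

text \<open>The indicator of an exceptional null set has integral 0; two exchanges of integrals
  bring z outermost, so almost every z has a null section.\<close>

lemma AE_lborel_triple_swap:
  fixes P :: "'a::euclidean_space \<Rightarrow> 'a \<Rightarrow> 'a \<Rightarrow> bool"
  assumes ae: "AE (x, y, z) in lborel. P x y z"
  shows "AE z in lborel. AE (x, y) in lborel. P x y z"
proof -
  obtain N where N: "N \<in> null_sets lborel" "{p. \<not> (case p of (x, y, z) \<Rightarrow> P x y z)} \<subseteq> N"
    using ae unfolding eventually_ae_filter by auto
  have [measurable]: "N \<in> sets (borel \<Otimes>\<^sub>M (borel \<Otimes>\<^sub>M borel))"
  proof -
    have "N \<in> sets borel" using N(1) by auto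
    then show ?thesis unfolding borel_prod .
  qed
  have "0 = (\<integral>\<^sup>+p. indicator N p \<partial>(lborel \<Otimes>\<^sub>M (lborel \<Otimes>\<^sub>M lborel)))"
    using nn_integral_indicator[of N lborel] null_setsD1[OF N(1)] null_setsD2[OF N(1)] by (simp add: lborel_prod)
  also have "\<dots> = (\<integral>\<^sup>+x. \<integral>\<^sup>+q. indicator N (x, q) \<partial>(lborel \<Otimes>\<^sub>M lborel) \<partial>lborel)"
    unfolding lborel_prod by (rule nn_integral_lborel_pair) (simp add: borel_prod[symmetric])
  also have "\<dots> = (\<integral>\<^sup>+x. \<integral>\<^sup>+y. \<integral>\<^sup>+z. indicator N (x, y, z) \<partial>lborel \<partial>lborel \<partial>lborel)"
    by (subst lborel.nn_integral_fst[symmetric]) auto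
  also have "\<dots> = (\<integral>\<^sup>+x. \<integral>\<^sup>+z. \<integral>\<^sup>+y. indicator N (x, y, z) \<partial>lborel \<partial>lborel \<partial>lborel)"
    by (intro nn_integral_cong lborel_pair.Fubini') measurable
  also have "\<dots> = (\<integral>\<^sup>+z. \<integral>\<^sup>+x. \<integral>\<^sup>+y. indicator N (x, y, z) \<partial>lborel \<partial>lborel \<partial>lborel)"
    by (rule lborel_pair.Fubini') measurable
  finally have "AE z in lborel. (\<integral>\<^sup>+x. \<integral>\<^sup>+y. indicator N (x, y, z) \<partial>lborel \<partial>lborel) = 0"
    by (subst (asm) eq_commute, subst (asm) nn_integral_0_iff_AE) auto
  then show ?thesis
  proof eventually_elim
    case (elim z)
    have m: "(\<lambda>(x, y). indicator N (x, y, z) :: ennreal) \<in> borel_measurable (lborel \<Otimes>\<^sub>M lborel)"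
      by measurable
    have "(\<integral>\<^sup>+(x, y). indicator N (x, y, z) \<partial>(lborel \<Otimes>\<^sub>M lborel)) = 0"
      using lborel.nn_integral_fst[OF m] elim by simp
    then have "AE p in lborel \<Otimes>\<^sub>M lborel. (\<lambda>(x, y). indicator N (x, y, z) :: ennreal) p = 0"
      by (subst (asm) nn_integral_0_iff_AE) (use m in auto)
    then show ?case unfolding lborel_prod
      by eventually_elim (use subsetD[OF N(2)] in \<open>fastforce simp: indicator_def split: if_splits\<close>)
  qed
qed

text \<open>Otherwise the ball would be contained in a null set.\<close>

lemma AE_lborel_ball_exists:
  assumes "AE x in lborel. P x" and "0 < (e::real)"
  shows "\<exists>x\<in>ball (a::'a::euclidean_space) e. P x"
proof (rule ccontr)
  assume "\<not> ?thesis"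
  then have "ball a e \<subseteq> {x. \<not> P x}" by auto
  moreover obtain N where "N \<in> null_sets lborel" "{x. \<not> P x} \<subseteq> N"
    using assms(1) unfolding eventually_ae_filter by auto
  ultimately have "negligible (ball a e)"
    by (metis negligible_iff_null_sets negligible_subset null_sets_completionI order_trans)
  then show False using open_not_negligible[of "ball a e"] assms(2) by simp
qed

text \<open>A translation by an arbitrary \<open>z\<close> is a composition of two translations for which the
  estimate holds, because almost every \<open>z'\<close> near \<open>z / 2\<close> is such that \<open>z'\<close> and \<open>z - z'\<close> are both good.\<close>

lemma translation_estimate_all:
  fixes \<kappa> :: "'a::euclidean_space \<times> 'a \<Rightarrow> real"
  assumes ae: "AE z in lborel. AE (x, y) in lborel. norm (x - y) < 1 \<and> norm z < 1 \<longrightarrow>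
       norm (x - y) powr p * \<bar>\<kappa> (x + z, y + z) - \<kappa> (x, y)\<bar> \<le> \<Gamma> * norm z powr s"
    and "0 \<le> \<Gamma>" "0 < s" and z: "z \<noteq> 0" "norm z < 1"
  shows "AE (x, y) in lborel. norm (x - y) < 1 \<longrightarrow>
       norm (x - y) powr p * \<bar>\<kappa> (x + z, y + z) - \<kappa> (x, y)\<bar> \<le> 2 * \<Gamma> * norm z powr s"
proof -
  define good where "good z \<longleftrightarrow> (AE q in lborel. norm (fst q - snd q) < 1 \<and> norm z < 1 \<longrightarrow>
       norm (fst q - snd q) powr p * \<bar>\<kappa> (q + (z, z)) - \<kappa> q\<bar> \<le> \<Gamma> * norm z powr s)" for z
  have g: "AE z in lborel. good z"
    using ae by (simp add: good_def case_prod_unfold plus_prod_def)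
  from AE_lborel_reflect[OF g, of z] g have "AE z' in lborel. good z' \<and> good (z - z')"
    by eventually_elim simp
  \<comment> \<open>Radius |z|/2 about z/2 makes both a and z - a no longer than z. Both steps then
    stay below 1, and the two bounds add up to 2 \<Gamma> |z|^s.\<close>
  from AE_lborel_ball_exists[OF this, of "norm z / 2" "z /\<^sub>R 2"] z
  obtain a where a: "dist (z /\<^sub>R 2) a < norm z / 2" "good a" "good (z - a)" by auto
  define b where "b = z - a"
  have half: "z /\<^sub>R 2 + z /\<^sub>R 2 = z" by (simp flip: scaleR_add_left)
  have na: "norm a \<le> norm z"
    using a(1) norm_triangle_ineq4[of "z /\<^sub>R 2" "z /\<^sub>R 2 - a"] by (simp add: dist_norm)
  have "b = z /\<^sub>R 2 + (z /\<^sub>R 2 - a)" using half by (simp add: b_def add_diff_eq)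
  then have nb: "norm b \<le> norm z"
    using a(1) norm_triangle_ineq[of "z /\<^sub>R 2" "z /\<^sub>R 2 - a"] by (simp add: dist_norm)
  have "AE q in lborel. norm (fst q - snd q) < 1 \<and> norm a < 1 \<longrightarrow>
       norm (fst q - snd q) powr p * \<bar>\<kappa> (q + (b, b) + (a, a)) - \<kappa> (q + (b, b))\<bar> \<le> \<Gamma> * norm a powr s"
    using AE_lborel_shift[OF a(2)[unfolded good_def], of "(b, b)"] by simp
  then have "AE q in lborel. norm (fst q - snd q) < 1 \<longrightarrow>
       norm (fst q - snd q) powr p * \<bar>\<kappa> (q + (z, z)) - \<kappa> q\<bar> \<le> 2 * \<Gamma> * norm z powr s"
    using a(3)[unfolded good_def b_def[symmetric]]
  proof eventually_elim
    case (elim q)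
    show ?case
    proof
      assume q: "norm (fst q - snd q) < 1"
      let ?t = "norm (fst q - snd q) powr p"
      have e: "q + (b, b) + (a, a) = q + (z, z)" by (simp add: b_def prod_eq_iff)
      have 1: "?t * \<bar>\<kappa> (q + (z, z)) - \<kappa> (q + (b, b))\<bar> \<le> \<Gamma> * norm a powr s"
        using elim(1) q na z(2) unfolding e by simp
      have 2: "?t * \<bar>\<kappa> (q + (b, b)) - \<kappa> q\<bar> \<le> \<Gamma> * norm b powr s"
        using elim(2) q nb z(2) by simp
      have "?t * \<bar>\<kappa> (q + (z, z)) - \<kappa> q\<bar> \<le> ?t * (\<bar>\<kappa> (q + (z, z)) - \<kappa> (q + (b, b))\<bar> + \<bar>\<kappa> (q + (b, b)) - \<kappa> q\<bar>)"
        by (intro mult_left_mono) auto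
      also have "\<dots> \<le> \<Gamma> * norm a powr s + \<Gamma> * norm b powr s"
        using 1 2 by (simp add: distrib_left)
      also have "\<dots> \<le> \<Gamma> * norm z powr s + \<Gamma> * norm z powr s"
        using na nb assms(2,3) by (intro add_mono mult_left_mono powr_mono2) auto
      finally show "?t * \<bar>\<kappa> (q + (z, z)) - \<kappa> q\<bar> \<le> 2 * \<Gamma> * norm z powr s" by simp
    qed
  qed
  then show ?thesis by (simp add: case_prod_unfold plus_prod_def)
qed

lemma cross_energy_eq:
  "(\<integral>\<^sup>+(x, y) \<in> cross_set U. ennreal ((w x - w y)\<^sup>2) * K (x, y) \<partial>lebesgue)
    = (\<integral>\<^sup>+p. ennreal ((w (fst p) - w (snd p))\<^sup>2) * K p * indicator (cross_set U) p \<partial>lborel)"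
  unfolding nn_integral_completion by (simp add: case_prod_unfold)

text \<open>Supplies the locale with Borel versions of the kernel and the solution. The constant
  \<open>2 * \<Gamma>\<close> is the cost of passing from almost every translation to all of
  them.\<close>

lemma solution_borel_version:
  fixes s \<beta> lam Lam M \<Gamma> r R :: real and \<Omega> A :: "(real^'n) set"
    and K :: "(real^'n) \<times> (real^'n) \<Rightarrow> ennreal" and f u :: "real^'n \<Rightarrow> real"
  assumes par: "0 < s" "s < 1" "0 < \<beta>" "0 < lam" "lam \<le> Lam" "0 < M" "0 < \<Gamma>" "0 < r" "r \<le> 1"
    and \<Omega>: "open \<Omega>" and A: "A \<noteq> {}"
    and nbhd: "\<And>x. infdist x A \<le> 7 * r \<Longrightarrow> x \<in> \<Omega>" "\<And>x. infdist x A \<le> 7 * r \<Longrightarrow> norm x \<le> R"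
    and K: "kernel_conditions s \<beta> lam Lam M \<Gamma> K" and f: "f \<in> Lp_space 2 \<Omega>"
    and u: "u \<in> X_space K \<Omega> \<inter> weighted_L1_space \<beta>" and sol: "is_solution K \<Omega> f u"
  obtains \<kappa> u' where "nonlocal_solution s \<beta> lam Lam M (2 * \<Gamma>) r R (Lp_norm 2 \<Omega> f) \<Omega> A \<kappa> u'"
    and "AE x in lborel. u x = u' x"
    and "nonlocal_solution.data \<beta> (Lp_norm 2 \<Omega> f) \<Omega> u' = Lp_norm 2 \<Omega> u + weighted_L1_norm \<beta> u + Lp_norm 2 \<Omega> f"
    and "sqrt (nonlocal_solution.n2 \<Omega> u') = Lp_norm 2 \<Omega> u"
proof -
  let ?D = "real CARD('n)"
  have \<Omega>b [measurable]: "\<Omega> \<in> sets borel" using \<Omega> by simp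
  note Kc = K[unfolded kernel_conditions_def]
  have Km: "(\<lambda>p. enn2real (K p)) \<in> borel_measurable (completion lborel)"
    using Kc by auto
  from completion_ex_borel_measurable_real[OF Km] obtain \<kappa>0 where
    \<kappa>0: "\<kappa>0 \<in> borel_measurable lborel" "AE p in lborel. enn2real (K p) = \<kappa>0 p" by blast
  \<comment> \<open>A Borel version may be negative on a null set; clipping gives nonnegativity
    everywhere, as the locale demands.\<close>
  define \<kappa> where "\<kappa> p = max 0 (\<kappa>0 p)" for p
  have \<kappa>m [measurable]: "\<kappa> \<in> borel_measurable borel"
    using \<kappa>0(1) unfolding \<kappa>_def by simp
  have \<kappa>: "AE p in lborel. enn2real (K p) = \<kappa> p"
    using \<kappa>0(2)
  proof eventually_elim
    case (elim p)
    then show ?case using enn2real_nonneg[of "K p"] by (simp add: \<kappa>_def)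
  qed
  have um: "u \<in> borel_measurable (completion lborel)" using u by (simp add: X_space_def)
  from completion_ex_borel_measurable_real[OF um] obtain u' where
    u'm [measurable]: "u' \<in> borel_measurable borel" and u': "AE x in lborel. u x = u' x" by auto
  have u'1: "AE p in (lborel :: ((real^'n) \<times> (real^'n)) measure). u (fst p) = u' (fst p)"
    "AE p in (lborel :: ((real^'n) \<times> (real^'n)) measure). u (snd p) = u' (snd p)"
    by (rule AE_lborel_pair_fst[OF u']) (rule AE_lborel_pair_snd[OF u'])
  have off: "AE p in (lborel :: ((real^'n) \<times> (real^'n)) measure). fst p \<noteq> snd p"
    using AE_lborel_diagonal by (simp add: case_prod_unfold)
  have near: "AE p in lborel. norm (fst p - snd p) < 1 \<longrightarrow>
         ennreal lam \<le> ennreal (norm (fst p - snd p) powr (?D + 2 * s)) * K p \<and>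
         ennreal (norm (fst p - snd p) powr (?D + 2 * s)) * K p \<le> ennreal Lam"
    using Kc by (simp add: AE_completion_iff case_prod_unfold)
  have far: "AE p in lborel. norm (fst p - snd p) \<ge> 1 \<longrightarrow>
         ennreal (norm (fst p - snd p) powr (?D + \<beta>)) * K p \<le> ennreal M"
    using Kc by (simp add: AE_completion_iff case_prod_unfold)
  \<comment> \<open>Off the diagonal the power of the distance is positive, so the upper kernel
    bounds force finiteness; only then do \<open>K\<close> and its real version agree almost
    everywhere.\<close>
  have fin: "AE p in lborel. K p < \<infinity>"
    using near far off
  proof eventually_elim
    case (elim p)
    show ?case
    proof (cases "norm (fst p - snd p) < 1")
      case True
      then show ?thesis using elim par
        by (intro ennreal_mult_le_enn2real(1)[of "norm (fst p - snd p) powr (?D + 2 * s)" Lam]) auto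
    next
      case False
      then show ?thesis using elim par
        by (intro ennreal_mult_le_enn2real(1)[of "norm (fst p - snd p) powr (?D + \<beta>)" M]) auto
    qed
  qed
  have near': "AE p in lborel. norm (fst p - snd p) < 1 \<longrightarrow>
         lam \<le> norm (fst p - snd p) powr (?D + 2 * s) * \<kappa> p \<and>
         norm (fst p - snd p) powr (?D + 2 * s) * \<kappa> p \<le> Lam"
    using near off fin \<kappa>
  proof eventually_elim
    case (elim p)
    have t: "0 < norm (fst p - snd p) powr (?D + 2 * s)" using elim(2) by simp
    show ?case
      using elim(1) le_ennreal_mult_enn2real[OF t _ elim(3)] ennreal_mult_le_enn2real(2)[OF t, of Lam "K p"] par
      unfolding elim(4) by auto
  qed
  have far': "AE p in lborel. norm (fst p - snd p) \<ge> 1 \<longrightarrow>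
         norm (fst p - snd p) powr (?D + \<beta>) * \<kappa> p \<le> M"
    using far off \<kappa>
  proof eventually_elim
    case (elim p)
    have t: "0 < norm (fst p - snd p) powr (?D + \<beta>)" using elim(2) by simp
    show ?case
      using elim(1) ennreal_mult_le_enn2real(2)[OF t, of M "K p"] par unfolding elim(3) by auto
  qed
  have tr: "AE (x, y) in lborel. norm (x - y) < 1 \<longrightarrow>
       norm (x - y) powr (?D + 2 * s) * \<bar>\<kappa> (x + z, y + z) - \<kappa> (x, y)\<bar> \<le> 2 * \<Gamma> * norm z powr s"
    if z: "z \<noteq> 0" "norm z < 1" for z
  proof (rule translation_estimate_all[OF _ _ par(1) z])
    have "AE (x, y, z) in lborel. norm (x - y) < 1 \<and> norm z < 1 \<longrightarrow>
         norm (x - y) powr (?D + 2 * s) *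
           \<bar>enn2real (K (x + z, y + z)) - enn2real (K (x, y))\<bar> \<le> \<Gamma> * norm z powr s"
      using Kc unfolding AE_completion_iff by blast
    from AE_lborel_triple_swap[OF this]
    show "AE z in lborel. AE (x, y) in lborel. norm (x - y) < 1 \<and> norm z < 1 \<longrightarrow>
       norm (x - y) powr (?D + 2 * s) * \<bar>\<kappa> (x + z, y + z) - \<kappa> (x, y)\<bar> \<le> \<Gamma> * norm z powr s"
    proof eventually_elim
      case (elim z)
      from elim AE_lborel_shift[OF \<kappa>, of "(z, z)"] \<kappa> show ?case
        by eventually_elim (auto simp: plus_prod_def)
    qed
  qed (use par in auto)
  have u2: "integrable lborel (\<lambda>x. (indicator \<Omega> x * u' x)\<^sup>2)"
  proof -
    have "AE x in lborel. x \<in> \<Omega> \<longrightarrow> u x = u' x" using u' by eventually_elim simp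
    from integrable_lebesgue_on_sq[OF \<Omega>b u'm this] show ?thesis
      using u by (simp add: X_space_def Lp_space_2)
  qed
  have uw: "AE x in lborel. \<bar>u x\<bar> / (1 + norm x powr (?D + \<beta>)) = \<bar>u' x\<bar> / (1 + norm x powr (?D + \<beta>))"
    using u' by eventually_elim simp
  have u1: "integrable lborel (\<lambda>x. \<bar>u' x\<bar> / (1 + norm x powr (?D + \<beta>)))"
    using integrable_lebesgue_AE[OF uw] u by (simp add: weighted_L1_space_def)
  have ue: "integrable lborel (\<lambda>(x, y). indicator (- ((- \<Omega>) \<times> (- \<Omega>))) (x, y) * ((u' x - u' y)\<^sup>2 * \<kappa> (x, y)))"
    unfolding case_prod_unfold
  proof (rule integrableI_bounded)
    let ?f = "\<lambda>p. indicator (- ((- \<Omega>) \<times> (- \<Omega>))) (fst p, snd p) * ((u' (fst p) - u' (snd p))\<^sup>2 * \<kappa> (fst p, snd p))"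
    have "open (- ((- \<Omega>) \<times> (- \<Omega>)))"
      using \<Omega> by (intro open_Compl closed_Times closed_Compl)
    then have [measurable]: "- ((- \<Omega>) \<times> (- \<Omega>)) \<in> sets borel" by simp
    show "?f \<in> borel_measurable lborel" by simp
    have "(\<integral>\<^sup>+p. ennreal (norm (?f p)) \<partial>lborel) = (\<integral>\<^sup>+(x, y) \<in> cross_set \<Omega>. ennreal ((u x - u y)\<^sup>2) * K (x, y) \<partial>lebesgue)"
      unfolding cross_energy_eq
    proof (rule nn_integral_cong_AE)
      show "AE p in lborel. ennreal (norm (?f p)) = ennreal ((u (fst p) - u (snd p))\<^sup>2) * K p * indicator (cross_set \<Omega>) p"
        using \<kappa> fin u'1
      proof eventually_elim
        case (elim p)
        then have "K p = ennreal (\<kappa> p)" by (metis ennreal_enn2real infinity_ennreal_def)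
        then show ?case using elim
          by (auto simp: case_prod_unfold cross_set_def mem_Times_iff Compl_eq_Diff_UNIV[symmetric] \<kappa>_def indicator_def ennreal_mult)
      qed
    qed
    also have "\<dots> < \<infinity>" using u by (simp add: X_space_def)
    finally show "(\<integral>\<^sup>+p. ennreal (norm (?f p)) \<partial>lborel) < \<infinity>" .
  qed
  \<comment> \<open>Finite energy for the Borel kernel places \<phi> in
    \<open>X0_space K \<Omega>\<close>, so the equation may be tested with it; Cauchy-Schwarz on
    \<Omega> bounds the right-hand side.\<close>
  have so: "\<bar>bform \<kappa> u' \<phi>\<bar> \<le> Lp_norm 2 \<Omega> f * sqrt (l2sq \<phi>)"
    if \<phi>: "\<phi> \<in> frac_sobolev s r" "\<And>x. x \<notin> \<Omega> \<Longrightarrow> \<phi> x = 0" "integrable lborel (\<lambda>(x, y). (\<phi> x - \<phi> y)\<^sup>2 * \<kappa> (x, y))" for \<phi>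
  proof -
    have \<phi>m [measurable]: "\<phi> \<in> borel_measurable borel" and \<phi>2: "integrable lborel (\<lambda>x. (\<phi> x)\<^sup>2)"
      using \<phi> by (auto simp: frac_sobolev_def)
    have \<phi>ind: "indicator \<Omega> x * \<phi> x = \<phi> x" for x
      using \<phi>(2)[of x] by (auto simp: indicator_def)
    have \<phi>l: "\<phi> \<in> borel_measurable lebesgue" by (rule measurable_completion) simp
    then have \<phi>l': "\<phi> \<in> borel_measurable (lebesgue_on \<Omega>)" by (rule measurable_restrict_space1)
    have \<phi>L: "\<phi> \<in> Lp_space 2 \<Omega>"
      using integrable_lebesgue_on_sq[OF \<Omega>b \<phi>m, of \<phi>] \<phi>l' \<phi>2 by (simp add: Lp_space_2 \<phi>ind)
    have "(\<integral>\<^sup>+(x, y) \<in> cross_set \<Omega>. ennreal ((\<phi> x - \<phi> y)\<^sup>2) * K (x, y) \<partial>lebesgue)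
      \<le> (\<integral>\<^sup>+p. ennreal ((\<phi> (fst p) - \<phi> (snd p))\<^sup>2 * \<kappa> p) \<partial>lborel)"
      unfolding cross_energy_eq
    proof (rule nn_integral_mono_AE)
      show "AE p in lborel. ennreal ((\<phi> (fst p) - \<phi> (snd p))\<^sup>2) * K p * indicator (cross_set \<Omega>) p
        \<le> ennreal ((\<phi> (fst p) - \<phi> (snd p))\<^sup>2 * \<kappa> p)"
        using \<kappa> fin
      proof eventually_elim
        case (elim p)
        then have "K p = ennreal (\<kappa> p)" by (metis ennreal_enn2real infinity_ennreal_def)
        then show ?case
          by (auto simp: case_prod_unfold indicator_def ennreal_mult \<kappa>_def)
      qed
    qed
    also have "\<dots> < \<infinity>"
      using \<phi>(3) by (auto simp: integrable_iff_bounded case_prod_unfold \<kappa>_def abs_mult)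
    finally have "\<phi> \<in> X0_space K \<Omega>"
      using \<phi>l \<phi>L \<phi>(2) by (auto simp: X0_space_def X_space_def)
    then have "energy_form K u \<phi> = (\<integral>x. f x * \<phi> x \<partial>lebesgue_on \<Omega>)"
      using sol by (simp add: is_solution_def)
    moreover have "energy_form K u \<phi> = bform \<kappa> u' \<phi>"
      unfolding energy_form_def bform_def
    proof (rule integral_lebesgue_AE)
      show "AE p in lborel. (case p of (x, y) \<Rightarrow> (u x - u y) * (\<phi> x - \<phi> y) * enn2real (K (x, y)))
        = (case p of (x, y) \<Rightarrow> (u' x - u' y) * (\<phi> x - \<phi> y) * \<kappa> (x, y))"
        using \<kappa> u'1 by eventually_elim (auto simp: case_prod_unfold)
    qed (simp add: case_prod_unfold)
    ultimately have "bform \<kappa> u' \<phi> = (\<integral>x. f x * \<phi> x \<partial>lebesgue_on \<Omega>)" by simp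
    also have "\<bar>\<dots>\<bar> \<le> (\<integral>x. \<bar>f x * \<phi> x\<bar> \<partial>lebesgue_on \<Omega>)" by (rule integral_abs_bound)
    also have "\<dots> \<le> Lp_norm 2 \<Omega> f * Lp_norm 2 \<Omega> \<phi>"
      unfolding Lp_norm_2 by (rule Cauchy_Schwarz_integral(2)) (use f \<phi>L in \<open>auto simp: Lp_space_2\<close>)
    also have "Lp_norm 2 \<Omega> \<phi> = sqrt (l2sq \<phi>)"
      using Lp_norm_2_borel[OF \<Omega>b \<phi>m, of \<phi>] by (simp add: \<phi>ind)
    finally show ?thesis .
  qed
  have N: "nonlocal_solution s \<beta> lam Lam M (2 * \<Gamma>) r R (Lp_norm 2 \<Omega> f) \<Omega> A \<kappa> u'"
    by unfold_locales (use par A nbhd near' far' tr u2 u1 ue so in \<open>auto simp: case_prod_unfold \<kappa>_def[of p for p] Lp_norm_2\<close>)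
  interpret nonlocal_solution s \<beta> lam Lam M "2 * \<Gamma>" r R "Lp_norm 2 \<Omega> f" \<Omega> A \<kappa> u' by (rule N)
  have "AE x in lborel. x \<in> \<Omega> \<longrightarrow> u x = u' x" using u' by eventually_elim simp
  from Lp_norm_2_borel[OF \<Omega>b u'm this] have n: "sqrt n2 = Lp_norm 2 \<Omega> u" by (simp add: n2_def)
  have "n1 = weighted_L1_norm \<beta> u"
    using integral_lebesgue_AE[OF uw] by (simp add: n1_def weighted_L1_norm_def)
  then show ?thesis using that[OF N u'] n by (simp add: data_def)
qed

section \<open>The regularity estimate\<close>

lemma second_diff_AE:
  fixes u v :: "real^'n \<Rightarrow> real"
  assumes "AE x in lborel. u x = v x"
  shows "AE x in lborel. second_diff z u x = second_diff z v x"
  using assms AE_lborel_shift[OF assms, of z] AE_lborel_shift[OF assms, of "2 *\<^sub>R z"]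
  by eventually_elim (simp add: second_diff_def)

text \<open>\<open>W\<close> is any globally square integrable function that agrees with the second
  difference on the shift set. This serves both short steps, with \<open>W\<close> built from
  cut-offs, and long ones, with \<open>W\<close> built from the zero extension.\<close>

lemma Lp_norm_second_diff_le:
  fixes u u' :: "real^'n \<Rightarrow> real"
  assumes V: "open V" and u': "AE x in lborel. u x = u' x" "u' \<in> borel_measurable borel"
    and W: "integrable lborel (\<lambda>x. (W x)\<^sup>2)" "W \<in> borel_measurable borel"
    and eq: "\<And>x. x \<in> V \<Longrightarrow> x + z \<in> V \<Longrightarrow> x + 2 *\<^sub>R z \<in> V \<Longrightarrow> W x = u' (x + 2 *\<^sub>R z) - 2 * u' (x + z) + u' x"
  shows "Lp_norm 2 (shift_set V z) (second_diff z u) \<le> sqrt (l2sq W)"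
proof -
  note [measurable] = W(2)
  have "shift_set V z = V \<inter> (\<lambda>x. x + z) -` V \<inter> (\<lambda>x. x + 2 *\<^sub>R z) -` V"
    by (auto simp: shift_set_def)
  also have "open \<dots>"
    using V by (intro open_Int open_vimage continuous_intros)
  finally have S [measurable]: "shift_set V z \<in> sets borel" by simp
  have "AE x in lborel. x \<in> shift_set V z \<longrightarrow> second_diff z u x = W x"
    using second_diff_AE[OF u'(1), of z]
    by eventually_elim (auto simp: shift_set_def eq second_diff_def)
  from Lp_norm_2_borel[OF S W(2) this]
  have e: "Lp_norm 2 (shift_set V z) (second_diff z u) = sqrt (l2sq (\<lambda>x. indicator (shift_set V z) x * W x))" .
  have le: "(indicator (shift_set V z) x * W x)\<^sup>2 \<le> (W x)\<^sup>2" for x by (auto simp: indicator_def)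
  have "integrable lborel (\<lambda>x. (indicator (shift_set V z) x * W x)\<^sup>2)"
    by (rule Bochner_Integration.integrable_bound[OF W(1)]) (use le in auto)
  then show ?thesis
    unfolding e l2sq_def by (intro real_sqrt_le_mono integral_mono W(1) le)
qed

text \<open>The 4 is 1 + 2 + 1 from the triangle inequality, obtained here as the square root of 4 +
  8 + 4.\<close>

lemma l2sq_second_diff:
  fixes v :: "'a::euclidean_space \<Rightarrow> real" and z :: 'a
  assumes v: "integrable lborel (\<lambda>x. (v x)\<^sup>2)" and [measurable]: "v \<in> borel_measurable borel"
  defines "W \<equiv> \<lambda>x. v (x + 2 *\<^sub>R z) - 2 * v (x + z) + v x"
  shows "integrable lborel (\<lambda>x. (W x)\<^sup>2)" "W \<in> borel_measurable borel" "sqrt (l2sq W) \<le> 4 * sqrt (l2sq v)"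
proof -
  show m [measurable]: "W \<in> borel_measurable borel" unfolding W_def by measurable
  have sh: "has_bochner_integral lborel (\<lambda>x. (v (x + y))\<^sup>2) (l2sq v)" for y
    using integrable_lborel_shift[OF v, of y] integral_lborel_shift[of "\<lambda>x. (v x)\<^sup>2" y]
    by (simp add: has_bochner_integral_iff l2sq_def)
  let ?g = "\<lambda>x. 4 * (v (x + 2 *\<^sub>R z))\<^sup>2 + 8 * (v (x + z))\<^sup>2 + 4 * (v (x + 0))\<^sup>2"
  have g: "has_bochner_integral lborel ?g (4 * l2sq v + 8 * l2sq v + 4 * l2sq v)"
    by (intro has_bochner_integral_add has_bochner_integral_mult_right sh)
  have le: "(W x)\<^sup>2 \<le> ?g x" for x
  proof -
    have "(W x)\<^sup>2 = ((v (x + 2 *\<^sub>R z) + v x) + (- 2 * v (x + z)))\<^sup>2" by (simp add: W_def algebra_simps)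
    also have "\<dots> \<le> 2 * (v (x + 2 *\<^sub>R z) + v x)\<^sup>2 + 2 * (- 2 * v (x + z))\<^sup>2" by (rule power2_sum_le)
    finally show ?thesis using power2_sum_le[of "v (x + 2 *\<^sub>R z)" "v x"] by (simp add: power_mult_distrib)
  qed
  have ig: "integrable lborel ?g" using g by (simp add: has_bochner_integral_iff)
  show i: "integrable lborel (\<lambda>x. (W x)\<^sup>2)"
    by (rule Bochner_Integration.integrable_bound[OF ig]) (use le in auto)
  have "l2sq W \<le> 16 * l2sq v"
    using integral_mono[OF i ig le] has_bochner_integral_integral_eq[OF g] by (simp add: l2sq_def)
  then have "sqrt (l2sq W) \<le> sqrt (16 * l2sq v)" by (rule real_sqrt_le_mono)
  also have "\<dots> = 4 * sqrt (l2sq v)" by (simp add: real_sqrt_mult)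
  finally show "sqrt (l2sq W) \<le> 4 * sqrt (l2sq v)" .
qed

text \<open>The radius and the bound on norms are fixed by the subdomain and \<Omega> before the
  kernel, the right-hand side and the solution are introduced; this makes the constant
  uniform.\<close>

lemma regularity_on_subdomain:
  fixes s \<beta> lam Lam M \<Gamma> :: real and \<Omega> V :: "(real^'n) set"
  assumes par: "0 < s" "s < 1" "\<beta> > 0" "open \<Omega>" "lam > 0" "Lam \<ge> lam" "M > 0" "\<Gamma> > 0"
    and V: "domain_set V" "compactly_contained V \<Omega>"
  shows "\<exists>C > 0. \<forall>K f u. kernel_conditions s \<beta> lam Lam M \<Gamma> K \<and> f \<in> Lp_space 2 \<Omega> \<and>
      u \<in> X_space K \<Omega> \<inter> weighted_L1_space \<beta> \<and> is_solution K \<Omega> f u \<longrightarrow>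
      u \<in> nikolskii_space (2 * s) 2 V \<and>
      nikolskii_norm (2 * s) 2 V u \<le> C * (Lp_norm 2 \<Omega> u + weighted_L1_norm \<beta> u + Lp_norm 2 \<Omega> f)"
proof -
  define A where "A = closure V"
  have A: "compact A" "A \<subseteq> \<Omega>" "A \<noteq> {}" "closed A" and Vo: "open V" and VA: "V \<subseteq> A"
    using V by (auto simp: A_def compactly_contained_def domain_set_def closure_subset)
  have V\<Omega>: "V \<subseteq> \<Omega>" using VA A by auto
  obtain e where e: "0 < e" "(\<Union>x\<in>A. cball x e) \<subseteq> \<Omega>"
    using compact_subset_open_imp_cball_epsilon_subset[OF A(1) par(4) A(2)] by blast
  \<comment> \<open>The seven layers have to fit into the tube of radius \<open>e\<close> inside
    \<Omega>, and r \<le> 1 keeps the cut within the range of the two-sided kernel bound.\<close>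
  define r where "r = min 1 (e / 7)"
  have r: "0 < r" "r \<le> 1" "7 * r \<le> e" using e by (auto simp: r_def)
  obtain B where B: "\<And>x. x \<in> A \<Longrightarrow> norm x \<le> B"
    using compact_imp_bounded[OF A(1)] by (auto simp: bounded_iff)
  have nb: "x \<in> \<Omega>" "norm x \<le> B + 7 * r" if x: "infdist x A \<le> 7 * r" for x
  proof -
    obtain a where a: "a \<in> A" "infdist x A = dist x a"
      using infdist_attains_inf[OF A(4,3)] by blast
    then have d: "dist a x \<le> 7 * r" using x by (simp add: dist_commute)
    then show "x \<in> \<Omega>" using e(2) a(1) r(3) by force
    have "norm x \<le> norm a + dist a x"
      using norm_triangle_sub[of x a] by (simp add: dist_norm norm_minus_commute)
    then show "norm x \<le> B + 7 * r" using B[OF a(1)] d by simp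
  qed
  \<comment> \<open>The first term serves steps shorter than \<open>r\<close>, the second longer
    ones; the absolute value makes positivity immediate. \<open>reg_const\<close> depends on none of
    the kernel, the right-hand side and the solution.\<close>
  define Cr where "Cr = \<bar>nonlocal_solution.reg_const TYPE(real^'n) s \<beta> lam Lam M (2 * \<Gamma>) r (B + 7 * r)\<bar> + 4 * r powr (- (2 * s))"
  have Cr: "0 < Cr" using r unfolding Cr_def by (intro add_nonneg_pos) auto
  have main: "u \<in> nikolskii_space (2 * s) 2 V \<and>
      nikolskii_norm (2 * s) 2 V u \<le> (1 + Cr) * (Lp_norm 2 \<Omega> u + weighted_L1_norm \<beta> u + Lp_norm 2 \<Omega> f)"
    if K: "kernel_conditions s \<beta> lam Lam M \<Gamma> K" and f: "f \<in> Lp_space 2 \<Omega>"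
      and u: "u \<in> X_space K \<Omega> \<inter> weighted_L1_space \<beta>" and sol: "is_solution K \<Omega> f u" for K f u
  proof -
    obtain \<kappa> u' where N: "nonlocal_solution s \<beta> lam Lam M (2 * \<Gamma>) r (B + 7 * r) (Lp_norm 2 \<Omega> f) \<Omega> A \<kappa> u'"
      and u': "AE x in lborel. u x = u' x"
      and T: "nonlocal_solution.data \<beta> (Lp_norm 2 \<Omega> f) \<Omega> u' = Lp_norm 2 \<Omega> u + weighted_L1_norm \<beta> u + Lp_norm 2 \<Omega> f"
      and n2: "sqrt (nonlocal_solution.n2 \<Omega> u') = Lp_norm 2 \<Omega> u"
      by (rule solution_borel_version[OF par(1,2,3,5,6,7,8) r(1,2) par(4) A(3) nb K f u sol])
    interpret nonlocal_solution s \<beta> lam Lam M "2 * \<Gamma>" r "B + 7 * r" "Lp_norm 2 \<Omega> f" \<Omega> A \<kappa> u' by (rule N)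
    note T = T[symmetric] and n2' = n2[unfolded n2_def]
    have Lu: "Lp_norm 2 \<Omega> u \<le> data" using n1_nonneg nf unfolding data_def n2[symmetric] by simp
    have quot: "nikolskii_quotient (2 * s) 2 V u z \<le> Cr * data" if z: "z \<noteq> 0" for z
    proof (cases "norm z < r")
      case True
      obtain W where W: "integrable lborel (\<lambda>x. (W x)\<^sup>2)" "W \<in> borel_measurable borel"
        "sqrt (l2sq W) \<le> reg_const * norm z powr (2 * s) * data"
        "\<And>x. x \<in> A \<Longrightarrow> x + z \<in> A \<Longrightarrow> x + 2 *\<^sub>R z \<in> A \<Longrightarrow> W x = u' (x + 2 *\<^sub>R z) - 2 * u' (x + z) + u' x"
        by (rule second_difference_estimate[OF z True]) blast
      have "Lp_norm 2 (shift_set V z) (second_diff z u) \<le> sqrt (l2sq W)"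
        by (rule Lp_norm_second_diff_le[OF Vo u' u_measurable W(1,2)]) (use W(4) VA in auto)
      also have "\<dots> \<le> reg_const * norm z powr (2 * s) * data" by (rule W(3))
      finally have "nikolskii_quotient (2 * s) 2 V u z \<le> norm z powr (- (2 * s)) * (reg_const * norm z powr (2 * s) * data)"
        unfolding nikolskii_quotient_def by (rule mult_left_mono) simp
      also have "\<dots> = (norm z powr (2 * s) * norm z powr (- (2 * s))) * (reg_const * data)"
        by (simp only: mult_ac)
      also have "\<dots> = reg_const * data" using powr_mult_powr_minus[of "norm z" "2 * s"] z by simp
      also have "\<dots> \<le> Cr * data"
        by (rule mult_right_mono[OF _ data_nonneg]) (auto simp: Cr_def intro: add_increasing2)
      finally show ?thesis .
    next
      case False
      \<comment> \<open>The extension by zero is globally square integrable, and since V lies in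
        \<Omega> it has the same second differences on the shift set.\<close>
      let ?v = "\<lambda>x. indicator \<Omega> x * u' x"
      note W = l2sq_second_diff[of ?v z, OF u_L2]
      have "Lp_norm 2 (shift_set V z) (second_diff z u) \<le> sqrt (l2sq (\<lambda>x. ?v (x + 2 *\<^sub>R z) - 2 * ?v (x + z) + ?v x))"
        by (rule Lp_norm_second_diff_le[OF Vo u' u_measurable W(1,2)]) (use V\<Omega> in \<open>auto simp: indicator_def subset_eq\<close>)
      also have "\<dots> \<le> 4 * sqrt (l2sq ?v)" by (rule W(3)) measurable
      also have "\<dots> \<le> 4 * data" using Lu n2' by simp
      finally have "nikolskii_quotient (2 * s) 2 V u z \<le> norm z powr (- (2 * s)) * (4 * data)"
        unfolding nikolskii_quotient_def by (rule mult_left_mono) simp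
      also have "\<dots> \<le> r powr (- (2 * s)) * (4 * data)"
        using False r par(1) data_nonneg by (intro mult_right_mono powr_mono2') auto
      also have "\<dots> \<le> Cr * data"
        using data_nonneg unfolding Cr_def by (simp add: algebra_simps)
      finally show ?thesis .
    qed
    have Vb [measurable]: "V \<in> sets borel" using Vo by simp
    have uV: "AE x in lborel. x \<in> V \<longrightarrow> u x = u' x" using u' by eventually_elim simp
    have le: "(indicator V x * u' x)\<^sup>2 \<le> (indicator \<Omega> x * u' x)\<^sup>2" for x
      using V\<Omega> by (auto simp: indicator_def)
    have iV: "integrable lborel (\<lambda>x. (indicator V x * u' x)\<^sup>2)"
      by (rule Bochner_Integration.integrable_bound[OF u_L2]) (use le in auto)
    have ul: "u \<in> borel_measurable (lebesgue_on V)"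
      using u by (intro measurable_restrict_space1) (simp add: X_space_def)
    have uLp: "u \<in> Lp_space 2 V"
      using integrable_lebesgue_on_sq[OF Vb u_measurable uV] iV ul by (simp add: Lp_space_2)
    have "l2sq (\<lambda>x. indicator V x * u' x) \<le> n2"
      unfolding l2sq_def n2_def by (rule integral_mono[OF iV u_L2 le])
    then have "Lp_norm 2 V u \<le> sqrt n2"
      using Lp_norm_2_borel[OF Vb u_measurable uV] by (simp add: real_sqrt_le_mono)
    then have nV: "Lp_norm 2 V u \<le> data" using Lu n2 by simp
    have bdd: "bdd_above (nikolskii_quotient (2 * s) 2 V u ` (UNIV - {0}))"
      using quot by (intro bdd_aboveI2) auto
    have ne: "UNIV - {0 :: real^'n} \<noteq> {}"
      using axis_eq_0_iff[of undefined "1::real"] by blast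
    have "nikolskii_seminorm (2 * s) 2 V u \<le> Cr * data"
      unfolding nikolskii_seminorm_def by (rule cSUP_least[OF ne]) (use quot in auto)
    then have "nikolskii_norm (2 * s) 2 V u \<le> (1 + Cr) * data"
      using nV unfolding nikolskii_norm_def by (simp add: algebra_simps)
    then show ?thesis using uLp bdd T by (simp add: nikolskii_space_def)
  qed
  show ?thesis
    by (rule exI[of _ "1 + Cr"]) (use Cr main in auto)
qed

theorem theorem2p2:
  fixes s \<beta> lam Lam M \<Gamma> :: real and \<Omega> :: "(real^'n) set"
  assumes "0 < s" "s < 1" and "\<beta> > 0" and "open \<Omega>"
    and "lam > 0" "Lam \<ge> lam" and "M > 0" and "\<Gamma> > 0"
  shows "\<exists>C :: (real^'n) set \<Rightarrow> real. (\<forall>\<Omega>'. C \<Omega>' > 0) \<and>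
    (\<forall>(K :: (real^'n) \<times> (real^'n) \<Rightarrow> ennreal) (f :: real^'n \<Rightarrow> real) (u :: real^'n \<Rightarrow> real).
      K \<in> borel_measurable lebesgue \<and>
      (AE (x, y) in lebesgue. K (x, y) = K (y, x)) \<and>
      (AE (x, y) in lebesgue. norm (x - y) < 1 \<longrightarrow>
         ennreal lam \<le> ennreal (norm (x - y) powr (real CARD('n) + 2 * s)) * K (x, y) \<and>
         ennreal (norm (x - y) powr (real CARD('n) + 2 * s)) * K (x, y) \<le> ennreal Lam) \<and>
      (AE (x, y) in lebesgue. norm (x - y) \<ge> 1 \<longrightarrow>
         0 \<le> ennreal (norm (x - y) powr (real CARD('n) + \<beta>)) * K (x, y) \<and>
         ennreal (norm (x - y) powr (real CARD('n) + \<beta>)) * K (x, y) \<le> ennreal M) \<and>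
      (AE (x, y, z) in lebesgue. norm (x - y) < 1 \<and> norm z < 1 \<longrightarrow>
         norm (x - y) powr (real CARD('n) + 2 * s) *
           \<bar>enn2real (K (x + z, y + z)) - enn2real (K (x, y))\<bar> \<le> \<Gamma> * norm z powr s) \<and>
      f \<in> Lp_space 2 \<Omega> \<and>
      u \<in> X_space K \<Omega> \<inter> weighted_L1_space \<beta> \<and>
      is_solution K \<Omega> f u
      \<longrightarrow>
      u \<in> nikolskii_loc_space (2 * s) 2 \<Omega> \<and>
      (\<forall>\<Omega>'. domain_set \<Omega>' \<and> compactly_contained \<Omega>' \<Omega> \<longrightarrow>
         nikolskii_norm (2 * s) 2 \<Omega>' u
           \<le> C \<Omega>' * (Lp_norm 2 \<Omega> u + weighted_L1_norm \<beta> u + Lp_norm 2 \<Omega> f)))"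
proof -
  define P where "P C V \<longleftrightarrow> 0 < C \<and> (\<forall>K f u. kernel_conditions s \<beta> lam Lam M \<Gamma> K \<and> f \<in> Lp_space 2 \<Omega> \<and>
      u \<in> X_space K \<Omega> \<inter> weighted_L1_space \<beta> \<and> is_solution K \<Omega> f u \<longrightarrow>
      u \<in> nikolskii_space (2 * s) 2 V \<and>
      nikolskii_norm (2 * s) 2 V u \<le> C * (Lp_norm 2 \<Omega> u + weighted_L1_norm \<beta> u + Lp_norm 2 \<Omega> f))" for C V
  \<comment> \<open>The constant is chosen per subdomain. The default 1 keeps it positive for sets
    that are not domains compactly contained in \<Omega>.\<close>
  define C where "C V = (if domain_set V \<and> compactly_contained V \<Omega> then SOME c. P c V else 1)" for V
  have P: "P (C V) V" if "domain_set V" "compactly_contained V \<Omega>" for V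
  proof -
    have "\<exists>c. P c V" using regularity_on_subdomain[OF assms that] unfolding P_def .
    then have "P (SOME c. P c V) V" by (rule someI_ex)
    moreover have "C V = (SOME c. P c V)" using that by (simp add: C_def)
    ultimately show ?thesis by (simp only:)
  qed
  have "0 < C V" for V
    using P[of V] by (cases "domain_set V \<and> compactly_contained V \<Omega>") (auto simp: P_def C_def)
  moreover have "u \<in> nikolskii_loc_space (2 * s) 2 \<Omega> \<and>
      (\<forall>V. domain_set V \<and> compactly_contained V \<Omega> \<longrightarrow>
         nikolskii_norm (2 * s) 2 V u \<le> C V * (Lp_norm 2 \<Omega> u + weighted_L1_norm \<beta> u + Lp_norm 2 \<Omega> f))"
    if "kernel_conditions s \<beta> lam Lam M \<Gamma> K" "f \<in> Lp_space 2 \<Omega>"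
      "u \<in> X_space K \<Omega> \<inter> weighted_L1_space \<beta>" "is_solution K \<Omega> f u" for K f u
    using P that unfolding P_def nikolskii_loc_space_def by blast
  ultimately show ?thesis
    by (intro exI[of _ C] conjI allI impI) (auto simp: kernel_conditions_def)
qed

end
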